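(* Let $s>0$ and consider the driven continuous generalized KMP process on $[0,\infty)^V$ with generator $$Lf(\zeta)=\sum_{i,j\in V}p(i,j)L_{ij}f(\zeta)+\sum_{i\in V}c(i)L_{\theta_i^*}f(\zeta).$$ Then: (a) If the process is started from a product measure of the form $\bigotimes_{i\in V}\nu_{\theta_i}$, then at time $t>0$ its distribution is $\mathbb{E}_\theta\big(\bigotimes_{i\in V}\nu_{\theta_i(t)}\big)$, where the process $(\theta_i(t),i\in V,t\ge0)$ (the hidden parameter model), started from $\theta=(\theta_i)_{i\in V}$, evolves according to the generator $$\sum_{i,j\in V}p(i,j)\mathcal{L}_{ij}+\sum_{i\in V}c(i)\mathcal{L}_{\theta_i^*}.\qquad(\star)$$ (b) The driven generalized KMP process converges to a unique stationary measure, which reads $\int\bigotimes_{i\in V}\nu_{\theta_i}\,\Xi[d\theta]$, where the mixture measure $\Xi$ is the unique stationary measure of the associated hidden parameter model, with generator $(\star)$. (c) In particular, if all the reservoir parameters are equal to a fixed value, i.e. $\theta_i^*=\theta^*$ for all $i\in V$, then this unique stationary measure is $\bigotimes_{i\in V}\nu_{\theta^*}$, and it is also reversible.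
   Context: $V$ is a finite set of vertices and $p(i,j)=p(j,i)\ge 0$ ($i,j\in V$) are symmetric edge weights which are irreducible: any two vertices are joined by a finite path along which $p>0$. In the sums $\sum_{i,j\in V}$ only pairs of distinct vertices contribute. The constants $c(i)\ge0$ tune the coupling of site $i\in V$ to a reservoir with parameter $\theta_i^*>0$. $\mathrm{Beta}(2s,2s)[du]=\frac{1}{B(2s,2s)}u^{2s-1}(1-u)^{2s-1}du$ on $[0,1]$, where $B(2s,2s)$ is the Beta function. For $\theta>0$, $\nu_\theta[dx]=\frac{x^{2s-1}}{\theta^{2s}\Gamma(2s)}e^{-x/\theta}dx$ on $[0,\infty)$ (Gamma distribution with shape parameter $2s$ and scale parameter $\theta$). Bulk generator of the process: $L_{ij}$ acts on the variables $(\zeta_i,\zeta_j)=(x,y)$ as $L_{ij}f(x,y)=\mathbb{E}\big(f(X(x+y),(1-X)(x+y))-f(x,y)\big)$, with $X\sim\mathrm{Beta}(2s,2s)$. Reservoir generator: $L_{\theta_i^*}$ acts on the variable $\zeta_i=x$ only, by $L_{\theta^*}f(x)=\mathbb{E}\big(f((x+Y)B)-f(x)\big)$ with $\theta^*=\theta_i^*$, where $Y\sim\nu_{\theta^*}$ and $B\sim\mathrm{Beta}(2s,2s)$ are independent. Hidden parameter generators (acting on functions on $[0,\infty)^V$): $\mathcal{L}_{ij}$ acts on $(\theta_i,\theta_j)=(x,y)$ as $\mathcal{L}_{ij}f(x,y)=\int_0^1\big(f(xu+y(1-u),xu+y(1-u))-f(x,y)\big)\mathrm{Beta}(2s,2s)[du]$;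 $\mathcal{L}_{\theta_i^*}$ acts on the variable $\theta_i$ only, by $\mathcal{L}_{\theta^*}f(\theta)=\int_0^1\big(f((1-u)\theta+u\theta^* )-f(\theta)\big)\mathrm{Beta}(2s,2s)[du]$ with $\theta^*=\theta_i^*$. $\mathbb{E}_\theta$ is expectation in the hidden parameter model started from $\theta$, and $\mathbb{E}_\theta(\bigotimes_i\nu_{\theta_i(t)})$ is the probability measure $A\mapsto\mathbb{E}_\theta\big[(\bigotimes_i\nu_{\theta_i(t)})(A)\big]$. Convergence refers to the distribution of the process as $t\to\infty$.
   Formalization: In (b) and (c) it is additionally assumed that c(i) > 0 for at least one site i; if all c(i) = 0, every product measure with equal parameters is stationary, so there is no unique stationary measure. Part (a) needs no such assumption. *)

theory Defs
  imports "HOL-Probability.Probability"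
begin

section \<open>State space and reference distributions\<close>

definition halfline :: "real measure" where
  "halfline = restrict_space borel {0..}"

text \<open>The finite vertex set is the universe of a type of class \<open>finite\<close>;
  the state space is $[0,\infty)^V$ with its product (equivalently, Borel) sigma-algebra.\<close>

definition config :: "('v::finite \<Rightarrow> real) measure" where
  "config = Pi\<^sub>M UNIV (\<lambda>_. halfline)"

definition beta_distr :: "real \<Rightarrow> real measure" where
  "beta_distr s = density (restrict_space lborel {0..1})
     (\<lambda>u. ennreal (1 / Beta (2 * s) (2 * s) * u powr (2 * s - 1) * (1 - u) powr (2 * s - 1)))"

text \<open>The Gamma law is parametrised by its scale \<open>\<theta> > 0\<close>. The value at \<open>\<theta> = 0\<close> is the weak
  limit as \<open>\<theta>\<close> tends to 0; it only serves to make \<open>\<nu> s\<close> a probability kernel on all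
  of $[0,\infty)$, the state space of a single hidden parameter.\<close>

definition \<nu> :: "real \<Rightarrow> real \<Rightarrow> real measure" where
  "\<nu> s \<theta> = (if \<theta> = 0 then return halfline 0
     else density (restrict_space lborel {0..})
       (\<lambda>x. ennreal (x powr (2 * s - 1) / (\<theta> powr (2 * s) * Gamma (2 * s)) * exp (- x / \<theta>))))"

definition \<nu>_prod :: "real \<Rightarrow> ('v::finite \<Rightarrow> real) \<Rightarrow> ('v \<Rightarrow> real) measure" where
  "\<nu>_prod s \<theta> = Pi\<^sub>M UNIV (\<lambda>i. \<nu> s (\<theta> i))"


section \<open>Generators\<close>

definition act_on_pair ::
  "'v \<Rightarrow> 'v \<Rightarrow> ((real \<Rightarrow> real \<Rightarrow> real) \<Rightarrow> real \<Rightarrow> real \<Rightarrow> real) \<Rightarrow>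
    (('v \<Rightarrow> real) \<Rightarrow> real) \<Rightarrow> ('v \<Rightarrow> real) \<Rightarrow> real" where
  "act_on_pair i j G f \<zeta> = G (\<lambda>x y. f (\<zeta>(i := x, j := y))) (\<zeta> i) (\<zeta> j)"

definition act_on_site ::
  "'v \<Rightarrow> ((real \<Rightarrow> real) \<Rightarrow> real \<Rightarrow> real) \<Rightarrow>
    (('v \<Rightarrow> real) \<Rightarrow> real) \<Rightarrow> ('v \<Rightarrow> real) \<Rightarrow> real" where
  "act_on_site i G f \<zeta> = G (\<lambda>x. f (\<zeta>(i := x))) (\<zeta> i)"

definition kmp_bulk :: "real \<Rightarrow> (real \<Rightarrow> real \<Rightarrow> real) \<Rightarrow> real \<Rightarrow> real \<Rightarrow> real" where
  "kmp_bulk s f x y = (\<integral>u. f (u * (x + y)) ((1 - u) * (x + y)) - f x y \<partial>beta_distr s)"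

definition kmp_reservoir :: "real \<Rightarrow> real \<Rightarrow> (real \<Rightarrow> real) \<Rightarrow> real \<Rightarrow> real" where
  "kmp_reservoir s \<theta>' f x = (\<integral>(y, b). f ((x + y) * b) - f x \<partial>(\<nu> s \<theta>' \<Otimes>\<^sub>M beta_distr s))"

definition hidden_bulk :: "real \<Rightarrow> (real \<Rightarrow> real \<Rightarrow> real) \<Rightarrow> real \<Rightarrow> real \<Rightarrow> real" where
  "hidden_bulk s f x y =
     (\<integral>u. f (x * u + y * (1 - u)) (x * u + y * (1 - u)) - f x y \<partial>beta_distr s)"

definition hidden_reservoir :: "real \<Rightarrow> real \<Rightarrow> (real \<Rightarrow> real) \<Rightarrow> real \<Rightarrow> real" where
  "hidden_reservoir s \<theta>' f x = (\<integral>u. f ((1 - u) * x + u * \<theta>') - f x \<partial>beta_distr s)"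

definition kmp_generator ::
  "real \<Rightarrow> ('v::finite \<Rightarrow> 'v \<Rightarrow> real) \<Rightarrow> ('v \<Rightarrow> real) \<Rightarrow> ('v \<Rightarrow> real) \<Rightarrow>
    (('v \<Rightarrow> real) \<Rightarrow> real) \<Rightarrow> ('v \<Rightarrow> real) \<Rightarrow> real" where
  "kmp_generator s p c \<theta>' f \<zeta> =
     (\<Sum>i\<in>UNIV. \<Sum>j\<in>UNIV - {i}. p i j * act_on_pair i j (kmp_bulk s) f \<zeta>) +
     (\<Sum>i\<in>UNIV. c i * act_on_site i (kmp_reservoir s (\<theta>' i)) f \<zeta>)"

definition hidden_generator ::
  "real \<Rightarrow> ('v::finite \<Rightarrow> 'v \<Rightarrow> real) \<Rightarrow> ('v \<Rightarrow> real) \<Rightarrow> ('v \<Rightarrow> real) \<Rightarrow>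
    (('v \<Rightarrow> real) \<Rightarrow> real) \<Rightarrow> ('v \<Rightarrow> real) \<Rightarrow> real" where
  "hidden_generator s p c \<theta>' f \<theta> =
     (\<Sum>i\<in>UNIV. \<Sum>j\<in>UNIV - {i}. p i j * act_on_pair i j (hidden_bulk s) f \<theta>) +
     (\<Sum>i\<in>UNIV. c i * act_on_site i (hidden_reservoir s (\<theta>' i)) f \<theta>)"

definition irreducible_weights :: "('v \<Rightarrow> 'v \<Rightarrow> real) \<Rightarrow> bool" where
  "irreducible_weights p \<longleftrightarrow> (\<forall>i j. (i, j) \<in> {(k, l). p k l > 0}\<^sup>*)"


section \<open>Markov processes\<close>

text \<open>A Markov process is given by its transition probabilities \<open>P t x\<close>: the law at time \<open>t\<close>
  of the process started from \<open>x\<close>. Started from an initial law \<open>\<mu>\<close>, it has law \<open>\<mu> \<bind> P t\<close>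
  at time \<open>t\<close>.\<close>

definition markov_semigroup :: "'a measure \<Rightarrow> (real \<Rightarrow> 'a \<Rightarrow> 'a measure) \<Rightarrow> bool" where
  "markov_semigroup M P \<longleftrightarrow>
     (\<forall>t\<ge>0. P t \<in> M \<rightarrow>\<^sub>M prob_algebra M) \<and>
     (\<forall>x\<in>space M. P 0 x = return M x) \<and>
     (\<forall>r\<ge>0. \<forall>t\<ge>0. \<forall>x\<in>space M. P (r + t) x = P r x \<bind> P t)"

text \<open>All jump rates are bounded here, so the generator is a bounded operator, defined on all
  bounded measurable functions as the derivative at \<open>t = 0\<close> of the semigroup in supremum norm.\<close>

definition has_generator ::
  "'a measure \<Rightarrow> (real \<Rightarrow> 'a \<Rightarrow> 'a measure) \<Rightarrow> (('a \<Rightarrow> real) \<Rightarrow> 'a \<Rightarrow> real) \<Rightarrow> bool" where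
  "has_generator M P L \<longleftrightarrow>
     (\<forall>f\<in>borel_measurable M. bounded (f ` space M) \<longrightarrow>
        uniform_limit (space M) (\<lambda>t x. ((\<integral>y. f y \<partial>P t x) - f x) / t) (L f) (at_right 0))"

definition markov_process_with_generator ::
  "'a measure \<Rightarrow> (('a \<Rightarrow> real) \<Rightarrow> 'a \<Rightarrow> real) \<Rightarrow> (real \<Rightarrow> 'a \<Rightarrow> 'a measure) \<Rightarrow> bool" where
  "markov_process_with_generator M L P \<longleftrightarrow> markov_semigroup M P \<and> has_generator M P L"

definition stationary :: "'a measure \<Rightarrow> (real \<Rightarrow> 'a \<Rightarrow> 'a measure) \<Rightarrow> 'a measure \<Rightarrow> bool" where
  "stationary M P \<mu> \<longleftrightarrow> \<mu> \<in> space (prob_algebra M) \<and> (\<forall>t\<ge>0. \<mu> \<bind> P t = \<mu>)"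

definition unique_stationary ::
  "'a measure \<Rightarrow> (real \<Rightarrow> 'a \<Rightarrow> 'a measure) \<Rightarrow> 'a measure \<Rightarrow> bool" where
  "unique_stationary M P \<mu> \<longleftrightarrow> stationary M P \<mu> \<and> (\<forall>\<mu>'. stationary M P \<mu>' \<longrightarrow> \<mu>' = \<mu>)"

text \<open>Detailed balance: for the process started from \<open>\<mu>\<close>, the pairs (state at time 0, state at
  time \<open>t\<close>) and (state at time \<open>t\<close>, state at time 0) have the same law.\<close>

definition reversible :: "'a measure \<Rightarrow> (real \<Rightarrow> 'a \<Rightarrow> 'a measure) \<Rightarrow> 'a measure \<Rightarrow> bool" where
  "reversible M P \<mu> \<longleftrightarrow> \<mu> \<in> space (prob_algebra M) \<and>
     (\<forall>t\<ge>0. \<forall>A\<in>sets M. \<forall>B\<in>sets M.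
        (\<integral>\<^sup>+x\<in>A. emeasure (P t x) B \<partial>\<mu>) = (\<integral>\<^sup>+x\<in>B. emeasure (P t x) A \<partial>\<mu>))"

definition weakly_converges ::
  "'a::topological_space measure \<Rightarrow> (real \<Rightarrow> 'a measure) \<Rightarrow> 'a measure \<Rightarrow> bool" where
  "weakly_converges M \<mu>t \<mu> \<longleftrightarrow>
     (\<forall>f :: 'a \<Rightarrow> real. continuous_on (space M) f \<and> bounded (f ` space M) \<longrightarrow>
        ((\<lambda>t. \<integral>x. f x \<partial>\<mu>t t) \<longlongrightarrow> (\<integral>x. f x \<partial>\<mu>)) at_top)"

text \<open>Convergence in distribution as time tends to infinity, from every initial law.\<close>

definition converges_to ::
  "'a::topological_space measure \<Rightarrow> (real \<Rightarrow> 'a \<Rightarrow> 'a measure) \<Rightarrow> 'a measure \<Rightarrow> bool" where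
  "converges_to M P \<mu> \<longleftrightarrow>
     (\<forall>\<mu>0\<in>space (prob_algebra M). weakly_converges M (\<lambda>t. \<mu>0 \<bind> P t) \<mu>)"

end

theory Submission
  imports Defs
begin

text \<open>All moves occur at bounded total rate \<open>\<Lambda>\<close>, so a semigroup with generator \<open>N - \<Lambda>\<close> satisfies
  \<open>exp (\<Lambda> t) P\<^sub>t f = (\<Sum>j. t\<^sup>j / j! N\<^sup>j f)\<close>, and every assertion about \<open>P\<close> or \<open>Q\<close> reduces to one about a
  single move.

  For (a), redistributing independent Gamma variables of scales \<open>a\<close> and \<open>b\<close> by a Beta
  variable gives the Beta mixture over \<open>u\<close> of two independent Gamma variables of common scale
  \<open>a u + b (1 - u)\<close>: in polar coordinates \<open>(x, y) = (z r, (1 - z) r)\<close> the two densities agree after a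
  Moebius substitution. A reservoir move is a bulk move with an auxiliary site of parameter \<open>\<theta>'\<close>,
  of which only the first coordinate is kept. Hence the product kernel \<open>\<nu>_prod\<close> intertwines the two
  generators. For equal scales the same coordinates show that a bulk move is reversible,
  which gives (c).

  For (b), one move averages, respectively halves, the weights in a weighted \<open>\<ell>\<^sup>1\<close> Lipschitz bound, in
  both models in the same way. A random walk killed at the reservoirs has a strictly positive
  supersolution, and with these weights Lipschitz bounds decay exponentially. Two initial laws
  are therefore forgotten, so a stationary law is unique and attracting as soon as it exists. For the
  hidden model it is constructed by monotone coupling from the past, and it is
  transported to the KMP process by \<open>\<nu>_prod\<close>.\<close>

section \<open>Semigroups with a bounded generator\<close>

text \<open>The processes enter only as hypotheses on \<open>P\<close> and \<open>Q\<close>: nothing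
  is known of them beyond the semigroup law and the derivative at time 0 in supremum norm. The
  exponential series is recovered from these by a Taylor formula with remainder. The hidden state
  space contains configurations with zero coordinates, whereas the Gamma computations need positive
  scales. Intertwining is therefore a statement about positive configurations: hidden moves preserve
  them, and the stationary law built by coupling stays above the smallest reservoir parameter. Both
  models have the same Lipschitz weights because only the mean 1/2 of the Beta law enters when two
  copies use the same noise. Summed over ordered pairs, the averaging of weights is the generator of
  a walk with jump rates \<open>p\<close> and killing rate \<open>c / 2\<close>; its expected
  lifetime is the weight. Some \<open>c i\<close> must be positive: for \<open>c = 0\<close> the
  bulk moves conserve the total energy, and every homogeneous product law is stationary. The
  coupling controls Lipschitz test functions only, hence the approximation arguments for weak
  convergence and for equality of laws.\<close>

lemma prob_algebra_bounded_integral: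
  fixes f :: "'a \<Rightarrow> real"
  assumes \<mu>: "\<mu> \<in> space (prob_algebra X)" and f: "f \<in> borel_measurable X"
    and B: "\<And>x. x \<in> space X \<Longrightarrow> \<bar>f x\<bar> \<le> B"
  shows "integrable \<mu> f" and "\<bar>\<integral>x. f x \<partial>\<mu>\<bar> \<le> B"
proof -
  have sets: "sets \<mu> = sets X" and "prob_space \<mu>"
    using \<mu> by (auto simp: space_prob_algebra)
  then have sp: "space \<mu> = space X" by (metis sets_eq_imp_space_eq)
  interpret prob_space \<mu> by fact
  have f': "f \<in> borel_measurable \<mu>"
    using f measurable_cong_sets[OF sets refl] by auto
  have AE: "AE x in \<mu>. norm (f x) \<le> B"
    using B sp by (intro AE_I2) auto
  show int: "integrable \<mu> f"
    by (rule integrable_const_bound[OF AE f'])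
  have "\<bar>\<integral>x. f x \<partial>\<mu>\<bar> \<le> (\<integral>x. \<bar>f x\<bar> \<partial>\<mu>)"
    by (rule integral_abs_bound)
  also have "\<dots> \<le> (\<integral>x. B \<partial>\<mu>)"
    by (rule integral_mono_AE) (use int AE in auto)
  finally show "\<bar>\<integral>x. f x \<partial>\<mu>\<bar> \<le> B"
    by (simp add: prob_space)
qed

lemma prob_algebra_integral_bind:
  fixes f :: "'b \<Rightarrow> real"
  assumes \<mu>: "\<mu> \<in> space (prob_algebra X)" and \<kappa>: "\<kappa> \<in> X \<rightarrow>\<^sub>M prob_algebra Y"
    and f: "f \<in> borel_measurable Y" and B: "\<And>y. y \<in> space Y \<Longrightarrow> \<bar>f y\<bar> \<le> B"
  shows "(\<integral>y. f y \<partial>(\<mu> \<bind> \<kappa>)) = (\<integral>x. \<integral>y. f y \<partial>\<kappa> x \<partial>\<mu>)"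
proof -
  have sets: "sets \<mu> = sets X" and prob: "prob_space \<mu>"
    using \<mu> by (auto simp: space_prob_algebra)
  then have sp: "space \<mu> = space X" by (metis sets_eq_imp_space_eq)
  interpret prob_space \<mu> by fact
  have k: "\<kappa> \<in> \<mu> \<rightarrow>\<^sub>M subprob_algebra Y"
    using measurable_prob_algebraD[OF \<kappa>] measurable_cong_sets[OF sets refl] by auto
  have ps: "prob_space (\<kappa> x)" and ss: "space (\<kappa> x) = space Y" if "x \<in> space \<mu>" for x
    using measurable_space[OF \<kappa>] that sp
    by (auto simp: space_prob_algebra dest: sets_eq_imp_space_eq)
  show ?thesis
    by (rule integral_bind[where K=Y and B=B and B'=1])
      (use B f k ps finite_measure_axioms in \<open>auto simp: prob_space.emeasure_space_1\<close>)
qed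

lemma prob_algebra_integral_measurable:
  fixes f :: "'b \<Rightarrow> real"
  assumes \<kappa>: "\<kappa> \<in> X \<rightarrow>\<^sub>M prob_algebra Y" and f: "f \<in> borel_measurable Y"
  shows "(\<lambda>x. \<integral>y. f y \<partial>\<kappa> x) \<in> borel_measurable X"
  by (rule measurable_compose[OF measurable_prob_algebraD[OF \<kappa>] integral_measurable_subprob_algebra[OF f]])

lemma prob_algebra_eqI:
  assumes \<mu>: "\<mu> \<in> space (prob_algebra X)" and \<mu>': "\<mu>' \<in> space (prob_algebra X)"
    and eq: "\<And>f. f \<in> borel_measurable X \<Longrightarrow> (\<And>x. x \<in> space X \<Longrightarrow> \<bar>f x\<bar> \<le> (1::real)) \<Longrightarrow>
       (\<integral>x. f x \<partial>\<mu>) = (\<integral>x. f x \<partial>\<mu>')"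
  shows "\<mu> = \<mu>'"
proof (rule measure_eqI)
  have sets: "sets \<mu> = sets X" "sets \<mu>' = sets X" and ps: "prob_space \<mu>" "prob_space \<mu>'"
    using \<mu> \<mu>' by (auto simp: space_prob_algebra)
  then show "sets \<mu> = sets \<mu>'" by simp
  fix A assume "A \<in> sets \<mu>"
  with sets have A: "A \<in> sets X" by simp
  have "integral\<^sup>L \<mu> (indicator A :: _ \<Rightarrow> real) = integral\<^sup>L \<mu>' (indicator A)"
    using A by (intro eq[of "indicator A"]) (auto simp: indicator_def)
  moreover have "A \<subseteq> space \<mu>" "A \<subseteq> space \<mu>'"
    using sets A by (metis sets.sets_into_space)+
  ultimately have "measure \<mu> A = measure \<mu>' A"
    by (simp add: Int_absorb2)
  then show "emeasure \<mu> A = emeasure \<mu>' A"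
    using ps by (simp add: finite_measure.emeasure_eq_measure prob_space.finite_measure)
qed

text \<open>\<open>N\<close> collects the gain part of a jump generator: rates times means after a
  jump. With the bound \<open>\<Lambda> * B\<close>, the iterates \<open>(N ^^ n) f\<close> grow at
  most geometrically, which the exponential series absorbs.\<close>

locale bounded_generator =
  fixes X :: "'a measure" and P :: "real \<Rightarrow> 'a \<Rightarrow> 'a measure"
    and N :: "('a \<Rightarrow> real) \<Rightarrow> 'a \<Rightarrow> real" and \<Lambda> :: real
  assumes semigroup: "markov_semigroup X P"
    and generator: "has_generator X P (\<lambda>f x. N f x - \<Lambda> * f x)"
    and jump_measurable: "\<And>f B. f \<in> borel_measurable X \<Longrightarrow> (\<And>x. x \<in> space X \<Longrightarrow> \<bar>f x\<bar> \<le> B) \<Longrightarrow>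
          N f \<in> borel_measurable X"
    and jump_bound: "\<And>f B x. f \<in> borel_measurable X \<Longrightarrow> (\<And>x. x \<in> space X \<Longrightarrow> \<bar>f x\<bar> \<le> B) \<Longrightarrow>
          x \<in> space X \<Longrightarrow> \<bar>N f x\<bar> \<le> \<Lambda> * B"
    and rate_nonneg: "\<Lambda> \<ge> 0"
begin

lemma kernel: "t \<ge> 0 \<Longrightarrow> P t \<in> X \<rightarrow>\<^sub>M prob_algebra X"
  using semigroup by (auto simp: markov_semigroup_def)

lemma kernel_space: "t \<ge> 0 \<Longrightarrow> x \<in> space X \<Longrightarrow> P t x \<in> space (prob_algebra X)"
  using measurable_space[OF kernel] .

lemma jump_iterates:
  assumes f: "f \<in> borel_measurable X" and B: "\<And>x. x \<in> space X \<Longrightarrow> \<bar>f x\<bar> \<le> B"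
  shows "(N ^^ n) f \<in> borel_measurable X \<and> (\<forall>x\<in>space X. \<bar>(N ^^ n) f x\<bar> \<le> \<Lambda> ^ n * B)"
proof (induction n)
  case 0
  then show ?case using assms by auto
next
  case (Suc n)
  have "N ((N ^^ n) f) \<in> borel_measurable X"
    by (rule jump_measurable[of _ "\<Lambda> ^ n * B"]) (use Suc in auto)
  moreover have "\<bar>N ((N ^^ n) f) x\<bar> \<le> \<Lambda> * (\<Lambda> ^ n * B)" if "x \<in> space X" for x
    by (rule jump_bound) (use Suc that in auto)
  ultimately show ?case by (simp add: mult.assoc)
qed

lemma integral_semigroup:
  assumes f: "f \<in> borel_measurable X" and B: "\<And>x. x \<in> space X \<Longrightarrow> \<bar>f x\<bar> \<le> (B::real)"
    and "r \<ge> 0" "t \<ge> 0" "x \<in> space X"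
  shows "(\<integral>y. f y \<partial>P (r + t) x) = (\<integral>z. \<integral>y. f y \<partial>P t z \<partial>P r x)"
proof -
  have "P (r + t) x = P r x \<bind> P t"
    using semigroup assms by (auto simp: markov_semigroup_def)
  then show ?thesis
    using prob_algebra_integral_bind[OF kernel_space kernel f B] assms by metis
qed

text \<open>By the semigroup law the increment over \<open>[t, t + h]\<close> is the mean under
  \<open>P t x\<close> of the increment over \<open>[0, h]\<close>. The generator limit is uniform
  in the starting state, so one \<delta> serves all \<open>t\<close> and \<open>x\<close>.\<close>

lemma forward_increment:
  assumes f: "f \<in> borel_measurable X" and B: "\<And>x. x \<in> space X \<Longrightarrow> \<bar>f x\<bar> \<le> B"
    and \<epsilon>: "\<epsilon> > 0"
  shows "\<exists>\<delta>>0. \<forall>x\<in>space X. \<forall>t\<ge>0. \<forall>h. 0 < h \<longrightarrow> h < \<delta> \<longrightarrow>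
     \<bar>(\<integral>y. f y \<partial>P (t + h) x) - (\<integral>y. f y \<partial>P t x) - h * (\<integral>y. N f y - \<Lambda> * f y \<partial>P t x)\<bar> \<le> \<epsilon> * h"
proof -
  let ?L = "\<lambda>y. N f y - \<Lambda> * f y"
  have bd: "bounded (f ` space X)"
    using B by (auto simp: bounded_iff)
  have "uniform_limit (space X) (\<lambda>t x. ((\<integral>y. f y \<partial>P t x) - f x) / t) ?L (at_right 0)"
    using generator f bd by (auto simp: has_generator_def)
  from uniform_limitD[OF this \<epsilon>] obtain \<delta> where \<delta>: "\<delta> > 0"
    and lim: "\<And>h x. 0 < h \<Longrightarrow> h < \<delta> \<Longrightarrow> x \<in> space X \<Longrightarrow> dist (((\<integral>y. f y \<partial>P h x) - f x) / h) (?L x) < \<epsilon>"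
    by (auto simp: eventually_at_right_field)
  have Nf: "N f \<in> borel_measurable X" "\<And>x. x \<in> space X \<Longrightarrow> \<bar>N f x\<bar> \<le> \<Lambda> * B"
    using jump_measurable[OF f B] jump_bound[OF f B] by auto
  show ?thesis
  proof (intro exI[of _ \<delta>] conjI ballI allI impI \<delta>)
    fix x and t h :: real assume x: "x \<in> space X" and t: "0 \<le> t" and h: "0 < h" "h < \<delta>"
    let ?g = "\<lambda>z. (\<integral>y. f y \<partial>P h z) - f z - h * ?L z"
    have \<mu>: "P t x \<in> space (prob_algebra X)" by (rule kernel_space) fact+
    have g: "\<bar>?g z\<bar> \<le> \<epsilon> * h" if z: "z \<in> space X" for z
    proof -
      have "\<bar>((\<integral>y. f y \<partial>P h z) - f z) / h - ?L z\<bar> < \<epsilon>"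
        using lim[OF h z] by (simp add: dist_real_def)
      moreover have "?g z = h * (((\<integral>y. f y \<partial>P h z) - f z) / h - ?L z)"
        using h by (simp add: field_simps)
      ultimately show ?thesis
        using h by (simp add: abs_mult)
    qed
    have Pm: "(\<lambda>z. \<integral>y. f y \<partial>P h z) \<in> borel_measurable X"
      by (rule prob_algebra_integral_measurable[OF kernel f]) (use h in simp)
    have Pb: "\<bar>\<integral>y. f y \<partial>P h z\<bar> \<le> B" if "z \<in> space X" for z
      by (rule prob_algebra_bounded_integral[OF kernel_space f B]) (use h that in auto)
    note int = prob_algebra_bounded_integral(1)[OF \<mu>]
    have i1: "integrable (P t x) (\<lambda>z. \<integral>y. f y \<partial>P h z)" by (rule int[OF Pm Pb])
    have i2: "integrable (P t x) f" by (rule int[OF f B])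
    have i3: "integrable (P t x) (N f)" by (rule int[OF Nf])
    have "(\<integral>y. f y \<partial>P (t + h) x) - (\<integral>y. f y \<partial>P t x) - h * (\<integral>y. ?L y \<partial>P t x)
       = (\<integral>z. ?g z \<partial>P t x)"
      using i1 i2 i3 h t x by (simp add: integral_semigroup[OF f B])
    also have "\<bar>\<dots>\<bar> \<le> \<epsilon> * h"
      by (rule prob_algebra_bounded_integral(2)[OF \<mu> _ g]) (use Pm f Nf in auto)
    finally show "\<bar>(\<integral>y. f y \<partial>P (t + h) x) - (\<integral>y. f y \<partial>P t x) - h * (\<integral>y. ?L y \<partial>P t x)\<bar> \<le> \<epsilon> * h" .
  qed
qed

text \<open>\<open>forward_increment\<close> only looks forward in time. For the left derivative it
  is applied at the earlier time, and a second application, to the generator image of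
  \<open>f\<close>, shows that the derivative itself moves little in between.\<close>

lemma forward_equation:
  assumes f: "f \<in> borel_measurable X" and B: "\<And>x. x \<in> space X \<Longrightarrow> \<bar>f x\<bar> \<le> B"
    and x: "x \<in> space X" and t: "t \<ge> 0"
  shows "((\<lambda>t. \<integral>y. f y \<partial>P t x) has_real_derivative (\<integral>y. N f y - \<Lambda> * f y \<partial>P t x)) (at t within {0..})"
proof -
  let ?L = "\<lambda>f y. N f y - \<Lambda> * f y"
  have L: "?L f \<in> borel_measurable X \<and> (\<forall>x\<in>space X. \<bar>?L f x\<bar> \<le> 2 * \<Lambda> * B)"
    if f: "f \<in> borel_measurable X" and B: "\<And>x. x \<in> space X \<Longrightarrow> \<bar>f x\<bar> \<le> B" for f B
  proof -
    have "\<bar>?L f x\<bar> \<le> 2 * \<Lambda> * B" if x: "x \<in> space X" for x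
    proof -
      have "\<bar>\<Lambda> * f x\<bar> \<le> \<Lambda> * B"
        using B[OF x] rate_nonneg by (simp add: abs_mult mult_left_mono)
      then show ?thesis
        using jump_bound[OF f B x] by linarith
    qed
    then show ?thesis using jump_measurable[OF f B] f by auto
  qed
  have L1: "?L f \<in> borel_measurable X" "\<And>x. x \<in> space X \<Longrightarrow> \<bar>?L f x\<bar> \<le> 2 * \<Lambda> * B"
    using L[OF f B] by auto
  have L2: "?L (?L f) \<in> borel_measurable X" "\<And>x. x \<in> space X \<Longrightarrow> \<bar>?L (?L f) x\<bar> \<le> 2 * \<Lambda> * (2 * \<Lambda> * B)"
    using L[OF L1] by auto
  \<comment> \<open>Lipschitz constant of \<open>?b\<close> over short times: 1 for the error
    allowed in the increment of \<open>?b\<close>, and the rest bounds its derivative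
    \<open>?c\<close>.\<close>
  define C where "C = 1 + 2 * \<Lambda> * (2 * \<Lambda> * B)"
  have "\<bar>f x\<bar> \<le> B" by (rule B[OF x])
  then have C: "C \<ge> 1" unfolding C_def using rate_nonneg by simp
  let ?a = "\<lambda>t. \<integral>y. f y \<partial>P t x" and ?b = "\<lambda>t. \<integral>y. ?L f y \<partial>P t x" and ?c = "\<lambda>t. \<integral>y. ?L (?L f) y \<partial>P t x"
  show ?thesis
    unfolding has_field_derivative_def has_derivative_within_alt
  proof (intro conjI allI impI)
    show "bounded_linear ((*) (?b t))" by (rule bounded_linear_mult_right)
    fix e :: real assume e: "e > 0"
    obtain d1 where d1: "d1 > 0" "\<And>t h. t \<ge> 0 \<Longrightarrow> 0 < h \<Longrightarrow> h < d1 \<Longrightarrow> \<bar>?a (t + h) - ?a t - h * ?b t\<bar> \<le> e/2 * h"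
      using forward_increment[OF f B half_gt_zero[OF e]] x by blast
    obtain d2 where d2: "d2 > 0" "\<And>t h. t \<ge> 0 \<Longrightarrow> 0 < h \<Longrightarrow> h < d2 \<Longrightarrow> \<bar>?b (t + h) - ?b t - h * ?c t\<bar> \<le> 1 * h"
      using forward_increment[OF L1 zero_less_one] x by blast
    \<comment> \<open>The third bound gives \<open>h * C \<le> e / 2\<close>; the other half of
      \<open>e\<close> pays for the increment of \<open>?a\<close>.\<close>
    define d where "d = min (min d1 d2) (e / (2 * C))"
    have "d > 0" using d1 d2 e C by (simp add: d_def)
    moreover have "norm (?a y - ?a t - ?b t * (y - t)) \<le> e * norm (y - t)"
      if y: "y \<in> {0..}" "norm (y - t) < d" for y
    proof (cases y t rule: linorder_cases)
      case less
      \<comment> \<open>Expand from the earlier time \<open>y\<close>, then replace the slope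
        \<open>?b y\<close> by \<open>?b t\<close>.\<close>
      define h where "h = t - y"
      have h: "0 < h" "h < d1" "h < d2" "h \<le> e / (2 * C)" "t = y + h"
        using less y by (auto simp: h_def d_def)
      have 1: "\<bar>?a t - ?a y - h * ?b y\<bar> \<le> e/2 * h" using d1(2)[of y h] h y by simp
      have 2: "\<bar>?b t - ?b y - h * ?c y\<bar> \<le> h" using d2(2)[of y h] h y by simp
      have 3: "\<bar>?c y\<bar> \<le> C - 1"
        unfolding C_def
        using prob_algebra_bounded_integral(2)[OF kernel_space[of y x] L2] y x by simp
      have "\<bar>h * ?c y\<bar> \<le> h * (C - 1)" using h 3 by (simp add: abs_mult)
      with 2 have "\<bar>?b t - ?b y\<bar> \<le> h * C" by (simp add: algebra_simps)
      also have "\<dots> \<le> e / 2" using h(4) C by (simp add: field_simps)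
      finally have "\<bar>h * (?b t - ?b y)\<bar> \<le> h * (e / 2)" using h by (simp add: abs_mult)
      moreover have "?a y - ?a t - ?b t * (y - t) = h * (?b t - ?b y) - (?a t - ?a y - h * ?b y)"
        unfolding h_def by (simp add: algebra_simps)
      ultimately have "\<bar>?a y - ?a t - ?b t * (y - t)\<bar> \<le> h * (e / 2) + e / 2 * h"
        using 1 by linarith
      also have "\<dots> = e * h" by simp
      finally have "\<bar>?a y - ?a t - ?b t * (y - t)\<bar> \<le> e * h" .
      then show ?thesis using less by (simp add: h_def)
    next
      case equal
      then show ?thesis by simp
    next
      case greater
      then have "\<bar>?a (t + (y - t)) - ?a t - (y - t) * ?b t\<bar> \<le> e/2 * (y - t)"
        using d1(2)[of t "y - t"] t y by (simp add: d_def)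
      also have "\<dots> \<le> e * (y - t)" using greater e by simp
      finally show ?thesis using greater by (simp add: algebra_simps)
    qed
    ultimately show "\<exists>d>0. \<forall>y\<in>{0..}. norm (y - t) < d \<longrightarrow>
        norm (?a y - ?a t - ?b t * (y - t)) \<le> e * norm (y - t)"
      by blast
  qed
qed

section \<open>The exponential series of the semigroup\<close>

text \<open>The integrating factor \<open>exp (\<Lambda> * t)\<close> cancels the loss term of the
  generator, so differentiating merely raises the power of \<open>N\<close> by one.\<close>

lemma taylor_derivative:
  assumes f: "f \<in> borel_measurable X" and B: "\<And>x. x \<in> space X \<Longrightarrow> \<bar>f x\<bar> \<le> B"
    and x: "x \<in> space X" and t: "t \<ge> 0"
  shows "((\<lambda>t. exp (\<Lambda> * t) * (\<integral>y. (N ^^ n) f y \<partial>P t x)) has_real_derivative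
           exp (\<Lambda> * t) * (\<integral>y. (N ^^ Suc n) f y \<partial>P t x)) (at t within {0..})"
proof -
  let ?g = "(N ^^ n) f"
  have g: "?g \<in> borel_measurable X" "\<And>x. x \<in> space X \<Longrightarrow> \<bar>?g x\<bar> \<le> \<Lambda> ^ n * B"
    using jump_iterates[OF f B, of n] by auto
  note Ng = jump_measurable[OF g] jump_bound[OF g]
  note int = prob_algebra_bounded_integral(1)[OF kernel_space[OF t x]]
  have "(\<integral>y. N ?g y - \<Lambda> * ?g y \<partial>P t x) = (\<integral>y. N ?g y \<partial>P t x) - \<Lambda> * (\<integral>y. ?g y \<partial>P t x)"
    using int[OF g] int[OF Ng] by simp
  with forward_equation[OF g x t]
  have "((\<lambda>t. \<integral>y. ?g y \<partial>P t x) has_real_derivative (\<integral>y. N ?g y \<partial>P t x) - \<Lambda> * (\<integral>y. ?g y \<partial>P t x)) (at t within {0..})"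
    by simp
  moreover have "((\<lambda>t. exp (\<Lambda> * t)) has_real_derivative \<Lambda> * exp (\<Lambda> * t)) (at t within {0..})"
    by (auto intro!: derivative_eq_intros)
  ultimately have "((\<lambda>t. exp (\<Lambda> * t) * (\<integral>y. ?g y \<partial>P t x)) has_real_derivative
      exp (\<Lambda> * t) * ((\<integral>y. N ?g y \<partial>P t x) - \<Lambda> * (\<integral>y. ?g y \<partial>P t x)) +
      \<Lambda> * exp (\<Lambda> * t) * (\<integral>y. ?g y \<partial>P t x)) (at t within {0..})"
    by (intro DERIV_mult')
  then show ?thesis
    by (simp add: algebra_simps)
qed

text \<open>The error of order \<open>Suc k\<close> for the iterate \<open>n\<close> vanishes at
  time 0, and its derivative is the error of order \<open>k\<close> for the iterate
  \<open>Suc n\<close>. Hence the induction over \<open>k\<close> with \<open>n\<close> arbitrary.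
  The horizon \<open>T\<close> is fixed so that the constant \<open>exp (\<Lambda> * T)\<close> does
  not have to be differentiated.\<close>

lemma taylor_remainder:
  assumes f: "f \<in> borel_measurable X" and B: "\<And>x. x \<in> space X \<Longrightarrow> \<bar>f x\<bar> \<le> B"
    and x: "x \<in> space X" and t: "0 \<le> t" "t \<le> T"
  shows "\<bar>exp (\<Lambda> * t) * (\<integral>y. (N ^^ n) f y \<partial>P t x) - (\<Sum>j<k. t ^ j / fact j * (N ^^ (n + j)) f x)\<bar>
    \<le> exp (\<Lambda> * T) * B * \<Lambda> ^ (n + k) * (t ^ k / fact k)"
  using t
proof (induction k arbitrary: n t)
  case 0
  have "\<bar>\<integral>y. (N ^^ n) f y \<partial>P t x\<bar> \<le> \<Lambda> ^ n * B"
    by (rule prob_algebra_bounded_integral(2)[OF kernel_space]) (use 0 x jump_iterates[OF f B] in auto)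
  moreover have "exp (\<Lambda> * t) \<le> exp (\<Lambda> * T)"
    using 0 rate_nonneg by (simp add: mult_left_mono)
  ultimately have "exp (\<Lambda> * t) * \<bar>\<integral>y. (N ^^ n) f y \<partial>P t x\<bar> \<le> exp (\<Lambda> * T) * (\<Lambda> ^ n * B)"
    by (intro mult_mono) auto
  then show ?case by (simp add: abs_mult mult_ac)
next
  case (Suc k)
  define F where "F n t = exp (\<Lambda> * t) * (\<integral>y. (N ^^ n) f y \<partial>P t x)" for n t
  define S where "S n k t = (\<Sum>j<k. t ^ j / fact j * (N ^^ (n + j)) f x)" for n k t
  define R where "R n k t = exp (\<Lambda> * T) * B * \<Lambda> ^ (n + k) * (t ^ k / fact k)" for n k and t :: real
  have IH: "\<bar>F (Suc n) u - S (Suc n) k u\<bar> \<le> R (Suc n) k u" if "0 \<le> u" "u \<le> T" for u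
    using Suc.IH[OF that, of "Suc n"] by (simp add: F_def S_def R_def)
  have power: "((\<lambda>t. t ^ Suc j / fact (Suc j)) has_real_derivative t ^ j / fact j) (at t within A)" for t j A
  proof -
    have "((\<lambda>t. t ^ Suc j / fact (Suc j)) has_real_derivative (real (Suc j) * t ^ j) / fact (Suc j)) (at t within A)"
      by (rule derivative_eq_intros refl | simp)+
    also have "(real (Suc j) * t ^ j) / fact (Suc j) = t ^ j / fact j"
      by (simp add: field_simps del: of_nat_Suc)
    finally show ?thesis .
  qed
  have dF: "(F n has_real_derivative F (Suc n) u) (at u within {0..})" if "u \<ge> 0" for u
    unfolding F_def by (rule taylor_derivative[OF f B x that])
  have S_Suc: "S n (Suc k) = (\<lambda>t. (N ^^ n) f x + (\<Sum>j<k. t ^ Suc j / fact (Suc j) * (N ^^ (Suc n + j)) f x))"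
    by (auto simp: S_def sum.lessThan_Suc_shift fun_eq_iff simp del: sum.lessThan_Suc fact_Suc power_Suc)
  have dS: "(S n (Suc k) has_real_derivative S (Suc n) k u) (at u within A)" for u A
    unfolding S_Suc S_def
    by (rule DERIV_cong[OF DERIV_add[OF DERIV_const DERIV_sum]], rule DERIV_cmult_right[OF power]) simp
  have dR: "(R n (Suc k) has_real_derivative R (Suc n) k u) (at u within A)" for u A
    unfolding R_def using DERIV_cmult[OF power[of k u A], of "exp (\<Lambda> * T) * B * \<Lambda> ^ (n + Suc k)"] by simp
  have P0: "P 0 x = return X x"
    using semigroup x by (auto simp: markov_semigroup_def)
  have "F n 0 = (N ^^ n) f x"
    using jump_iterates[OF f B, of n] x by (simp add: F_def P0 integral_return)
  then have zero: "F n 0 - S n (Suc k) 0 = 0" "R n (Suc k) 0 = 0"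
    by (simp_all add: S_Suc R_def)
  have dG: "((\<lambda>u. R n (Suc k) u + c * (F n u - S n (Suc k) u)) has_real_derivative
      R (Suc n) k u + c * (F (Suc n) u - S (Suc n) k u)) (at u within {0..})" if "u \<ge> 0" for u c
    by (intro DERIV_add DERIV_cmult DERIV_diff dR dS dF that)
  \<comment> \<open>With \<open>c\<close> equal to 1 and to -1 the same increasing function bounds
    the error from above and from below.\<close>
  have mono: "0 \<le> R n (Suc k) t + c * (F n t - S n (Suc k) t)" if c: "\<bar>c\<bar> = 1" for c
  proof -
    let ?G = "\<lambda>u. R n (Suc k) u + c * (F n u - S n (Suc k) u)"
    have "?G 0 \<le> ?G t"
    proof (rule DERIV_nonneg_imp_increasing_open[where f="?G" and a=0 and b=t])
      show "0 \<le> t" using Suc by simp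
      show "continuous_on {0..t} ?G"
        by (rule continuous_on_subset[of "{0..}"], rule DERIV_continuous_on[OF dG]) auto
      fix u assume u: "0 < u" "u < t"
      have "at u within {0..} = at u"
        by (rule at_within_interior) (use u in auto)
      then have "DERIV ?G u :> R (Suc n) k u + c * (F (Suc n) u - S (Suc n) k u)"
        using dG[of u c] u by simp
      moreover have "\<bar>c * (F (Suc n) u - S (Suc n) k u)\<bar> \<le> R (Suc n) k u"
        using IH[of u] u Suc.prems c by (simp add: abs_mult)
      then have "R (Suc n) k u + c * (F (Suc n) u - S (Suc n) k u) \<ge> 0" by linarith
      ultimately show "\<exists>y. DERIV ?G u :> y \<and> y \<ge> 0" by blast
    qed
    then show ?thesis using zero by simp
  qed
  from mono[of 1] mono[of "-1"] have "\<bar>F n t - S n (Suc k) t\<bar> \<le> R n (Suc k) t" by simp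
  then show ?case by (simp add: F_def S_def R_def)
qed

text \<open>The remainder is uniform in the starting state and can be integrated. The weight
  \<open>g\<close> is 1 for stationarity and duality, and an indicator for reversibility.\<close>

lemma taylor_series_integrated:
  assumes \<mu>: "\<mu> \<in> space (prob_algebra X)"
    and f: "f \<in> borel_measurable X" and B: "\<And>x. x \<in> space X \<Longrightarrow> \<bar>f x\<bar> \<le> B"
    and g: "g \<in> borel_measurable X" and C: "\<And>x. x \<in> space X \<Longrightarrow> \<bar>g x\<bar> \<le> C"
    and t: "0 \<le> t"
  shows "(\<lambda>j. t ^ j / fact j * (\<integral>x. g x * (N ^^ j) f x \<partial>\<mu>)) sums
           (exp (\<Lambda> * t) * (\<integral>x. g x * (\<integral>y. f y \<partial>P t x) \<partial>\<mu>))"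
proof -
  have Pm: "(\<lambda>x. \<integral>y. f y \<partial>P t x) \<in> borel_measurable X"
    by (rule prob_algebra_integral_measurable[OF kernel[OF t] f])
  have Pb: "\<bar>\<integral>y. f y \<partial>P t z\<bar> \<le> B" if "z \<in> space X" for z
    by (rule prob_algebra_bounded_integral[OF kernel_space f B]) (use t that in auto)
  have bnd: "\<bar>a * b\<bar> \<le> C * D" if "\<bar>a\<bar> \<le> C" "\<bar>b\<bar> \<le> D" for a b C D :: real
    using that by (simp add: abs_mult mult_mono')
  have mu_ne: "space X \<noteq> {}"
    using \<mu> by (auto simp: space_prob_algebra dest!: prob_space.not_empty sets_eq_imp_space_eq)
  then have C0: "C \<ge> 0" using C abs_ge_zero order_trans by (metis all_not_in_conv)
  have i1: "integrable \<mu> (\<lambda>x. g x * (\<integral>y. f y \<partial>P t x))"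
    by (rule prob_algebra_bounded_integral(1)[OF \<mu>, of _ "C * B"]) (use Pm g C Pb bnd in auto)
  have i2: "integrable \<mu> (\<lambda>x. g x * (N ^^ j) f x)" for j
    by (rule prob_algebra_bounded_integral(1)[OF \<mu>, of _ "C * (\<Lambda> ^ j * B)"])
       (use g C jump_iterates[OF f B, of j] bnd in auto)
  define R where "R k = C * exp (\<Lambda> * t) * B * ((\<Lambda> * t) ^ k / fact k)" for k
  have rem: "\<bar>exp (\<Lambda> * t) * (\<integral>x. g x * (\<integral>y. f y \<partial>P t x) \<partial>\<mu>) - (\<Sum>j<k. t ^ j / fact j * (\<integral>x. g x * (N ^^ j) f x \<partial>\<mu>))\<bar> \<le> R k" for k
  proof -
    let ?h = "\<lambda>x. exp (\<Lambda> * t) * (\<integral>y. f y \<partial>P t x) - (\<Sum>j<k. t ^ j / fact j * (N ^^ j) f x)"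
    have "exp (\<Lambda> * t) * (\<integral>x. g x * (\<integral>y. f y \<partial>P t x) \<partial>\<mu>) - (\<Sum>j<k. t ^ j / fact j * (\<integral>x. g x * (N ^^ j) f x \<partial>\<mu>))
      = (\<integral>x. exp (\<Lambda> * t) * (g x * (\<integral>y. f y \<partial>P t x)) - (\<Sum>j<k. t ^ j / fact j * (g x * (N ^^ j) f x)) \<partial>\<mu>)"
      using i1 i2 by simp
    also have "\<dots> = (\<integral>x. g x * ?h x \<partial>\<mu>)"
      by (intro arg_cong[where f="integral\<^sup>L \<mu>"] ext) (simp add: algebra_simps sum_distrib_left)
    also have "\<bar>\<dots>\<bar> \<le> C * (exp (\<Lambda> * t) * B * \<Lambda> ^ k * (t ^ k / fact k))"
    proof (rule prob_algebra_bounded_integral(2)[OF \<mu>])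
      have [measurable]: "(N ^^ j) f \<in> borel_measurable X" for j
        using jump_iterates[OF f B] by blast
      show "(\<lambda>x. g x * ?h x) \<in> borel_measurable X"
        using g Pm by measurable
      show "\<bar>g x * ?h x\<bar> \<le> C * (exp (\<Lambda> * t) * B * \<Lambda> ^ k * (t ^ k / fact k))" if "x \<in> space X" for x
        using C[OF that] taylor_remainder[OF f B that t order_refl, of 0 k] by (intro bnd) auto
    qed
    finally show ?thesis by (simp add: R_def power_mult_distrib mult_ac)
  qed
  have "(\<lambda>k. (\<Lambda> * t) ^ k / fact k) \<longlonglongrightarrow> 0"
    using summable_LIMSEQ_zero[OF summable_exp[of "\<Lambda> * t"]] by (simp add: field_simps)
  then have R0: "R \<longlonglongrightarrow> 0" unfolding R_def by (rule tendsto_mult_right_zero)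
  show ?thesis
    unfolding sums_def
    by (rule metric_tendsto_imp_tendsto[OF R0]) 
       (use rem in \<open>auto simp: dist_real_def abs_minus_commute intro!: always_eventually order_trans[OF _ abs_ge_self]\<close>)
qed

end

section \<open>The exchange identity for Gamma and Beta variables\<close>

abbreviation \<nu>_dens :: "real \<Rightarrow> real \<Rightarrow> real \<Rightarrow> real" where
  "\<nu>_dens s \<theta> x \<equiv> x powr (2 * s - 1) / (\<theta> powr (2 * s) * Gamma (2 * s)) * exp (- x / \<theta>)"

abbreviation beta_dens :: "real \<Rightarrow> real \<Rightarrow> real" where
  "beta_dens s u \<equiv> 1 / Beta (2 * s) (2 * s) * u powr (2 * s - 1) * (1 - u) powr (2 * s - 1)"

lemma Beta_real_pos: "a > 0 \<Longrightarrow> b > 0 \<Longrightarrow> Beta a b > (0::real)"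
  by (simp add: Beta_def Gamma_real_pos)

lemma \<nu>_dens_nonneg: "s > 0 \<Longrightarrow> \<nu>_dens s \<theta> x \<ge> 0"
  using Gamma_real_pos[of "2 * s"] by simp

lemma beta_dens_nonneg: "s > 0 \<Longrightarrow> beta_dens s u \<ge> 0"
  using Beta_real_pos[of "2 * s" "2 * s"] by simp

lemma space_halfline [simp]: "space halfline = {0..}"
  by (simp add: halfline_def space_restrict_space)

lemma sets_\<nu> [simp, measurable_cong]: "sets (\<nu> s \<theta>) = sets halfline"
  by (auto simp: \<nu>_def halfline_def sets_restrict_space)

lemma space_\<nu> [simp]: "space (\<nu> s \<theta>) = {0..}"
  using sets_eq_imp_space_eq[OF sets_\<nu>[of s \<theta>]] by simp

lemma sets_beta_distr [simp, measurable_cong]: "sets (beta_distr s) = sets (restrict_space borel {0..1})"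
  by (auto simp: beta_distr_def sets_restrict_space)

lemma space_beta_distr [simp]: "space (beta_distr s) = {0..1}"
  by (simp add: beta_distr_def space_restrict_space)

lemma measurable_beta_borel: "(\<lambda>x. x) \<in> beta_distr s \<rightarrow>\<^sub>M borel"
  by (subst measurable_cong_sets[OF sets_beta_distr refl]) (rule measurable_restrict_space1, simp)

lemma nn_integral_\<nu>:
  assumes "\<theta> > 0" and f[measurable]: "f \<in> borel_measurable borel"
  shows "(\<integral>\<^sup>+x. f x \<partial>\<nu> s \<theta>) = (\<integral>\<^sup>+x. ennreal (\<nu>_dens s \<theta> x) * f x * indicator {0..} x \<partial>lborel)"
proof -
  have [measurable]: "f \<in> borel_measurable (restrict_space lborel {0..})"
    by (rule measurable_restrict_space1) simp
  have [measurable]: "(\<lambda>x. ennreal (\<nu>_dens s \<theta> x)) \<in> borel_measurable (restrict_space lborel {0..})"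
    by (rule measurable_restrict_space1) simp
  have "(\<integral>\<^sup>+x. f x \<partial>\<nu> s \<theta>) = (\<integral>\<^sup>+x. ennreal (\<nu>_dens s \<theta> x) * f x \<partial>restrict_space lborel {0..})"
  proof -
    have "\<nu> s \<theta> = density (restrict_space lborel {0..}) (\<lambda>x. ennreal (\<nu>_dens s \<theta> x))"
      using assms(1) by (simp add: \<nu>_def)
    then show ?thesis by (simp only:) (rule nn_integral_density; measurable)
  qed
  then show ?thesis
    by (simp only:) (subst nn_integral_restrict_space, auto)
qed

lemma nn_integral_beta_distr:
  assumes f[measurable]: "f \<in> borel_measurable borel"
  shows "(\<integral>\<^sup>+u. f u \<partial>beta_distr s) = (\<integral>\<^sup>+u. ennreal (beta_dens s u) * f u * indicator {0..1} u \<partial>lborel)"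
proof -
  have [measurable]: "f \<in> borel_measurable (restrict_space lborel {0..1})"
    by (rule measurable_restrict_space1) simp
  have [measurable]: "(\<lambda>x. ennreal (beta_dens s x)) \<in> borel_measurable (restrict_space lborel {0..1})"
    by (rule measurable_restrict_space1) simp
  have "(\<integral>\<^sup>+u. f u \<partial>beta_distr s) = (\<integral>\<^sup>+u. ennreal (beta_dens s u) * f u \<partial>restrict_space lborel {0..1})"
    unfolding beta_distr_def by (rule nn_integral_density; measurable)
  then show ?thesis
    by (simp only:) (subst nn_integral_restrict_space, auto)
qed

lemma prob_space_beta_distr:
  assumes "s > 0"
  shows "prob_space (beta_distr s)"
proof
  let ?B = "Beta (2 * s) (2 * s)"
  have B: "?B > 0" using assms by (simp add: Beta_real_pos)
  have "((\<lambda>t. t powr (2 * s - 1) * (1 - t) powr (2 * s - 1)) has_integral ?B) {0..1}"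
    using assms by (intro has_integral_Beta_real) auto
  from has_integral_mult_right[OF this, of "1 / ?B"]
  have "((\<lambda>t. beta_dens s t) has_integral 1) {0..1}"
    using B by (simp add: mult.assoc)
  from nn_integral_has_integral_lebesgue[OF _ this]
  have "(\<integral>\<^sup>+u. ennreal (indicator {0..1} u * beta_dens s u) \<partial>lborel) = 1"
    using beta_dens_nonneg[OF assms] by simp
  moreover have "(\<integral>\<^sup>+u. 1 \<partial>beta_distr s) = (\<integral>\<^sup>+u. ennreal (indicator {0..1} u * beta_dens s u) \<partial>lborel)"
    by (subst nn_integral_beta_distr) (auto intro!: nn_integral_cong simp: indicator_def)
  ultimately show "emeasure (beta_distr s) (space (beta_distr s)) = 1"
    by simp
qed

lemma nn_integral_\<nu>_scale:
  assumes "\<theta> > 0" and f[measurable]: "f \<in> borel_measurable borel"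
  shows "(\<integral>\<^sup>+x. f x \<partial>\<nu> s \<theta>) = (\<integral>\<^sup>+x. f (\<theta> * x) \<partial>\<nu> s 1)"
proof -
  have "(\<integral>\<^sup>+x. f x \<partial>\<nu> s \<theta>) =
      \<bar>\<theta>\<bar> * (\<integral>\<^sup>+x. ennreal (\<nu>_dens s \<theta> (0 + \<theta> * x)) * f (0 + \<theta> * x) * indicator {0..} (0 + \<theta> * x) \<partial>lborel)"
    using assms by (subst nn_integral_\<nu>, simp, simp, subst nn_integral_real_affine[of _ \<theta> 0]) auto
  also have "\<dots> = (\<integral>\<^sup>+x. \<bar>\<theta>\<bar> * (ennreal (\<nu>_dens s \<theta> (0 + \<theta> * x)) * f (0 + \<theta> * x) * indicator {0..} (0 + \<theta> * x)) \<partial>lborel)"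
    by (subst nn_integral_cmult) auto
  also have "\<dots> = (\<integral>\<^sup>+x. ennreal (\<nu>_dens s 1 x) * f (\<theta> * x) * indicator {0..} x \<partial>lborel)"
  proof (rule nn_integral_cong)
    fix x :: real
    have "\<theta> * \<nu>_dens s \<theta> (\<theta> * x) = \<nu>_dens s 1 x" if "x \<ge> 0"
      using assms that by (simp add: powr_mult powr_diff field_simps)
    then show "\<bar>\<theta>\<bar> * (ennreal (\<nu>_dens s \<theta> (0 + \<theta> * x)) * f (0 + \<theta> * x) * indicator {0..} (0 + \<theta> * x))
       = ennreal (\<nu>_dens s 1 x) * f (\<theta> * x) * indicator {0..} x"
      using assms by (auto simp: indicator_def zero_le_mult_iff ennreal_mult'[symmetric] mult.assoc[symmetric]
          simp del: times_divide_eq_left times_divide_eq_right)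
  qed
  also have "\<dots> = (\<integral>\<^sup>+x. f (\<theta> * x) \<partial>\<nu> s 1)"
    by (subst nn_integral_\<nu>) auto
  finally show ?thesis .
qed

lemma prob_space_\<nu>:
  assumes "s > 0" "\<theta> \<ge> 0"
  shows "prob_space (\<nu> s \<theta>)"
proof (cases "\<theta> = 0")
  case True
  then show ?thesis by (auto simp: \<nu>_def intro: prob_space_return)
next
  case False
  have G: "Gamma (2 * s) > 0" using assms by (simp add: Gamma_real_pos)
  have "(\<integral>\<^sup>+x. 1 \<partial>\<nu> s 1) = (\<integral>\<^sup>+t. ennreal (1 / Gamma (2 * s)) * ennreal (indicator {0..} t * t powr (2 * s - 1) / exp t) \<partial>lborel)"
    using assms Gamma_real_pos[of "2 * s"] by (subst nn_integral_\<nu>)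
      (auto intro!: nn_integral_cong simp: indicator_def ennreal_mult'[symmetric] exp_minus field_simps)
  also have "\<dots> = ennreal (1 / Gamma (2 * s)) * Gamma (2 * s)"
    using assms by (subst nn_integral_cmult) (simp_all add: Gamma_conv_nn_integral_real)
  also have "\<dots> = 1"
    using G by (subst ennreal_mult'[symmetric]) auto
  finally have "(\<integral>\<^sup>+x. 1 \<partial>\<nu> s 1) = 1" .
  then have "(\<integral>\<^sup>+x. 1 \<partial>\<nu> s \<theta>) = 1"
    using nn_integral_\<nu>_scale[of \<theta> "\<lambda>_. 1" s] assms False by simp
  then show ?thesis by (intro prob_spaceI) simp
qed

section \<open>Polar coordinates in the quadrant\<close>

text \<open>Two affine substitutions do the work of a planar change of variables:
  \<open>y = r - x\<close> for fixed \<open>x\<close> and then, after Fubini,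
  \<open>x = z * r\<close> for fixed \<open>r\<close>. The second one contributes the Jacobian
  \<open>r\<close> and degenerates only on the null set \<open>r = 0\<close>.\<close>

lemma nn_integral_quadrant_polar:
  fixes H :: "real \<Rightarrow> real \<Rightarrow> ennreal"
  assumes [measurable]: "case_prod H \<in> borel_measurable (borel \<Otimes>\<^sub>M borel)"
  shows "(\<integral>\<^sup>+x. \<integral>\<^sup>+y. H x y * indicator {0..} x * indicator {0..} y \<partial>lborel \<partial>lborel) =
    (\<integral>\<^sup>+r. ennreal r * indicator {0..} r * (\<integral>\<^sup>+z. H (z * r) ((1 - z) * r) * indicator {0..1} z \<partial>lborel) \<partial>lborel)"
proof -
  have [measurable]: "(\<lambda>x. H (f x) (g x)) \<in> borel_measurable M"
    if "f \<in> borel_measurable M" "g \<in> borel_measurable M" for f g and M :: "'z measure"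
    using measurable_compose[OF measurable_Pair[OF that] assms] by simp
  have "(\<integral>\<^sup>+x. \<integral>\<^sup>+y. H x y * indicator {0..} x * indicator {0..} y \<partial>lborel \<partial>lborel) =
     (\<integral>\<^sup>+x. \<integral>\<^sup>+r. H x (r - x) * indicator {0..} x * indicator {0..} (r - x) \<partial>lborel \<partial>lborel)"
  proof (rule nn_integral_cong)
    fix x :: real
    show "(\<integral>\<^sup>+y. H x y * indicator {0..} x * indicator {0..} y \<partial>lborel) =
        (\<integral>\<^sup>+r. H x (r - x) * indicator {0..} x * indicator {0..} (r - x) \<partial>lborel)"
      by (subst nn_integral_real_affine[of _ 1 "- x"]) auto
  qed
  also have "\<dots> = (\<integral>\<^sup>+r. \<integral>\<^sup>+x. H x (r - x) * indicator {0..} x * indicator {0..} (r - x) \<partial>lborel \<partial>lborel)"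
    by (rule lborel_pair.Fubini') measurable
  also have "\<dots> = (\<integral>\<^sup>+r. ennreal r * indicator {0..} r * (\<integral>\<^sup>+z. H (z * r) ((1 - z) * r) * indicator {0..1} z \<partial>lborel) \<partial>lborel)"
  proof (rule nn_integral_cong_AE, rule eventually_mono[OF AE_lborel_singleton[of 0]])
    fix r :: real assume r: "r \<noteq> 0"
    show "(\<integral>\<^sup>+x. H x (r - x) * indicator {0..} x * indicator {0..} (r - x) \<partial>lborel) =
      ennreal r * indicator {0..} r * (\<integral>\<^sup>+z. H (z * r) ((1 - z) * r) * indicator {0..1} z \<partial>lborel)"
    proof (cases "r > 0")
      case True
      have "(\<integral>\<^sup>+x. H x (r - x) * indicator {0..} x * indicator {0..} (r - x) \<partial>lborel) =
        \<bar>r\<bar> * (\<integral>\<^sup>+z. H (0 + r * z) (r - (0 + r * z)) * indicator {0..} (0 + r * z) * indicator {0..} (r - (0 + r * z)) \<partial>lborel)"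
        using r by (subst nn_integral_real_affine[of _ r 0]) auto
      also have "(\<integral>\<^sup>+z. H (0 + r * z) (r - (0 + r * z)) * indicator {0..} (0 + r * z) * indicator {0..} (r - (0 + r * z)) \<partial>lborel)
        = (\<integral>\<^sup>+z. H (z * r) ((1 - z) * r) * indicator {0..1} z \<partial>lborel)"
        using True by (intro nn_integral_cong)
          (auto simp: indicator_def zero_le_mult_iff algebra_simps)
      finally show ?thesis using True by simp
    next
      case False
      have "(\<integral>\<^sup>+x. H x (r - x) * indicator {0..} x * indicator {0..} (r - x) \<partial>lborel) = (\<integral>\<^sup>+(x::real). 0 \<partial>lborel)"
        using False r by (intro nn_integral_cong) (auto simp: indicator_def)
      then show ?thesis using False r by simp
    qed
  qed
  finally show ?thesis .
qed

text \<open>The substitution \<open>z = u a / (a u + b (1 - u))\<close> linearises the harmonic mixture: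
  \<open>z / a + (1 - z) / b = 1 / (a u + b (1 - u))\<close>.\<close>

lemma nn_integral_beta_mobius:
  fixes a b r s :: real
  assumes s: "s > 0" and a: "a > 0" and b: "b > 0"
  defines "\<theta> \<equiv> \<lambda>u. a * u + b * (1 - u)"
  shows "(\<integral>\<^sup>+z. ennreal (beta_dens s z * exp (- r * (z / a + (1 - z) / b)) / (a * b) powr (2 * s)) * indicator {0..1} z \<partial>lborel)
    = (\<integral>\<^sup>+u. ennreal (beta_dens s u * exp (- r / \<theta> u) / \<theta> u powr (4 * s)) * indicator {0..1} u \<partial>lborel)"
proof -
  define f where "f z = beta_dens s z * exp (- r * (z / a + (1 - z) / b)) / (a * b) powr (2 * s)" for z
  define g where "g u = u * a / \<theta> u" for u
  define g' where "g' u = a * b / (\<theta> u)\<^sup>2" for u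
  have \<theta>: "\<theta> u > 0" if "u \<in> {0..1}" for u
  proof (cases "u = 0")
    case False
    then have "a * u > 0" "b * (1 - u) \<ge> 0" using that a b by auto
    then show ?thesis by (simp add: \<theta>_def)
  qed (use b in \<open>simp add: \<theta>_def\<close>)
  have "(\<integral>\<^sup>+z. ennreal (f z) * indicator {g 0..g 1} z \<partial>lborel) = (\<integral>\<^sup>+u. ennreal (f (g u) * g' u) * indicator {0..1} u \<partial>lborel)"
    unfolding nn_integral_set_ennreal
  proof (rule nn_integral_substitution)
    show "set_borel_measurable borel {g 0..g 1} f"
      unfolding f_def set_borel_measurable_def by measurable
    show "(g has_real_derivative g' u) (at u)" if "u \<in> {0..1}" for u
    proof -
      have "((\<lambda>u. u * a / \<theta> u) has_real_derivative (a * \<theta> u - u * a * (a - b)) / (\<theta> u * \<theta> u)) (at u)"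
        unfolding \<theta>_def by (rule derivative_eq_intros refl | use \<theta>[OF that] in \<open>simp add: \<theta>_def\<close>)+
      also have "(a * \<theta> u - u * a * (a - b)) / (\<theta> u * \<theta> u) = g' u"
        by (simp add: g'_def \<theta>_def power2_eq_square algebra_simps)
      finally show ?thesis by (simp add: g_def[abs_def])
    qed
    show "continuous_on {0..1} g'"
      unfolding g'_def \<theta>_def using \<theta> by (intro continuous_intros) (force simp: \<theta>_def)
    show "0 \<le> g' u" if "u \<in> {0..1}" for u
      using a b by (simp add: g'_def)
  qed simp
  moreover have "g 0 = 0" "g 1 = 1" using a by (simp_all add: g_def \<theta>_def)
  \<comment> \<open>Count of powers: the two factors of the density give \<open>?t\<close> to the
    power \<open>- 2 * (2 * s - 1)\<close> and the derivative gives \<open>-2\<close>, together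
    \<open>- 4 * s\<close>. The powers of \<open>a\<close> and \<open>b\<close> cancel against
    \<open>(a * b) powr (2 * s)\<close>.\<close>
  moreover have "f (g u) * g' u = beta_dens s u * exp (- r / \<theta> u) / \<theta> u powr (4 * s)" if u: "u \<in> {0..1}" for u
  proof -
    let ?t = "\<theta> u"
    have t: "?t > 0" using \<theta>[OF u] .
    have 1: "1 - g u = (1 - u) * b / ?t"
      using t by (simp add: g_def field_simps) (simp add: \<theta>_def algebra_simps)
    have "g u / a + (1 - g u) / b = u / ?t + (1 - u) / ?t"
      unfolding 1 using a b by (simp add: g_def)
    also have "\<dots> = 1 / ?t" by (simp add: add_divide_distrib[symmetric])
    finally have 2: "- r * (g u / a + (1 - g u) / b) = - r / ?t" by simp
    have 3: "g u powr (2 * s - 1) = u powr (2 * s - 1) * a powr (2 * s - 1) / ?t powr (2 * s - 1)"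
      using u a t by (simp add: g_def powr_mult powr_divide)
    have 4: "(1 - g u) powr (2 * s - 1) = (1 - u) powr (2 * s - 1) * b powr (2 * s - 1) / ?t powr (2 * s - 1)"
      unfolding 1 using u b t by (simp add: powr_mult powr_divide)
    have 5: "(a * b) powr (2 * s) = a powr (2 * s - 1) * b powr (2 * s - 1) * (a * b)"
      using a b by (simp add: powr_mult powr_diff)
    have 6: "?t powr (4 * s) = ?t powr (2 * s - 1) * ?t powr (2 * s - 1) * ?t\<^sup>2"
      using t by (simp add: powr_add[symmetric] powr_diff power2_eq_square)
    show ?thesis
      unfolding f_def 2 3 4 5 6 g'_def using a b t by (simp add: field_simps)
  qed
  ultimately show ?thesis
    by (auto simp: f_def intro!: nn_integral_cong split: split_indicator)
qed

text \<open>The powers separate into a radial factor and a Beta density in \<open>z\<close>; only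
  the exponential couples \<open>r\<close> with \<open>z\<close>, and it does so solely when the two
  scales differ. \<open>Beta\<close> appears as a factor to undo the normalisation of
  \<open>beta_dens\<close>.\<close>

lemma \<nu>_dens_polar:
  fixes a b r s z :: real
  assumes "s > 0" "a > 0" "b > 0" "r \<ge> 0" "z \<in> {0..1}"
  shows "\<nu>_dens s a (z * r) * \<nu>_dens s b ((1 - z) * r) =
    Beta (2 * s) (2 * s) * (r powr (2 * s - 1))\<^sup>2 / (Gamma (2 * s))\<^sup>2 *
     (beta_dens s z * exp (- r * (z / a + (1 - z) / b)) / (a * b) powr (2 * s))"
proof -
  have B: "Beta (2 * s) (2 * s) > 0" using assms by (simp add: Beta_real_pos)
  have e: "exp (- (z * r) / a) * exp (- ((1 - z) * r) / b) = exp (- r * (z / a + (1 - z) / b))"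
    by (simp add: exp_add[symmetric] algebra_simps)
  have "\<nu>_dens s a (z * r) * \<nu>_dens s b ((1 - z) * r) =
      z powr (2 * s - 1) * r powr (2 * s - 1) * ((1 - z) powr (2 * s - 1) * r powr (2 * s - 1)) /
      (a powr (2 * s) * b powr (2 * s) * (Gamma (2 * s))\<^sup>2) * (exp (- (z * r) / a) * exp (- ((1 - z) * r) / b))"
    using assms by (simp add: powr_mult power2_eq_square mult_ac)
  then show ?thesis
    unfolding e using assms B by (simp add: powr_mult power2_eq_square mult_ac)
qed

text \<open>The Jacobian times the radial factor of \<open>\<nu>_dens_polar\<close>. It does not
  involve the scales, so both sides of the exchange identity share it.\<close>

definition polar_weight :: "real \<Rightarrow> real \<Rightarrow> real" where
  "polar_weight s r = r * (Beta (2 * s) (2 * s) * (r powr (2 * s - 1))\<^sup>2 / (Gamma (2 * s))\<^sup>2)"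

text \<open>The mean of \<open>F\<close> after redistributing the total \<open>r\<close>. The
  outcome of a bulk move depends on the old pair through its total only.\<close>

definition polar_average :: "real \<Rightarrow> (real \<Rightarrow> real \<Rightarrow> ennreal) \<Rightarrow> real \<Rightarrow> ennreal" where
  "polar_average s F r = (\<integral>\<^sup>+u. ennreal (beta_dens s u) * F (u * r) ((1 - u) * r) * indicator {0..1} u \<partial>lborel)"

lemma measurable_curried:
  fixes F :: "real \<Rightarrow> real \<Rightarrow> ennreal"
  assumes "case_prod F \<in> borel_measurable (borel \<Otimes>\<^sub>M borel)" "f \<in> borel_measurable M" "g \<in> borel_measurable M"
  shows "(\<lambda>x. F (f x) (g x)) \<in> borel_measurable M"
  using measurable_compose[OF measurable_Pair[OF assms(2,3)] assms(1)] by simp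

lemma measurable_polar_average:
  assumes "case_prod F \<in> borel_measurable (borel \<Otimes>\<^sub>M borel)"
  shows "polar_average s F \<in> borel_measurable borel"
proof -
  note [measurable (raw)] = measurable_curried[OF assms]
  show ?thesis unfolding polar_average_def[abs_def] by measurable
qed

lemma polar_average_eq:
  assumes "case_prod F \<in> borel_measurable (borel \<Otimes>\<^sub>M borel)"
  shows "(\<integral>\<^sup>+u. F (u * r) ((1 - u) * r) \<partial>beta_distr s) = polar_average s F r"
proof -
  note [measurable (raw)] = measurable_curried[OF assms]
  show ?thesis unfolding polar_average_def by (rule nn_integral_beta_distr) measurable
qed

lemma nn_integral_\<nu>_pair:
  fixes G :: "real \<Rightarrow> real \<Rightarrow> ennreal"
  assumes G: "case_prod G \<in> borel_measurable (borel \<Otimes>\<^sub>M borel)"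
    and s: "s > 0" and a: "a > 0" and b: "b > 0"
  shows "(\<integral>\<^sup>+x. \<integral>\<^sup>+y. G x y \<partial>\<nu> s b \<partial>\<nu> s a) = (\<integral>\<^sup>+r. ennreal (polar_weight s r) * indicator {0..} r *
    (\<integral>\<^sup>+z. ennreal (beta_dens s z * exp (- r * (z / a + (1 - z) / b)) / (a * b) powr (2 * s)) *
       G (z * r) ((1 - z) * r) * indicator {0..1} z \<partial>lborel) \<partial>lborel)"
proof -
  note [measurable (raw)] = measurable_curried[OF G]
  let ?H = "\<lambda>x y. ennreal (\<nu>_dens s a x * \<nu>_dens s b y) * G x y"
  have "(\<integral>\<^sup>+x. \<integral>\<^sup>+y. G x y \<partial>\<nu> s b \<partial>\<nu> s a)
      = (\<integral>\<^sup>+x. \<integral>\<^sup>+y. ennreal (\<nu>_dens s b y) * G x y * indicator {0..} y \<partial>lborel \<partial>\<nu> s a)"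
    by (rule nn_integral_cong, rule nn_integral_\<nu>[OF b]) measurable
  also have "\<dots> = (\<integral>\<^sup>+x. ennreal (\<nu>_dens s a x) *
      (\<integral>\<^sup>+y. ennreal (\<nu>_dens s b y) * G x y * indicator {0..} y \<partial>lborel) * indicator {0..} x \<partial>lborel)"
    by (rule nn_integral_\<nu>[OF a]) measurable
  also have "\<dots> = (\<integral>\<^sup>+x. \<integral>\<^sup>+y. ?H x y * indicator {0..} x * indicator {0..} y \<partial>lborel \<partial>lborel)"
  proof (rule nn_integral_cong)
    fix x :: real
    have "ennreal (\<nu>_dens s a x) * (\<integral>\<^sup>+y. ennreal (\<nu>_dens s b y) * G x y * indicator {0..} y \<partial>lborel) * indicator {0..} x
       = (ennreal (\<nu>_dens s a x) * indicator {0..} x) * (\<integral>\<^sup>+y. ennreal (\<nu>_dens s b y) * G x y * indicator {0..} y \<partial>lborel)"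
      by (simp only: mult_ac)
    also have "\<dots> = (\<integral>\<^sup>+y. (ennreal (\<nu>_dens s a x) * indicator {0..} x) * (ennreal (\<nu>_dens s b y) * G x y * indicator {0..} y) \<partial>lborel)"
      by (rule nn_integral_cmult[symmetric]) measurable
    also have "\<dots> = (\<integral>\<^sup>+y. ?H x y * indicator {0..} x * indicator {0..} y \<partial>lborel)"
      by (rule nn_integral_cong, subst ennreal_mult'[OF \<nu>_dens_nonneg[OF s]]) (simp only: mult_ac)
    finally show "ennreal (\<nu>_dens s a x) * (\<integral>\<^sup>+y. ennreal (\<nu>_dens s b y) * G x y * indicator {0..} y \<partial>lborel) * indicator {0..} x
       = (\<integral>\<^sup>+y. ?H x y * indicator {0..} x * indicator {0..} y \<partial>lborel)" .
  qed
  also have "\<dots> = (\<integral>\<^sup>+r. ennreal r * indicator {0..} r * (\<integral>\<^sup>+z. ?H (z * r) ((1 - z) * r) * indicator {0..1} z \<partial>lborel) \<partial>lborel)"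
    by (rule nn_integral_quadrant_polar) measurable
  also have "\<dots> = (\<integral>\<^sup>+r. ennreal (polar_weight s r) * indicator {0..} r *
    (\<integral>\<^sup>+z. ennreal (beta_dens s z * exp (- r * (z / a + (1 - z) / b)) / (a * b) powr (2 * s)) *
       G (z * r) ((1 - z) * r) * indicator {0..1} z \<partial>lborel) \<partial>lborel)"
  proof (rule nn_integral_cong)
    fix r :: real
    let ?C = "Beta (2 * s) (2 * s) * (r powr (2 * s - 1))\<^sup>2 / (Gamma (2 * s))\<^sup>2"
    let ?D = "\<lambda>z. beta_dens s z * exp (- r * (z / a + (1 - z) / b)) / (a * b) powr (2 * s)"
    have C: "?C \<ge> 0" using s Beta_real_pos[of "2 * s" "2 * s"] by simp
    show "ennreal r * indicator {0..} r * (\<integral>\<^sup>+z. ?H (z * r) ((1 - z) * r) * indicator {0..1} z \<partial>lborel) =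
      ennreal (polar_weight s r) * indicator {0..} r * (\<integral>\<^sup>+z. ennreal (?D z) * G (z * r) ((1 - z) * r) * indicator {0..1} z \<partial>lborel)"
    proof (cases "r \<ge> 0")
      case True
      have "(\<integral>\<^sup>+z. ?H (z * r) ((1 - z) * r) * indicator {0..1} z \<partial>lborel)
        = (\<integral>\<^sup>+z. ennreal ?C * (ennreal (?D z) * G (z * r) ((1 - z) * r) * indicator {0..1} z) \<partial>lborel)"
      proof (rule nn_integral_cong)
        fix z :: real
        show "?H (z * r) ((1 - z) * r) * indicator {0..1} z = ennreal ?C * (ennreal (?D z) * G (z * r) ((1 - z) * r) * indicator {0..1} z)"
        proof (cases "z \<in> {0..1}")
          case z: True
          show ?thesis
            unfolding \<nu>_dens_polar[OF s a b True z] ennreal_mult'[OF C] by (simp only: mult_ac)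
        qed simp
      qed
      also have "\<dots> = ennreal ?C * (\<integral>\<^sup>+z. ennreal (?D z) * G (z * r) ((1 - z) * r) * indicator {0..1} z \<partial>lborel)"
        by (rule nn_integral_cmult) measurable
      finally show ?thesis
        unfolding polar_weight_def ennreal_mult'[OF True] by (simp only: mult_ac)
    qed simp
  qed
  finally show ?thesis .
qed

text \<open>For equal scales the exponent \<open>z / \<theta> + (1 - z) / \<theta>\<close> is free
  of \<open>z\<close>: the total and the ratio of two such Gamma variables are independent, and the
  ratio is Beta distributed.\<close>

lemma nn_integral_\<nu>_pair_iid:
  fixes G :: "real \<Rightarrow> real \<Rightarrow> ennreal"
  assumes G: "case_prod G \<in> borel_measurable (borel \<Otimes>\<^sub>M borel)"
    and s: "s > 0" and \<theta>: "\<theta> > 0"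
  shows "(\<integral>\<^sup>+x. \<integral>\<^sup>+y. G x y \<partial>\<nu> s \<theta> \<partial>\<nu> s \<theta>) = (\<integral>\<^sup>+r. ennreal (polar_weight s r) * indicator {0..} r *
    (ennreal (exp (- r / \<theta>) / \<theta> powr (4 * s)) * polar_average s G r) \<partial>lborel)"
  unfolding nn_integral_\<nu>_pair[OF G s \<theta> \<theta>]
proof (rule nn_integral_cong)
  fix r :: real
  note [measurable (raw)] = measurable_curried[OF G]
  let ?e = "exp (- r / \<theta>) / \<theta> powr (4 * s)"
  have "beta_dens s z * exp (- r * (z / \<theta> + (1 - z) / \<theta>)) / (\<theta> * \<theta>) powr (2 * s) = ?e * beta_dens s z" for z
    using \<theta> by (simp add: powr_mult powr_add[symmetric] add_divide_distrib[symmetric] mult_ac)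
  then have "(\<integral>\<^sup>+z. ennreal (beta_dens s z * exp (- r * (z / \<theta> + (1 - z) / \<theta>)) / (\<theta> * \<theta>) powr (2 * s)) *
       G (z * r) ((1 - z) * r) * indicator {0..1} z \<partial>lborel) =
      (\<integral>\<^sup>+z. ennreal ?e * (ennreal (beta_dens s z) * G (z * r) ((1 - z) * r) * indicator {0..1} z) \<partial>lborel)"
    by (intro nn_integral_cong) (simp only: ennreal_mult'[OF divide_nonneg_nonneg[OF exp_ge_zero powr_ge_zero]] mult.assoc)
  also have "\<dots> = ennreal ?e * polar_average s G r"
    unfolding polar_average_def by (rule nn_integral_cmult) measurable
  finally show "ennreal (polar_weight s r) * indicator {0..} r *
      (\<integral>\<^sup>+z. ennreal (beta_dens s z * exp (- r * (z / \<theta> + (1 - z) / \<theta>)) / (\<theta> * \<theta>) powr (2 * s)) *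
       G (z * r) ((1 - z) * r) * indicator {0..1} z \<partial>lborel) =
     ennreal (polar_weight s r) * indicator {0..} r * (ennreal ?e * polar_average s G r)"
    by (simp only:)
qed

text \<open>After a redistribution the two scales survive only in the law of the total. The left
  side is thus the integral of \<open>polar_average s F r\<close> against the density of the total,
  and \<open>nn_integral_beta_mobius\<close> writes this density as the Beta mixture of the
  densities of totals with equal scales. Reading \<open>nn_integral_\<nu>_pair_iid\<close> backwards
  for each \<open>u\<close> gives the right side.\<close>

lemma nn_integral_gamma_beta_exchange:
  fixes F :: "real \<Rightarrow> real \<Rightarrow> ennreal"
  assumes F: "case_prod F \<in> borel_measurable (borel \<Otimes>\<^sub>M borel)"
    and s: "s > 0" and a: "a > 0" and b: "b > 0"
  shows "(\<integral>\<^sup>+x. \<integral>\<^sup>+y. \<integral>\<^sup>+u. F (u * (x + y)) ((1 - u) * (x + y)) \<partial>beta_distr s \<partial>\<nu> s b \<partial>\<nu> s a) =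
    (\<integral>\<^sup>+u. \<integral>\<^sup>+x. \<integral>\<^sup>+y. F x y \<partial>\<nu> s (a * u + b * (1 - u)) \<partial>\<nu> s (a * u + b * (1 - u)) \<partial>beta_distr s)"
proof -
  note [measurable] = measurable_polar_average[OF F]
  let ?\<theta> = "\<lambda>u. a * u + b * (1 - u)"
  let ?e = "\<lambda>u r. exp (- r / ?\<theta> u) / ?\<theta> u powr (4 * s)"
  let ?W = "\<lambda>r. ennreal (polar_weight s r) * indicator {0..} r"
  let ?M = "\<lambda>r. \<integral>\<^sup>+u. ennreal (beta_dens s u * exp (- r / ?\<theta> u) / ?\<theta> u powr (4 * s)) * indicator {0..1} u \<partial>lborel"
  let ?D = "\<lambda>r z. beta_dens s z * exp (- r * (z / a + (1 - z) / b)) / (a * b) powr (2 * s)"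
  let ?G = "\<lambda>u r. ?W r * (ennreal (?e u r) * polar_average s F r)"
  have \<theta>: "?\<theta> u > 0" if "u \<in> {0..1}" for u
  proof (cases "u = 0")
    case False
    then have "a * u > 0" "b * (1 - u) \<ge> 0" using that a b by auto
    then show ?thesis by simp
  qed (use b in simp)
  have [measurable]: "polar_weight s \<in> borel_measurable borel"
    unfolding polar_weight_def[abs_def] by measurable
  have "(\<integral>\<^sup>+x. \<integral>\<^sup>+y. \<integral>\<^sup>+u. F (u * (x + y)) ((1 - u) * (x + y)) \<partial>beta_distr s \<partial>\<nu> s b \<partial>\<nu> s a)
     = (\<integral>\<^sup>+x. \<integral>\<^sup>+y. polar_average s F (x + y) \<partial>\<nu> s b \<partial>\<nu> s a)"
    by (simp only: polar_average_eq[OF F])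
  also have "\<dots> = (\<integral>\<^sup>+r. ?W r * (\<integral>\<^sup>+z. ennreal (?D r z) *
       polar_average s F (z * r + (1 - z) * r) * indicator {0..1} z \<partial>lborel) \<partial>lborel)"
    by (rule nn_integral_\<nu>_pair[OF _ s a b]) measurable
  \<comment> \<open>The two arguments sum to \<open>r\<close>, so the average comes out of the
    integral over \<open>z\<close>.\<close>
  also have "\<dots> = (\<integral>\<^sup>+r. ?W r * (polar_average s F r * ?M r) \<partial>lborel)"
  proof (rule nn_integral_cong)
    fix r :: real
    have 1: "z * r + (1 - z) * r = r" for z by (simp add: algebra_simps)
    have "(\<integral>\<^sup>+z. ennreal (?D r z) *
       polar_average s F (z * r + (1 - z) * r) * indicator {0..1} z \<partial>lborel)
      = (\<integral>\<^sup>+z. polar_average s F r * (ennreal (?D r z) * indicator {0..1} z) \<partial>lborel)"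
      unfolding 1 by (simp only: mult_ac)
    also have "\<dots> = polar_average s F r * (\<integral>\<^sup>+z. ennreal (?D r z) * indicator {0..1} z \<partial>lborel)"
      by (rule nn_integral_cmult) measurable
    finally show "?W r * (\<integral>\<^sup>+z. ennreal (?D r z) *
       polar_average s F (z * r + (1 - z) * r) * indicator {0..1} z \<partial>lborel)
      = ?W r * (polar_average s F r * ?M r)"
      by (simp only: nn_integral_beta_mobius[OF s a b])
  qed
  also have "\<dots> = (\<integral>\<^sup>+r. \<integral>\<^sup>+u. ennreal (beta_dens s u) * ?G u r * indicator {0..1} u \<partial>lborel \<partial>lborel)"
  proof (rule nn_integral_cong)
    fix r :: real
    have "?W r * (polar_average s F r * ?M r)
      = (?W r * polar_average s F r) * ?M r"
      by (simp only: mult_ac)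
    also have "\<dots> = (\<integral>\<^sup>+u. (?W r * polar_average s F r) * (ennreal (beta_dens s u * exp (- r / ?\<theta> u) / ?\<theta> u powr (4 * s)) * indicator {0..1} u) \<partial>lborel)"
      by (rule nn_integral_cmult[symmetric]) measurable
    also have "\<dots> = (\<integral>\<^sup>+u. ennreal (beta_dens s u) * ?G u r * indicator {0..1} u \<partial>lborel)"
    proof (rule nn_integral_cong)
      fix u :: real
      have "ennreal (beta_dens s u * exp (- r / ?\<theta> u) / ?\<theta> u powr (4 * s)) = ennreal (beta_dens s u) * ennreal (?e u r)"
        unfolding ennreal_mult'[OF beta_dens_nonneg[OF s], symmetric] by (simp only: times_divide_eq_right)
      then show "(?W r * polar_average s F r) * (ennreal (beta_dens s u * exp (- r / ?\<theta> u) / ?\<theta> u powr (4 * s)) * indicator {0..1} u)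
        = ennreal (beta_dens s u) * ?G u r * indicator {0..1} u"
        by (simp only: mult_ac)
    qed
    finally show "?W r * (polar_average s F r * ?M r)
      = (\<integral>\<^sup>+u. ennreal (beta_dens s u) * ?G u r * indicator {0..1} u \<partial>lborel)" .
  qed
  also have "\<dots> = (\<integral>\<^sup>+u. \<integral>\<^sup>+r. ennreal (beta_dens s u) * ?G u r * indicator {0..1} u \<partial>lborel \<partial>lborel)"
    by (rule lborel_pair.Fubini') measurable
  also have "\<dots> = (\<integral>\<^sup>+u. ennreal (beta_dens s u) * (\<integral>\<^sup>+r. ?W r * (ennreal (?e u r) * polar_average s F r) \<partial>lborel) * indicator {0..1} u \<partial>lborel)"
  proof (rule nn_integral_cong)
    fix u :: real
    have "(\<integral>\<^sup>+r. ennreal (beta_dens s u) * ?G u r * indicator {0..1} u \<partial>lborel)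
      = (\<integral>\<^sup>+r. (ennreal (beta_dens s u) * indicator {0..1} u) * ?G u r \<partial>lborel)"
      by (simp only: mult_ac)
    also have "\<dots> = (ennreal (beta_dens s u) * indicator {0..1} u) * (\<integral>\<^sup>+r. ?W r * (ennreal (?e u r) * polar_average s F r) \<partial>lborel)"
      by (rule nn_integral_cmult) measurable
    finally show "(\<integral>\<^sup>+r. ennreal (beta_dens s u) * ?G u r * indicator {0..1} u \<partial>lborel)
      = ennreal (beta_dens s u) * (\<integral>\<^sup>+r. ?W r * (ennreal (?e u r) * polar_average s F r) \<partial>lborel) * indicator {0..1} u"
      by (simp only: mult_ac)
  qed
  also have "\<dots> = (\<integral>\<^sup>+u. \<integral>\<^sup>+r. ?W r * (ennreal (?e u r) * polar_average s F r) \<partial>lborel \<partial>beta_distr s)"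
    by (rule nn_integral_beta_distr[symmetric]) measurable
  also have "\<dots> = (\<integral>\<^sup>+u. \<integral>\<^sup>+x. \<integral>\<^sup>+y. F x y \<partial>\<nu> s (?\<theta> u) \<partial>\<nu> s (?\<theta> u) \<partial>beta_distr s)"
    by (rule nn_integral_cong, rule nn_integral_\<nu>_pair_iid[OF F s, symmetric]) (use \<theta> in auto)
  finally show ?thesis .
qed

text \<open>For equal scales a bulk move resamples the ratio from its law given the total, so it
  acts as a conditional expectation, and these are self-adjoint. Concretely, both sides integrate
  the product of the two polar averages.\<close>

lemma nn_integral_gamma_beta_reversible:
  fixes F G :: "real \<Rightarrow> real \<Rightarrow> ennreal"
  assumes F: "case_prod F \<in> borel_measurable (borel \<Otimes>\<^sub>M borel)"
    and G: "case_prod G \<in> borel_measurable (borel \<Otimes>\<^sub>M borel)"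
    and s: "s > 0" and \<theta>: "\<theta> > 0"
  shows "(\<integral>\<^sup>+x. \<integral>\<^sup>+y. G x y * (\<integral>\<^sup>+u. F (u * (x + y)) ((1 - u) * (x + y)) \<partial>beta_distr s) \<partial>\<nu> s \<theta> \<partial>\<nu> s \<theta>) =
    (\<integral>\<^sup>+x. \<integral>\<^sup>+y. F x y * (\<integral>\<^sup>+u. G (u * (x + y)) ((1 - u) * (x + y)) \<partial>beta_distr s) \<partial>\<nu> s \<theta> \<partial>\<nu> s \<theta>)"
proof -
  have "(\<integral>\<^sup>+x. \<integral>\<^sup>+y. G x y * (\<integral>\<^sup>+u. F (u * (x + y)) ((1 - u) * (x + y)) \<partial>beta_distr s) \<partial>\<nu> s \<theta> \<partial>\<nu> s \<theta>) =
    (\<integral>\<^sup>+r. ennreal (polar_weight s r) * indicator {0..} r *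
    (ennreal (exp (- r / \<theta>) / \<theta> powr (4 * s)) * (polar_average s G r * polar_average s F r)) \<partial>lborel)"
    if F: "case_prod F \<in> borel_measurable (borel \<Otimes>\<^sub>M borel)"
    and G: "case_prod G \<in> borel_measurable (borel \<Otimes>\<^sub>M borel)" for F G :: "real \<Rightarrow> real \<Rightarrow> ennreal"
  proof -
    note [measurable] = measurable_polar_average[OF F]
    note [measurable (raw)] = measurable_curried[OF G]
    have avg: "polar_average s (\<lambda>x y. G x y * polar_average s F (x + y)) r = polar_average s G r * polar_average s F r" for r
    proof -
      have 1: "z * r + (1 - z) * r = r" for z by (simp add: algebra_simps)
      have "polar_average s (\<lambda>x y. G x y * polar_average s F (x + y)) r =
        (\<integral>\<^sup>+u. (ennreal (beta_dens s u) * G (u * r) ((1 - u) * r) * indicator {0..1} u) * polar_average s F r \<partial>lborel)"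
        unfolding polar_average_def[of s "\<lambda>x y. G x y * polar_average s F (x + y)"] 1 by (simp only: mult_ac)
      also have "\<dots> = polar_average s G r * polar_average s F r"
        unfolding polar_average_def[of s G] by (rule nn_integral_multc) measurable
      finally show ?thesis .
    qed
    show ?thesis
      unfolding polar_average_eq[OF F] avg[symmetric]
      by (rule nn_integral_\<nu>_pair_iid[OF _ s \<theta>]) measurable
  qed
  from this[OF F G] this[OF G F] show ?thesis by (simp only: mult.commute)
qed

section \<open>Kernels on the configuration space\<close>

lemma space_config [simp]: "space config = {\<zeta>. \<forall>i. \<zeta> i \<ge> 0}"
  by (auto simp: config_def space_PiM PiE_def)

lemma measurable_halflineI:
  assumes "f \<in> borel_measurable M" "\<And>z. z \<in> space M \<Longrightarrow> f z \<ge> (0::real)"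
  shows "f \<in> M \<rightarrow>\<^sub>M halfline"
  unfolding halfline_def by (rule measurable_restrict_space2) (use assms in auto)

lemma measurable_halflineD: "f \<in> M \<rightarrow>\<^sub>M halfline \<Longrightarrow> f \<in> borel_measurable M"
  unfolding halfline_def by (simp add: measurable_restrict_space2_iff)

lemma measurable_restrict_spaceD: "f \<in> M \<rightarrow>\<^sub>M restrict_space borel A \<Longrightarrow> f \<in> borel_measurable M"
  by (simp add: measurable_restrict_space2_iff)

lemma measurable_config_component: "(\<lambda>\<zeta>. \<zeta> i) \<in> borel_measurable config"
  unfolding config_def by (rule measurable_halflineD, rule measurable_component_singleton) simp

lemma measurable_configI:
  assumes "\<And>l. (\<lambda>z. h z l) \<in> borel_measurable M" "\<And>z l. z \<in> space M \<Longrightarrow> h z l \<ge> 0"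
  shows "h \<in> M \<rightarrow>\<^sub>M config"
  unfolding config_def
  by (rule measurable_PiM_single'[of UNIV "\<lambda>l z. h z l", simplified])
    (use assms in \<open>auto intro!: measurable_halflineI simp: PiE_def\<close>)

text \<open>For every \<theta>, including 0, \<open>\<nu> s \<theta>\<close> is the image of the
  unit Gamma law under multiplication by \<theta>. This gives measurability in \<theta> without any
  analysis of densities.\<close>

lemma measurable_\<nu>:
  assumes "s > 0"
  shows "\<nu> s \<in> halfline \<rightarrow>\<^sub>M prob_algebra halfline"
proof -
  have eq: "\<nu> s \<theta> = distr (\<nu> s 1) halfline (\<lambda>x. \<theta> * x)" if \<theta>: "\<theta> \<in> space halfline" for \<theta>
  proof (rule measure_eqI)
    have meas [measurable]: "(\<lambda>x. \<theta> * x) \<in> \<nu> s 1 \<rightarrow>\<^sub>M halfline"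
    proof (rule measurable_halflineI)
      have "(\<lambda>x. x) \<in> borel_measurable (\<nu> s 1)"
        by (rule measurable_halflineD, rule measurable_ident_sets) simp
      then show "(\<lambda>x. \<theta> * x) \<in> borel_measurable (\<nu> s 1)" by simp
    qed (use \<theta> in simp)
    fix A assume "A \<in> sets (\<nu> s \<theta>)"
    then have A: "A \<in> sets halfline" by simp
    then have A': "A \<in> sets borel" "A \<subseteq> {0..}"
      by (auto simp: halfline_def sets_restrict_space)
    show "emeasure (\<nu> s \<theta>) A = emeasure (distr (\<nu> s 1) halfline (\<lambda>x. \<theta> * x)) A"
    proof (cases "\<theta> = 0")
      case True
      have "emeasure (distr (\<nu> s 1) halfline (\<lambda>x. 0)) A = indicator A 0"
        using A prob_space.emeasure_space_1[OF prob_space_\<nu>[OF assms, of 1]]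
        by (subst emeasure_distr) (auto simp: indicator_def vimage_def)
      then show ?thesis using True A by (simp add: \<nu>_def)
    next
      case False
      have "emeasure (\<nu> s \<theta>) A = (\<integral>\<^sup>+x. indicator A x \<partial>\<nu> s \<theta>)"
        using A by simp
      also have "\<dots> = (\<integral>\<^sup>+x. indicator A (\<theta> * x) \<partial>\<nu> s 1)"
        using False \<theta> A' by (intro nn_integral_\<nu>_scale) auto
      also have "\<dots> = (\<integral>\<^sup>+x. indicator A x \<partial>distr (\<nu> s 1) halfline (\<lambda>x. \<theta> * x))"
        using A by (subst nn_integral_distr) auto
      finally show ?thesis using A by simp
    qed
  qed simp
  have "(\<lambda>\<theta>. distr (\<nu> s 1) halfline (\<lambda>x. \<theta> * x)) \<in> halfline \<rightarrow>\<^sub>M prob_algebra halfline"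
  proof (rule measurable_distr_prob_space2[of "\<lambda>_. \<nu> s 1" _ halfline])
    show "(\<lambda>_. \<nu> s 1) \<in> halfline \<rightarrow>\<^sub>M prob_algebra halfline"
      using prob_space_\<nu>[OF assms, of 1] by (intro measurable_const) (simp add: space_prob_algebra)
    show "(\<lambda>(\<theta>, x). \<theta> * x) \<in> halfline \<Otimes>\<^sub>M halfline \<rightarrow>\<^sub>M halfline"
      unfolding case_prod_beta
      by (intro measurable_halflineI borel_measurable_times
          measurable_halflineD[OF measurable_fst] measurable_halflineD[OF measurable_snd])
        (auto simp: space_pair_measure)
  qed
  moreover have "(\<nu> s \<in> halfline \<rightarrow>\<^sub>M prob_algebra halfline) =
      ((\<lambda>\<theta>. distr (\<nu> s 1) halfline (\<lambda>x. \<theta> * x)) \<in> halfline \<rightarrow>\<^sub>M prob_algebra halfline)"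
    by (rule measurable_cong) (rule eq)
  ultimately show ?thesis by blast
qed

lemma sets_\<nu>_prod [simp, measurable_cong]: "sets (\<nu>_prod s \<theta>) = sets config"
  unfolding \<nu>_prod_def config_def by (rule sets_PiM_cong) auto

lemma prob_space_\<nu>_prod:
  assumes "s > 0" "\<And>i. \<theta> i \<ge> 0"
  shows "prob_space (\<nu>_prod s \<theta>)"
  unfolding \<nu>_prod_def using assms by (intro prob_space_PiM prob_space_\<nu>)

lemma \<nu>_prod_space:
  assumes "s > 0" "\<And>i. \<theta> i \<ge> 0"
  shows "\<nu>_prod s \<theta> \<in> space (prob_algebra config)"
  using prob_space_\<nu>_prod[OF assms] by (simp add: space_prob_algebra)

text \<open>On rectangles, an intersection-stable generator, the mass is a finite product of
  one-site masses, each measurable in its own parameter.\<close>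

lemma measurable_\<nu>_prod:
  assumes s: "s > 0"
  shows "\<nu>_prod s \<in> (config :: ('v::finite \<Rightarrow> real) measure) \<rightarrow>\<^sub>M prob_algebra config"
proof (rule measurable_prob_algebra_generated)
  let ?G = "{Pi\<^sub>E UNIV A |A. \<forall>i::'v. A i \<in> sets halfline}"
  have "sets (Pi\<^sub>M UNIV (\<lambda>_::'v. halfline)) = sigma_sets (\<Pi>\<^sub>E i\<in>UNIV. space halfline) ?G"
    by (subst sets_PiM_finite) auto
  then show "sets config = sigma_sets (space (config :: ('v \<Rightarrow> real) measure)) ?G"
    by (simp add: config_def space_PiM)
  show "Int_stable ?G"
  proof (rule Int_stableI)
    fix a b assume "a \<in> ?G" "b \<in> ?G"
    then obtain A B where ab: "a = Pi\<^sub>E UNIV A" "b = Pi\<^sub>E UNIV B"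
      and AB: "\<forall>i. A i \<in> sets halfline" "\<forall>i. B i \<in> sets halfline"
      by blast
    have "a \<inter> b = Pi\<^sub>E UNIV (\<lambda>i. A i \<inter> B i)"
      unfolding ab by (rule PiE_Int)
    moreover have "\<forall>i. A i \<inter> B i \<in> sets halfline"
      using AB by blast
    ultimately show "a \<inter> b \<in> ?G" by blast
  qed
  show "?G \<subseteq> Pow (space (config :: ('v \<Rightarrow> real) measure))"
  proof
    fix C assume "C \<in> ?G"
    then obtain A where C: "C = Pi\<^sub>E UNIV A" and A: "\<forall>i. A i \<in> sets halfline" by blast
    have "A i \<subseteq> {0..}" for i
      using sets.sets_into_space[of "A i" halfline] A by simp
    then show "C \<in> Pow (space (config :: ('v \<Rightarrow> real) measure))"
      unfolding C by (fastforce simp: PiE_iff)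
  qed
  show "prob_space (\<nu>_prod s a)" if "a \<in> space config" for a :: "'v \<Rightarrow> real"
    using that by (intro prob_space_\<nu>_prod s) auto
  show "sets (\<nu>_prod s a) = sets config" for a :: "'v \<Rightarrow> real"
    by simp
  fix A assume "A \<in> ?G"
  then obtain B where A: "A = Pi\<^sub>E UNIV B" and B: "\<And>i. B i \<in> sets halfline" by auto
  have eq: "emeasure (\<nu>_prod s a) A = (\<Prod>i\<in>UNIV. emeasure (\<nu> s (a i)) (B i))" if "a \<in> space config" for a :: "'v \<Rightarrow> real"
  proof -
    have "product_prob_space (\<lambda>i. \<nu> s (a i))"
      using that s by (intro product_prob_spaceI prob_space_\<nu>) auto
    then interpret product_prob_space "\<lambda>i. \<nu> s (a i)" UNIV .
    show ?thesis unfolding \<nu>_prod_def A using B by (intro emeasure_PiM) auto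
  qed
  have "(\<lambda>a. \<Prod>i\<in>UNIV. emeasure (\<nu> s (a i)) (B i)) \<in> borel_measurable (config :: ('v \<Rightarrow> real) measure)"
  proof (intro borel_measurable_prod_ennreal)
    fix i :: 'v
    have "(\<lambda>a::'v \<Rightarrow> real. a i) \<in> config \<rightarrow>\<^sub>M halfline"
      by (rule measurable_halflineI[OF measurable_config_component]) auto
    from measurable_compose[OF this measurable_prob_algebraD[OF measurable_\<nu>[OF s]]]
    have "(\<lambda>a::'v \<Rightarrow> real. \<nu> s (a i)) \<in> config \<rightarrow>\<^sub>M subprob_algebra halfline" .
    from measurable_compose[OF this measurable_emeasure_subprob_algebra[OF B]]
    show "(\<lambda>a. emeasure (\<nu> s (a i)) (B i)) \<in> borel_measurable config" .
  qed
  moreover have "((\<lambda>a. emeasure (\<nu>_prod s a) A) \<in> borel_measurable (config :: ('v \<Rightarrow> real) measure)) =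
      ((\<lambda>a. \<Prod>i\<in>UNIV. emeasure (\<nu> s (a i)) (B i)) \<in> borel_measurable (config :: ('v \<Rightarrow> real) measure))"
    by (rule measurable_cong) (rule eq)
  ultimately show "(\<lambda>a. emeasure (\<nu>_prod s a) A) \<in> borel_measurable (config :: ('v \<Rightarrow> real) measure)"
    by blast
qed

section \<open>Jump operators with finitely many moves\<close>

definition jump_op :: "('k::finite \<Rightarrow> real) \<Rightarrow> ('k \<Rightarrow> 'a \<Rightarrow> 'a measure) \<Rightarrow> ('a \<Rightarrow> real) \<Rightarrow> 'a \<Rightarrow> real" where
  "jump_op r J f x = (\<Sum>k\<in>UNIV. r k * (\<integral>y. f y \<partial>J k x))"

lemma jump_op_measurable:
  assumes "\<And>k. J k \<in> X \<rightarrow>\<^sub>M prob_algebra X" "f \<in> borel_measurable X"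
  shows "jump_op r J f \<in> borel_measurable X"
  unfolding jump_op_def[abs_def]
  by (intro borel_measurable_sum borel_measurable_times borel_measurable_const prob_algebra_integral_measurable[OF assms])

lemma jump_op_bound:
  assumes J: "\<And>k. J k \<in> X \<rightarrow>\<^sub>M prob_algebra X" and f: "f \<in> borel_measurable X" "\<And>x. x \<in> space X \<Longrightarrow> \<bar>f x\<bar> \<le> B"
    and r: "\<And>k. r k \<ge> 0" and x: "x \<in> space X"
  shows "\<bar>jump_op r J f x\<bar> \<le> sum r UNIV * B"
proof -
  have "\<bar>jump_op r J f x\<bar> \<le> (\<Sum>k\<in>UNIV. \<bar>r k * (\<integral>y. f y \<partial>J k x)\<bar>)"
    unfolding jump_op_def by (rule sum_abs)
  also have "\<dots> \<le> (\<Sum>k\<in>UNIV. r k * B)"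
  proof (rule sum_mono)
    fix k
    have "\<bar>\<integral>y. f y \<partial>J k x\<bar> \<le> B"
      by (rule prob_algebra_bounded_integral(2)[OF measurable_space[OF J x] f])
    then show "\<bar>r k * (\<integral>y. f y \<partial>J k x)\<bar> \<le> r k * B"
      using r[of k] by (simp add: abs_mult mult_left_mono)
  qed
  finally show ?thesis by (simp add: sum_distrib_right)
qed

text \<open>\<open>L\<close> has to agree with the jump operator only on bounded measurable
  functions, the only ones that \<open>has_generator\<close> tests.\<close>

lemma bounded_generator_jump_op:
  fixes r :: "'k::finite \<Rightarrow> real"
  assumes P: "markov_process_with_generator X L P"
    and L: "\<And>f B x. f \<in> borel_measurable X \<Longrightarrow> (\<And>x. x \<in> space X \<Longrightarrow> \<bar>f x\<bar> \<le> B) \<Longrightarrow> x \<in> space X \<Longrightarrow>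
       L f x = jump_op r J f x - sum r UNIV * f x"
    and J: "\<And>k. J k \<in> X \<rightarrow>\<^sub>M prob_algebra X" and r: "\<And>k. r k \<ge> 0"
  shows "bounded_generator X P (jump_op r J) (sum r UNIV)"
proof
  show "markov_semigroup X P" using P by (simp add: markov_process_with_generator_def)
  show "has_generator X P (\<lambda>f x. jump_op r J f x - sum r UNIV * f x)"
    unfolding has_generator_def
  proof (intro ballI impI)
    fix f :: "'a \<Rightarrow> real" assume f: "f \<in> borel_measurable X" and b: "bounded (f ` space X)"
    from b obtain B where B: "\<And>x. x \<in> space X \<Longrightarrow> \<bar>f x\<bar> \<le> B"
      by (auto simp: bounded_iff)
    have "uniform_limit (space X) (\<lambda>t x. ((\<integral>y. f y \<partial>P t x) - f x) / t) (L f) (at_right 0)"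
      using P f b by (auto simp: markov_process_with_generator_def has_generator_def)
    then show "uniform_limit (space X) (\<lambda>t x. ((\<integral>y. f y \<partial>P t x) - f x) / t) (\<lambda>x. jump_op r J f x - sum r UNIV * f x) (at_right 0)"
      by (subst uniform_limit_cong'[of _ _ _ _ "L f", OF refl]) (auto simp: L[OF f B])
  qed
qed (use J r in \<open>auto intro!: jump_op_measurable jump_op_bound sum_nonneg\<close>)

section \<open>The moves of the two models and their kernels\<close>

type_synonym 'v move = "('v \<times> 'v) + 'v"

text \<open>Diagonal pairs remain in the index set, which keeps it a plain finite type, and receive
  rate 0 because the generators sum over distinct sites.\<close>

fun rate :: "('v \<Rightarrow> 'v \<Rightarrow> real) \<Rightarrow> ('v \<Rightarrow> real) \<Rightarrow> 'v move \<Rightarrow> real" where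
  "rate p c (Inl (i, j)) = (if i = j then 0 else p i j)"
| "rate p c (Inr i) = c i"

text \<open>Both kinds of move read the same noise, an injected energy \<open>y\<close> and a Beta
  variable \<open>u\<close>, so that one kernel definition covers them.\<close>

fun kmp_map :: "'v move \<Rightarrow> ('v \<Rightarrow> real) \<Rightarrow> real \<times> real \<Rightarrow> 'v \<Rightarrow> real" where
  "kmp_map (Inl (i, j)) \<zeta> (y, u) = \<zeta>(i := u * (\<zeta> i + \<zeta> j), j := (1 - u) * (\<zeta> i + \<zeta> j))"
| "kmp_map (Inr i) \<zeta> (y, u) = \<zeta>(i := (\<zeta> i + y) * u)"

fun hidden_map :: "('v \<Rightarrow> real) \<Rightarrow> 'v move \<Rightarrow> ('v \<Rightarrow> real) \<Rightarrow> real \<Rightarrow> 'v \<Rightarrow> real" where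
  "hidden_map \<theta>' (Inl (i, j)) \<theta> u = \<theta>(i := \<theta> i * u + \<theta> j * (1 - u), j := \<theta> i * u + \<theta> j * (1 - u))"
| "hidden_map \<theta>' (Inr i) \<theta> u = \<theta>(i := (1 - u) * \<theta> i + u * \<theta>' i)"

text \<open>A bulk move ignores the injected energy, so its law in that case is immaterial.\<close>

fun injected_law :: "real \<Rightarrow> ('v \<Rightarrow> real) \<Rightarrow> 'v move \<Rightarrow> real measure" where
  "injected_law s \<theta>' (Inl _) = \<nu> s 1"
| "injected_law s \<theta>' (Inr i) = \<nu> s (\<theta>' i)"

definition kmp_kernel :: "real \<Rightarrow> ('v::finite \<Rightarrow> real) \<Rightarrow> 'v move \<Rightarrow> ('v \<Rightarrow> real) \<Rightarrow> ('v \<Rightarrow> real) measure" where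
  "kmp_kernel s \<theta>' k \<zeta> = distr (injected_law s \<theta>' k \<Otimes>\<^sub>M beta_distr s) config (kmp_map k \<zeta>)"

definition hidden_kernel :: "real \<Rightarrow> ('v::finite \<Rightarrow> real) \<Rightarrow> 'v move \<Rightarrow> ('v \<Rightarrow> real) \<Rightarrow> ('v \<Rightarrow> real) measure" where
  "hidden_kernel s \<theta>' k \<theta> = distr (beta_distr s) config (hidden_map \<theta>' k \<theta>)"

lemma sum_move:
  fixes F :: "('v::finite) move \<Rightarrow> real"
  shows "sum F UNIV = (\<Sum>i\<in>UNIV. \<Sum>j\<in>UNIV. F (Inl (i, j))) + (\<Sum>i\<in>UNIV. F (Inr i))"
proof -
  have "sum F UNIV = sum F (UNIV <+> UNIV)" by simp
  also have "\<dots> = (\<Sum>q\<in>UNIV. F (Inl q)) + (\<Sum>i\<in>UNIV. F (Inr i))"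
    by (subst sum.Plus) (auto simp: comp_def)
  also have "(\<Sum>q\<in>UNIV. F (Inl q)) = (\<Sum>i\<in>UNIV. \<Sum>j\<in>UNIV. F (Inl (i, j)))"
    by (subst UNIV_Times_UNIV[symmetric], subst sum.cartesian_product) auto
  finally show ?thesis .
qed

lemma sets_injected_law [simp, measurable_cong]: "sets (injected_law s \<theta>' k) = sets halfline"
  by (cases k) auto

lemma space_injected_law [simp]: "space (injected_law s \<theta>' k) = {0..}"
  using sets_eq_imp_space_eq[OF sets_injected_law[of s \<theta>' k]] by simp

lemma prob_space_injected_law:
  "s > 0 \<Longrightarrow> (\<And>i. \<theta>' i > 0) \<Longrightarrow> prob_space (injected_law s \<theta>' k)"
  by (cases k) (auto intro!: prob_space_\<nu> simp: less_imp_le)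

lemma kmp_map_measurable:
  "case_prod (kmp_map k) \<in> config \<Otimes>\<^sub>M (halfline \<Otimes>\<^sub>M restrict_space borel {0..1}) \<rightarrow>\<^sub>M config"
proof (rule measurable_configI)
  have [measurable]: "(\<lambda>z. fst z l) \<in> borel_measurable (config \<Otimes>\<^sub>M N)" for l and N :: "'n measure"
    by (rule measurable_compose[OF measurable_fst measurable_config_component])
  have [measurable]: "(\<lambda>z. fst (snd z)) \<in> borel_measurable (config \<Otimes>\<^sub>M (halfline \<Otimes>\<^sub>M restrict_space borel {0..1::real}))"
    by (rule measurable_halflineD) measurable
  have [measurable]: "(\<lambda>z. snd (snd z)) \<in> borel_measurable (config \<Otimes>\<^sub>M (halfline \<Otimes>\<^sub>M restrict_space borel {0..1::real}))"
    by (rule measurable_restrict_spaceD) measurable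
  show "(\<lambda>z. case_prod (kmp_map k) z l) \<in> borel_measurable (config \<Otimes>\<^sub>M (halfline \<Otimes>\<^sub>M restrict_space borel {0..1}))" for l
  proof (cases k)
    case (Inl q)
    obtain i j where q: "q = (i, j)" by (cases q)
    have "(\<lambda>z. case_prod (kmp_map k) z l) = (\<lambda>z. if l = j then (1 - snd (snd z)) * (fst z i + fst z j)
       else if l = i then snd (snd z) * (fst z i + fst z j) else fst z l)"
      by (auto simp: Inl q fun_eq_iff)
    then show ?thesis by simp
  next
    case (Inr i)
    have "(\<lambda>z. case_prod (kmp_map k) z l) = (\<lambda>z. if l = i then (fst z i + fst (snd z)) * snd (snd z) else fst z l)"
      by (auto simp: Inr fun_eq_iff)
    then show ?thesis by simp
  qed
  show "0 \<le> case_prod (kmp_map k) z l" if "z \<in> space (config \<Otimes>\<^sub>M (halfline \<Otimes>\<^sub>M restrict_space borel {0..1}))" for z l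
    using that by (cases k) (auto simp: space_pair_measure)
qed

lemma hidden_map_measurable:
  assumes "\<And>i. \<theta>' i > 0"
  shows "case_prod (hidden_map \<theta>' k) \<in> config \<Otimes>\<^sub>M restrict_space borel {0..1} \<rightarrow>\<^sub>M config"
proof (rule measurable_configI)
  have [measurable]: "(\<lambda>z. fst z l) \<in> borel_measurable (config \<Otimes>\<^sub>M N)" for l and N :: "'n measure"
    by (rule measurable_compose[OF measurable_fst measurable_config_component])
  have [measurable]: "snd \<in> borel_measurable (config \<Otimes>\<^sub>M restrict_space borel {0..1::real})"
    by (rule measurable_restrict_spaceD[OF measurable_snd])
  show "(\<lambda>z. case_prod (hidden_map \<theta>' k) z l) \<in> borel_measurable (config \<Otimes>\<^sub>M restrict_space borel {0..1})" for l
  proof (cases k)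
    case (Inl q)
    obtain i j where q: "q = (i, j)" by (cases q)
    have "(\<lambda>z. case_prod (hidden_map \<theta>' k) z l) = (\<lambda>z. if l = j \<or> l = i then fst z i * snd z + fst z j * (1 - snd z) else fst z l)"
      by (auto simp: Inl q fun_eq_iff)
    then show ?thesis by simp
  next
    case (Inr i)
    have "(\<lambda>z. case_prod (hidden_map \<theta>' k) z l) = (\<lambda>z. if l = i then (1 - snd z) * fst z i + snd z * \<theta>' i else fst z l)"
      by (auto simp: Inr fun_eq_iff)
    then show ?thesis by simp
  qed
  show "0 \<le> case_prod (hidden_map \<theta>' k) z l" if "z \<in> space (config \<Otimes>\<^sub>M restrict_space borel {0..1})" for z l
    using that assms by (cases k) (auto simp: space_pair_measure less_imp_le)
qed

lemma measurable_kmp_kernel: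
  assumes "s > 0" "\<And>i. \<theta>' i > 0"
  shows "kmp_kernel s \<theta>' k \<in> config \<rightarrow>\<^sub>M prob_algebra config"
  unfolding kmp_kernel_def[abs_def]
proof (rule measurable_distr_prob_space2[OF _ kmp_map_measurable])
  have "prob_space (injected_law s \<theta>' k \<Otimes>\<^sub>M beta_distr s)"
    by (intro prob_space_pair prob_space_injected_law prob_space_beta_distr assms)
  then show "(\<lambda>_. injected_law s \<theta>' k \<Otimes>\<^sub>M beta_distr s) \<in> config \<rightarrow>\<^sub>M prob_algebra (halfline \<Otimes>\<^sub>M restrict_space borel {0..1})"
    by (intro measurable_const) (simp add: space_prob_algebra cong: sets_pair_measure_cong)
qed

lemma measurable_hidden_kernel:
  assumes "s > 0" "\<And>i. \<theta>' i > 0"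
  shows "hidden_kernel s \<theta>' k \<in> config \<rightarrow>\<^sub>M prob_algebra config"
  unfolding hidden_kernel_def[abs_def]
proof (rule measurable_distr_prob_space2[OF _ hidden_map_measurable])
  show "(\<lambda>_. beta_distr s) \<in> config \<rightarrow>\<^sub>M prob_algebra (restrict_space borel {0..1})"
    using prob_space_beta_distr[OF assms(1)] by (intro measurable_const) (simp add: space_prob_algebra)
qed (use assms in auto)

lemma kmp_map_measurable_noise:
  assumes "\<zeta> \<in> space config"
  shows "kmp_map k \<zeta> \<in> injected_law s \<theta>' k \<Otimes>\<^sub>M beta_distr s \<rightarrow>\<^sub>M config"
proof -
  have "kmp_map k \<zeta> \<in> halfline \<Otimes>\<^sub>M restrict_space borel {0..1} \<rightarrow>\<^sub>M config"
    using measurable_Pair2[OF kmp_map_measurable assms] by (simp add: case_prod_eta)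
  moreover have "sets (injected_law s \<theta>' k \<Otimes>\<^sub>M beta_distr s) = sets (halfline \<Otimes>\<^sub>M restrict_space borel {0..1})"
    by (intro sets_pair_measure_cong sets_injected_law sets_beta_distr)
  ultimately show ?thesis
    using measurable_cong_sets by blast
qed

lemma hidden_map_measurable_noise:
  assumes "\<And>i. \<theta>' i > 0" "\<theta> \<in> space config"
  shows "hidden_map \<theta>' k \<theta> \<in> beta_distr s \<rightarrow>\<^sub>M config"
proof -
  have "hidden_map \<theta>' k \<theta> \<in> restrict_space borel {0..1} \<rightarrow>\<^sub>M config"
    using measurable_Pair2[OF hidden_map_measurable[OF assms(1)] assms(2)] by (simp add: case_prod_eta)
  then show ?thesis
    using measurable_cong_sets[OF sets_beta_distr refl] by blast
qed

text \<open>Both Beta parameters equal \<open>2 * s\<close>, so the density is symmetric about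
  1/2.\<close>

lemma nn_integral_beta_distr_flip:
  assumes [measurable]: "g \<in> borel_measurable borel"
  shows "(\<integral>\<^sup>+u. g (1 - u) \<partial>beta_distr s) = (\<integral>\<^sup>+u. g u \<partial>beta_distr s)"
proof -
  have "(\<integral>\<^sup>+u. g u \<partial>beta_distr s) = (\<integral>\<^sup>+u. ennreal (beta_dens s u) * g u * indicator {0..1} u \<partial>lborel)"
    by (rule nn_integral_beta_distr) simp
  also have "\<dots> = \<bar>- 1 :: real\<bar> * (\<integral>\<^sup>+u. ennreal (beta_dens s (1 + (-1) * u)) * g (1 + (-1) * u) * indicator {0..1} (1 + (-1) * u) \<partial>lborel)"
    by (rule nn_integral_real_affine) auto
  also have "\<dots> = (\<integral>\<^sup>+u. ennreal (beta_dens s u) * g (1 - u) * indicator {0..1} u \<partial>lborel)"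
    by (auto intro!: nn_integral_cong simp: indicator_def mult_ac)
  also have "\<dots> = (\<integral>\<^sup>+u. g (1 - u) \<partial>beta_distr s)"
    by (rule nn_integral_beta_distr[symmetric]) simp
  finally show ?thesis by simp
qed

lemma (in prob_space) distr_pair_snd:
  assumes "sigma_finite_measure N"
  shows "distr (M \<Otimes>\<^sub>M N) N snd = N"
proof (rule measure_eqI)
  interpret N: sigma_finite_measure N by fact
  fix A assume "A \<in> sets (distr (M \<Otimes>\<^sub>M N) N snd)"
  then have A: "A \<in> sets N" by simp
  then have "snd -` A \<inter> space (M \<Otimes>\<^sub>M N) = space M \<times> A"
    using sets.sets_into_space by (auto simp: space_pair_measure)
  then show "emeasure (distr (M \<Otimes>\<^sub>M N) N snd) A = emeasure N A"
    using A by (simp add: emeasure_distr N.emeasure_pair_measure_Times emeasure_space_1)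
qed simp

lemma kmp_bulk_map_measurable:
  assumes s: "s > 0" and \<zeta>: "\<zeta> \<in> space config"
  shows "(\<lambda>u. \<zeta>(i := u * (\<zeta> i + \<zeta> j), j := (1 - u) * (\<zeta> i + \<zeta> j))) \<in> beta_distr s \<rightarrow>\<^sub>M config"
proof -
  have "(\<lambda>u. (0, u)) \<in> beta_distr s \<rightarrow>\<^sub>M halfline \<Otimes>\<^sub>M restrict_space borel {0..1}"
    by (intro measurable_Pair measurable_const measurable_ident_sets) auto
  from measurable_compose[OF this, of "kmp_map (Inl (i, j)) \<zeta>" config]
  show ?thesis
    using measurable_Pair2[OF kmp_map_measurable \<zeta>] by (simp add: case_prod_eta)
qed

lemma kmp_kernel_bulk:
  assumes s: "s > 0" and \<theta>': "\<And>i. \<theta>' i > 0" and \<zeta>: "\<zeta> \<in> space config"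
  shows "kmp_kernel s \<theta>' (Inl (i, j)) \<zeta> =
    distr (beta_distr s) config (\<lambda>u. \<zeta>(i := u * (\<zeta> i + \<zeta> j), j := (1 - u) * (\<zeta> i + \<zeta> j)))"
proof -
  let ?N = "injected_law s \<theta>' (Inl (i, j))"
  let ?f = "\<lambda>u. \<zeta>(i := u * (\<zeta> i + \<zeta> j), j := (1 - u) * (\<zeta> i + \<zeta> j))"
  have N: "prob_space ?N" by (intro prob_space_injected_law s \<theta>')
  have B: "prob_space (beta_distr s)" by (rule prob_space_beta_distr[OF s])
  have "distr (distr (?N \<Otimes>\<^sub>M beta_distr s) (beta_distr s) snd) config ?f = distr (?N \<Otimes>\<^sub>M beta_distr s) config (?f \<circ> snd)"
    by (rule distr_distr[OF kmp_bulk_map_measurable[OF s \<zeta>] measurable_snd])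
  moreover have "distr (?N \<Otimes>\<^sub>M beta_distr s) (beta_distr s) snd = beta_distr s"
    by (intro prob_space.distr_pair_snd N prob_space_imp_sigma_finite B)
  moreover have "kmp_map (Inl (i, j)) \<zeta> = ?f \<circ> snd"
    by (auto simp: fun_eq_iff)
  ultimately show ?thesis by (simp add: kmp_kernel_def)
qed

lemma integral_distr_increment:
  fixes f :: "'a \<Rightarrow> real"
  assumes M: "prob_space M" and T: "T \<in> M \<rightarrow>\<^sub>M X"
    and f: "f \<in> borel_measurable X" and B: "\<And>x. x \<in> space X \<Longrightarrow> \<bar>f x\<bar> \<le> B"
  shows "(\<integral>\<omega>. f (T \<omega>) - a \<partial>M) = (\<integral>x. f x \<partial>distr M X T) - a"
proof -
  interpret prob_space M by fact
  have "integrable M (\<lambda>\<omega>. f (T \<omega>))"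
    by (rule integrable_const_bound[of _ B])
      (use measurable_space[OF T] B measurable_compose[OF T f] in auto)
  then show ?thesis
    by (simp add: integral_distr[OF T f] prob_space)
qed

lemma sum_rate_bulk:
  fixes F :: "'v::finite \<Rightarrow> 'v \<Rightarrow> real"
  shows "(\<Sum>i\<in>UNIV. \<Sum>j\<in>UNIV. rate p c (Inl (i, j)) * F i j) = (\<Sum>i\<in>UNIV. \<Sum>j\<in>UNIV - {i}. p i j * F i j)"
proof (rule sum.cong[OF refl])
  fix i :: 'v
  have "(\<Sum>j\<in>UNIV. rate p c (Inl (i, j)) * F i j) = (\<Sum>j\<in>UNIV - {i}. rate p c (Inl (i, j)) * F i j)"
    by (subst sum.remove[of UNIV i]) auto
  also have "\<dots> = (\<Sum>j\<in>UNIV - {i}. p i j * F i j)"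
    by (rule sum.cong) auto
  finally show "(\<Sum>j\<in>UNIV. rate p c (Inl (i, j)) * F i j) = (\<Sum>j\<in>UNIV - {i}. p i j * F i j)" .
qed

lemma jump_op_increment:
  "jump_op r J f x - sum r UNIV * f x = (\<Sum>k\<in>UNIV. r k * ((\<integral>y. f y \<partial>J k x) - f x))"
  by (simp add: jump_op_def right_diff_distrib sum_subtractf sum_distrib_right)

text \<open>Boundedness of \<open>f\<close> makes the integrals finite, so that each increment
  splits into the mean after the move minus \<open>f \<zeta>\<close>; the subtracted terms add up to
  the total rate.\<close>

lemma kmp_generator_eq:
  assumes s: "s > 0" and \<theta>': "\<And>i. \<theta>' i > 0"
    and f: "f \<in> borel_measurable config" and B: "\<And>x. x \<in> space config \<Longrightarrow> \<bar>f x\<bar> \<le> B"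
    and \<zeta>: "\<zeta> \<in> space config"
  shows "kmp_generator s p c \<theta>' f \<zeta> =
    jump_op (rate p c) (kmp_kernel s \<theta>') f \<zeta> - sum (rate p c) UNIV * f \<zeta>"
proof -
  let ?D = "\<lambda>k. (\<integral>y. f y \<partial>kmp_kernel s \<theta>' k \<zeta>) - f \<zeta>"
  have B': "prob_space (beta_distr s)" by (rule prob_space_beta_distr[OF s])
  have bulk: "act_on_pair i j (kmp_bulk s) f \<zeta> = ?D (Inl (i, j))" for i j
    using integral_distr_increment[OF B' kmp_bulk_map_measurable[OF s \<zeta>] f B, where a="f \<zeta>"]
    by (simp add: act_on_pair_def kmp_bulk_def kmp_kernel_bulk[OF s \<theta>' \<zeta>])
  have site: "act_on_site i (kmp_reservoir s (\<theta>' i)) f \<zeta> = ?D (Inr i)" for i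
  proof -
    have "(\<integral>z. f (kmp_map (Inr i) \<zeta> z) - f \<zeta> \<partial>(injected_law s \<theta>' (Inr i) \<Otimes>\<^sub>M beta_distr s)) = ?D (Inr i)"
      unfolding kmp_kernel_def
      by (rule integral_distr_increment[OF _ kmp_map_measurable_noise[OF \<zeta>] f B])
         (intro prob_space_pair prob_space_injected_law s \<theta>' B')
    moreover have "(\<lambda>z. f (kmp_map (Inr i) \<zeta> z) - f \<zeta>) = (\<lambda>(y, b). f (\<zeta>(i := (\<zeta> i + y) * b)) - f \<zeta>)"
      by auto
    ultimately show ?thesis
      by (simp add: act_on_site_def kmp_reservoir_def)
  qed
  show ?thesis
    unfolding kmp_generator_def jump_op_increment
    unfolding sum_move bulk site sum_rate_bulk by simp
qed

lemma hidden_generator_eq: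
  assumes s: "s > 0" and \<theta>': "\<And>i. \<theta>' i > 0"
    and f: "f \<in> borel_measurable config" and B: "\<And>x. x \<in> space config \<Longrightarrow> \<bar>f x\<bar> \<le> B"
    and \<theta>: "\<theta> \<in> space config"
  shows "hidden_generator s p c \<theta>' f \<theta> =
    jump_op (rate p c) (hidden_kernel s \<theta>') f \<theta> - sum (rate p c) UNIV * f \<theta>"
proof -
  let ?D = "\<lambda>k. (\<integral>y. f y \<partial>hidden_kernel s \<theta>' k \<theta>) - f \<theta>"
  have B': "prob_space (beta_distr s)" by (rule prob_space_beta_distr[OF s])
  have D: "(\<integral>u. f (hidden_map \<theta>' k \<theta> u) - f \<theta> \<partial>beta_distr s) = ?D k" for k
    unfolding hidden_kernel_def
    by (rule integral_distr_increment[OF B' hidden_map_measurable_noise[OF \<theta>' \<theta>] f B])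
  have bulk: "act_on_pair i j (hidden_bulk s) f \<theta> = ?D (Inl (i, j))" for i j
    using D[of "Inl (i, j)"] by (simp add: act_on_pair_def hidden_bulk_def)
  have site: "act_on_site i (hidden_reservoir s (\<theta>' i)) f \<theta> = ?D (Inr i)" for i
    using D[of "Inr i"] by (simp add: act_on_site_def hidden_reservoir_def)
  show ?thesis
    unfolding hidden_generator_def jump_op_increment
    unfolding sum_move bulk site sum_rate_bulk by simp
qed

lemma nn_integral_kmp_kernel_bulk:
  assumes s: "s > 0" and \<theta>': "\<And>i. \<theta>' i > 0" and \<zeta>: "\<zeta> \<in> space config"
    and f: "f \<in> borel_measurable config"
  shows "(\<integral>\<^sup>+x. f x \<partial>kmp_kernel s \<theta>' (Inl (i, j)) \<zeta>) =
    (\<integral>\<^sup>+u. f (\<zeta>(i := u * (\<zeta> i + \<zeta> j), j := (1 - u) * (\<zeta> i + \<zeta> j))) \<partial>beta_distr s)"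
  unfolding kmp_kernel_bulk[OF s \<theta>' \<zeta>]
  by (rule nn_integral_distr[OF kmp_bulk_map_measurable[OF s \<zeta>]]) (use f in simp)

lemma nn_integral_kmp_kernel_site:
  assumes s: "s > 0" and \<theta>': "\<And>i. \<theta>' i > 0" and \<zeta>: "\<zeta> \<in> space config"
    and f: "f \<in> borel_measurable config"
  shows "(\<integral>\<^sup>+x. f x \<partial>kmp_kernel s \<theta>' (Inr i) \<zeta>) =
    (\<integral>\<^sup>+y. \<integral>\<^sup>+u. f (\<zeta>(i := (\<zeta> i + y) * u)) \<partial>beta_distr s \<partial>\<nu> s (\<theta>' i))"
proof -
  interpret B: prob_space "beta_distr s" by (rule prob_space_beta_distr[OF s])
  note m = kmp_map_measurable_noise[OF \<zeta>, of "Inr i" s \<theta>']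
  have "(\<integral>\<^sup>+x. f x \<partial>kmp_kernel s \<theta>' (Inr i) \<zeta>) = (\<integral>\<^sup>+z. f (kmp_map (Inr i) \<zeta> z) \<partial>(injected_law s \<theta>' (Inr i) \<Otimes>\<^sub>M beta_distr s))"
    unfolding kmp_kernel_def by (rule nn_integral_distr[OF m]) (use f in simp)
  also have "\<dots> = (\<integral>\<^sup>+y. \<integral>\<^sup>+u. f (kmp_map (Inr i) \<zeta> (y, u)) \<partial>beta_distr s \<partial>injected_law s \<theta>' (Inr i))"
    by (rule B.nn_integral_fst[symmetric]) (rule measurable_compose[OF m f])
  finally show ?thesis by simp
qed

lemma nn_integral_hidden_kernel:
  assumes \<theta>': "\<And>i. \<theta>' i > 0" and \<theta>: "\<theta> \<in> space config"
    and f: "f \<in> borel_measurable config"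
  shows "(\<integral>\<^sup>+x. f x \<partial>hidden_kernel s \<theta>' k \<theta>) = (\<integral>\<^sup>+u. f (hidden_map \<theta>' k \<theta> u) \<partial>beta_distr s)"
  unfolding hidden_kernel_def
  by (rule nn_integral_distr[OF hidden_map_measurable_noise]) (use f \<theta> \<theta>' in auto)

section \<open>Splitting one or two sites off the product law\<close>

text \<open>The law of the coordinates outside \<open>A\<close>. Its points carry no information on
  \<open>A\<close> and become configurations only once these coordinates are filled in by
  updates.\<close>

abbreviation \<nu>_off :: "real \<Rightarrow> ('v \<Rightarrow> real) \<Rightarrow> 'v set \<Rightarrow> ('v \<Rightarrow> real) measure" where
  "\<nu>_off s \<theta> A \<equiv> Pi\<^sub>M (UNIV - A) (\<lambda>l. \<nu> s (\<theta> l))"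

lemma space_\<nu>_off: "\<eta> \<in> space (\<nu>_off s \<theta> A) \<Longrightarrow> l \<notin> A \<Longrightarrow> \<eta> l \<ge> 0"
  by (auto simp: space_PiM PiE_def Pi_def)

lemma prob_space_\<nu>_off: "s > 0 \<Longrightarrow> (\<And>i. \<theta> i \<ge> 0) \<Longrightarrow> prob_space (\<nu>_off s \<theta> A)"
  by (intro prob_space_PiM prob_space_\<nu>)

lemma \<nu>_off_component: "l \<notin> A \<Longrightarrow> (\<lambda>\<eta>. \<eta> l) \<in> borel_measurable (\<nu>_off s \<theta> A)"
proof (rule measurable_halflineD)
  assume "l \<notin> A"
  then have "(\<lambda>\<eta>. \<eta> l) \<in> \<nu>_off s \<theta> A \<rightarrow>\<^sub>M \<nu> s (\<theta> l)"
    by (intro measurable_component_singleton) simp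
  then show "(\<lambda>\<eta>. \<eta> l) \<in> \<nu>_off s \<theta> A \<rightarrow>\<^sub>M halfline"
    using measurable_cong_sets[OF refl sets_\<nu>] by blast
qed

text \<open>Truncation at 0 turns functions of two sites into functions on the whole plane, as required by the
  exchange identity.\<close>

lemma update_pair_measurable:
  "(\<lambda>(z, \<eta>). \<eta>(i := max 0 (fst z), j := max 0 (snd z))) \<in> (borel \<Otimes>\<^sub>M borel) \<Otimes>\<^sub>M \<nu>_off s \<theta> {i, j} \<rightarrow>\<^sub>M config"
proof (rule measurable_configI)
  fix l
  show "(\<lambda>w. (case w of (z, \<eta>) \<Rightarrow> \<eta>(i := max 0 (fst z), j := max 0 (snd z))) l) \<in>
     borel_measurable ((borel \<Otimes>\<^sub>M borel) \<Otimes>\<^sub>M \<nu>_off s \<theta> {i, j})"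
  proof (cases "l \<in> {i, j}")
    case True
    then have eq: "(\<lambda>w. (case w of (z, \<eta>) \<Rightarrow> \<eta>(i := max 0 (fst z), j := max 0 (snd z))) l) =
       (\<lambda>w. if l = j then max 0 (snd (fst w)) else max 0 (fst (fst w)))"
      by (auto simp: fun_eq_iff)
    show ?thesis unfolding eq by measurable
  next
    case False
    then have eq: "(\<lambda>w. (case w of (z, \<eta>) \<Rightarrow> \<eta>(i := max 0 (fst z), j := max 0 (snd z))) l) = (\<lambda>w. snd w l)"
      by (auto simp: fun_eq_iff)
    show ?thesis
      unfolding eq by (rule measurable_compose[OF measurable_snd \<nu>_off_component[OF False]])
  qed
qed (auto simp: space_pair_measure space_\<nu>_off)

lemma update_site_measurable:
  "(\<lambda>(x, \<eta>). \<eta>(i := max 0 x)) \<in> borel \<Otimes>\<^sub>M \<nu>_off s \<theta> {i} \<rightarrow>\<^sub>M config"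
proof (rule measurable_configI)
  fix l
  show "(\<lambda>w. (case w of (x, \<eta>) \<Rightarrow> \<eta>(i := max 0 x)) l) \<in> borel_measurable (borel \<Otimes>\<^sub>M \<nu>_off s \<theta> {i})"
  proof (cases "l = i")
    case True
    then have eq: "(\<lambda>w. (case w of (x, \<eta>) \<Rightarrow> \<eta>(i := max 0 x)) l) = (\<lambda>w. max 0 (fst w))"
      by (auto simp: fun_eq_iff)
    show ?thesis unfolding eq by measurable
  next
    case False
    then have eq: "(\<lambda>w. (case w of (x, \<eta>) \<Rightarrow> \<eta>(i := max 0 x)) l) = (\<lambda>w. snd w l)"
      by (auto simp: fun_eq_iff)
    show ?thesis
      unfolding eq by (rule measurable_compose[OF measurable_snd \<nu>_off_component]) (use False in simp)
  qed
qed (auto simp: space_pair_measure space_\<nu>_off)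

context
  fixes s :: real and \<theta> :: "'v::finite \<Rightarrow> real"
  assumes s: "s > 0" and \<theta>: "\<And>i. \<theta> i \<ge> 0"
begin

lemma product_\<nu>: "product_sigma_finite (\<lambda>i. \<nu> s (\<theta> i))"
  by (intro product_sigma_finite.intro prob_space_imp_sigma_finite prob_space_\<nu> s \<theta>)

lemma config_measurable_PiM:
  "h \<in> borel_measurable config \<Longrightarrow> A = UNIV \<Longrightarrow> h \<in> borel_measurable (Pi\<^sub>M A (\<lambda>i. \<nu> s (\<theta> i)))"
  using measurable_cong_sets[OF sets_\<nu>_prod[of s \<theta>] refl, of borel] by (auto simp: \<nu>_prod_def)

text \<open>This order integrates the remaining sites first. It serves the intertwining, where a
  single test function is to be turned into a function of two energies.\<close>

lemma nn_integral_\<nu>_prod_pair_inner: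
  assumes ij: "i \<noteq> j" and h: "h \<in> borel_measurable config"
  shows "(\<integral>\<^sup>+\<zeta>. h \<zeta> \<partial>\<nu>_prod s \<theta>) =
    (\<integral>\<^sup>+x. \<integral>\<^sup>+y. \<integral>\<^sup>+\<eta>. h (\<eta>(i := x, j := y)) \<partial>\<nu>_off s \<theta> {i, j} \<partial>\<nu> s (\<theta> j) \<partial>\<nu> s (\<theta> i))"
proof -
  interpret product_sigma_finite "\<lambda>i. \<nu> s (\<theta> i)" by (rule product_\<nu>)
  let ?R = "UNIV - {i, j}"
  have U: "insert i (insert j ?R) = UNIV" by auto
  note hm = config_measurable_PiM[OF h U]
  have "(\<integral>\<^sup>+\<zeta>. h \<zeta> \<partial>\<nu>_prod s \<theta>) = (\<integral>\<^sup>+\<zeta>. h \<zeta> \<partial>Pi\<^sub>M (insert i (insert j ?R)) (\<lambda>i. \<nu> s (\<theta> i)))"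
    by (simp only: U \<nu>_prod_def)
  also have "\<dots> = (\<integral>\<^sup>+x. \<integral>\<^sup>+\<eta>. h (\<eta>(i := x)) \<partial>Pi\<^sub>M (insert j ?R) (\<lambda>i. \<nu> s (\<theta> i)) \<partial>\<nu> s (\<theta> i))"
    by (rule product_nn_integral_insert_rev[OF _ _ hm]) (use ij in auto)
  also have "\<dots> = (\<integral>\<^sup>+x. \<integral>\<^sup>+y. \<integral>\<^sup>+\<eta>. h (\<eta>(j := y, i := x)) \<partial>\<nu>_off s \<theta> {i, j} \<partial>\<nu> s (\<theta> j) \<partial>\<nu> s (\<theta> i))"
  proof (rule nn_integral_cong)
    fix x assume x: "x \<in> space (\<nu> s (\<theta> i))"
    have "(\<lambda>(\<eta>, x). \<eta>(i := x)) \<in> Pi\<^sub>M (insert j ?R) (\<lambda>i. \<nu> s (\<theta> i)) \<Otimes>\<^sub>M \<nu> s (\<theta> i) \<rightarrow>\<^sub>M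
        Pi\<^sub>M (insert i (insert j ?R)) (\<lambda>i. \<nu> s (\<theta> i))"
      by (rule measurable_add_dim)
    from measurable_Pair1[OF this x]
    have "(\<lambda>\<eta>. \<eta>(i := x)) \<in> Pi\<^sub>M (insert j ?R) (\<lambda>i. \<nu> s (\<theta> i)) \<rightarrow>\<^sub>M Pi\<^sub>M (insert i (insert j ?R)) (\<lambda>i. \<nu> s (\<theta> i))"
      by simp
    from measurable_compose[OF this hm]
    show "(\<integral>\<^sup>+\<eta>. h (\<eta>(i := x)) \<partial>Pi\<^sub>M (insert j ?R) (\<lambda>i. \<nu> s (\<theta> i))) = (\<integral>\<^sup>+y. \<integral>\<^sup>+\<eta>. h (\<eta>(j := y, i := x)) \<partial>\<nu>_off s \<theta> {i, j} \<partial>\<nu> s (\<theta> j))"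
      by (intro product_nn_integral_insert_rev) auto
  qed
  finally show ?thesis unfolding fun_upd_twist[OF ij] .
qed

text \<open>This order freezes the remaining sites. It serves reversibility, where two test
  functions depend on the same frozen values and integrating these out first would not
  factor.\<close>

lemma nn_integral_\<nu>_prod_pair_outer:
  assumes ij: "i \<noteq> j" and h: "h \<in> borel_measurable config"
  shows "(\<integral>\<^sup>+\<zeta>. h \<zeta> \<partial>\<nu>_prod s \<theta>) =
    (\<integral>\<^sup>+\<eta>. \<integral>\<^sup>+x. \<integral>\<^sup>+y. h (\<eta>(i := x, j := y)) \<partial>\<nu> s (\<theta> j) \<partial>\<nu> s (\<theta> i) \<partial>\<nu>_off s \<theta> {i, j})"
proof -
  interpret product_sigma_finite "\<lambda>i. \<nu> s (\<theta> i)" by (rule product_\<nu>)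
  let ?R = "UNIV - {i, j}"
  have U: "insert j (insert i ?R) = UNIV" by auto
  note hm [measurable] = config_measurable_PiM[OF h U]
  have "(\<integral>\<^sup>+\<zeta>. h \<zeta> \<partial>\<nu>_prod s \<theta>) = (\<integral>\<^sup>+\<zeta>. h \<zeta> \<partial>Pi\<^sub>M (insert j (insert i ?R)) (\<lambda>i. \<nu> s (\<theta> i)))"
    by (simp only: U \<nu>_prod_def)
  also have "\<dots> = (\<integral>\<^sup>+\<eta>. \<integral>\<^sup>+y. h (\<eta>(j := y)) \<partial>\<nu> s (\<theta> j) \<partial>Pi\<^sub>M (insert i ?R) (\<lambda>i. \<nu> s (\<theta> i)))"
    by (rule product_nn_integral_insert[OF _ _ hm]) (use ij in auto)
  also have "\<dots> = (\<integral>\<^sup>+\<eta>. \<integral>\<^sup>+x. \<integral>\<^sup>+y. h (\<eta>(i := x, j := y)) \<partial>\<nu> s (\<theta> j) \<partial>\<nu> s (\<theta> i) \<partial>\<nu>_off s \<theta> {i, j})"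
  proof (rule product_nn_integral_insert)
    show "(\<lambda>\<eta>. \<integral>\<^sup>+y. h (\<eta>(j := y)) \<partial>\<nu> s (\<theta> j)) \<in> borel_measurable (Pi\<^sub>M (insert i ?R) (\<lambda>i. \<nu> s (\<theta> i)))"
      by measurable
  qed auto
  finally show ?thesis .
qed

lemma nn_integral_\<nu>_prod_site_inner:
  assumes h: "h \<in> borel_measurable config"
  shows "(\<integral>\<^sup>+\<zeta>. h \<zeta> \<partial>\<nu>_prod s \<theta>) = (\<integral>\<^sup>+x. \<integral>\<^sup>+\<eta>. h (\<eta>(i := x)) \<partial>\<nu>_off s \<theta> {i} \<partial>\<nu> s (\<theta> i))"
proof -
  interpret product_sigma_finite "\<lambda>i. \<nu> s (\<theta> i)" by (rule product_\<nu>)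
  have U: "insert i (UNIV - {i}) = UNIV" by auto
  show ?thesis
    using product_nn_integral_insert_rev[OF _ _ config_measurable_PiM[OF h U]]
    by (simp add: \<nu>_prod_def insert_absorb)
qed

lemma nn_integral_\<nu>_prod_site_outer:
  assumes h: "h \<in> borel_measurable config"
  shows "(\<integral>\<^sup>+\<zeta>. h \<zeta> \<partial>\<nu>_prod s \<theta>) = (\<integral>\<^sup>+\<eta>. \<integral>\<^sup>+x. h (\<eta>(i := x)) \<partial>\<nu> s (\<theta> i) \<partial>\<nu>_off s \<theta> {i})"
proof -
  interpret product_sigma_finite "\<lambda>i. \<nu> s (\<theta> i)" by (rule product_\<nu>)
  have U: "insert i (UNIV - {i}) = UNIV" by auto
  show ?thesis
    using product_nn_integral_insert[OF _ _ config_measurable_PiM[OF h U]]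
    by (simp add: \<nu>_prod_def insert_absorb)
qed

end

section \<open>Intertwining and reversibility of a single move\<close>

lemma nn_kmp_kernel_measurable:
  assumes "s > 0" "\<And>i. \<theta>' i > 0" "f \<in> borel_measurable config"
  shows "(\<lambda>\<zeta>. \<integral>\<^sup>+x. f x \<partial>kmp_kernel s \<theta>' k \<zeta>) \<in> borel_measurable config"
  by (rule measurable_compose[OF measurable_prob_algebraD[OF measurable_kmp_kernel]
        nn_integral_measurable_subprob_algebra]) (use assms in auto)

text \<open>A convex combination of positive numbers is positive. This keeps the hidden parameters
  in the range where the exchange identity holds.\<close>

lemma hidden_map_pos:
  assumes \<theta>': "\<And>i. \<theta>' i > 0" and \<theta>: "\<And>i. \<theta> i > 0" and u: "u \<in> {0..1}"
  shows "hidden_map \<theta>' k \<theta> u l > 0"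
proof -
  have "a * u + b * (1 - u) > 0" if "a > 0" "b > 0" for a b :: real
  proof (cases "u = 0")
    case False
    then have "a * u > 0" "b * (1 - u) \<ge> 0" using that u by auto
    then show ?thesis by simp
  qed (use that in simp)
  from this[OF \<theta> \<theta>] this[OF \<theta>' \<theta>] show ?thesis
    using \<theta> by (cases k) (auto simp: algebra_simps)
qed

text \<open>Integrating out the other sites turns \<open>f\<close> into a function \<open>F\<close>
  of the two energies involved. Neither move touches the parameters of the other sites, so the same
  \<open>F\<close> describes both sides, and the claim reduces to the exchange identity.\<close>

lemma kmp_hidden_intertwining_bulk:
  fixes \<theta> :: "'v::finite \<Rightarrow> real"
  assumes s: "s > 0" and \<theta>': "\<And>i. \<theta>' i > 0" and \<theta>: "\<And>i. \<theta> i > 0"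
    and f: "f \<in> borel_measurable config" and ij: "i \<noteq> j"
  shows "(\<integral>\<^sup>+\<zeta>. \<integral>\<^sup>+x. f x \<partial>kmp_kernel s \<theta>' (Inl (i, j)) \<zeta> \<partial>\<nu>_prod s \<theta>) =
    (\<integral>\<^sup>+u. \<integral>\<^sup>+\<zeta>. f \<zeta> \<partial>\<nu>_prod s (hidden_map \<theta>' (Inl (i, j)) \<theta> u) \<partial>beta_distr s)"
proof -
  have \<theta>0: "\<theta> l \<ge> 0" for l using \<theta>[of l] by simp
  interpret R: prob_space "\<nu>_off s \<theta> {i, j}" by (rule prob_space_\<nu>_off[OF s \<theta>0])
  interpret B: prob_space "beta_distr s" by (rule prob_space_beta_distr[OF s])
  interpret RB: pair_sigma_finite "\<nu>_off s \<theta> {i, j}" "beta_distr s" ..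
  define g where "g z \<eta> = f (\<eta>(i := max 0 (fst z), j := max 0 (snd z)))" for z :: "real \<times> real" and \<eta>
  define F where "F a b = (\<integral>\<^sup>+\<eta>. g (a, b) \<eta> \<partial>\<nu>_off s \<theta> {i, j})" for a b
  have g: "case_prod g \<in> borel_measurable ((borel \<Otimes>\<^sub>M borel) \<Otimes>\<^sub>M \<nu>_off s \<theta> {i, j})"
    using measurable_compose[OF update_pair_measurable f, of i j s \<theta>] by (simp add: g_def case_prod_beta')
  have F: "case_prod F \<in> borel_measurable (borel \<Otimes>\<^sub>M borel)"
    using R.borel_measurable_nn_integral[OF g] by (simp add: F_def case_prod_beta')
  have "(\<integral>\<^sup>+\<zeta>. \<integral>\<^sup>+x. f x \<partial>kmp_kernel s \<theta>' (Inl (i, j)) \<zeta> \<partial>\<nu>_prod s \<theta>) =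
     (\<integral>\<^sup>+x. \<integral>\<^sup>+y. \<integral>\<^sup>+\<eta>. \<integral>\<^sup>+z. f z \<partial>kmp_kernel s \<theta>' (Inl (i, j)) (\<eta>(i := x, j := y)) \<partial>\<nu>_off s \<theta> {i, j} \<partial>\<nu> s (\<theta> j) \<partial>\<nu> s (\<theta> i))"
    by (rule nn_integral_\<nu>_prod_pair_inner[OF s \<theta>0 ij nn_kmp_kernel_measurable[OF s \<theta>' f]])
  also have "\<dots> = (\<integral>\<^sup>+x. \<integral>\<^sup>+y. \<integral>\<^sup>+u. F (u * (x + y)) ((1 - u) * (x + y)) \<partial>beta_distr s \<partial>\<nu> s (\<theta> j) \<partial>\<nu> s (\<theta> i))"
  proof (intro nn_integral_cong)
    fix x y assume "x \<in> space (\<nu> s (\<theta> i))" "y \<in> space (\<nu> s (\<theta> j))"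
    then have xy: "x \<ge> 0" "y \<ge> 0" by auto
    have "(\<integral>\<^sup>+\<eta>. \<integral>\<^sup>+z. f z \<partial>kmp_kernel s \<theta>' (Inl (i, j)) (\<eta>(i := x, j := y)) \<partial>\<nu>_off s \<theta> {i, j}) =
      (\<integral>\<^sup>+\<eta>. \<integral>\<^sup>+u. g (u * (x + y), (1 - u) * (x + y)) \<eta> \<partial>beta_distr s \<partial>\<nu>_off s \<theta> {i, j})"
    proof (rule nn_integral_cong)
      fix \<eta> assume \<eta>: "\<eta> \<in> space (\<nu>_off s \<theta> {i, j})"
      have "\<eta>(i := x, j := y) \<in> space config"
        using xy space_\<nu>_off[OF \<eta>] by auto
      then have "(\<integral>\<^sup>+z. f z \<partial>kmp_kernel s \<theta>' (Inl (i, j)) (\<eta>(i := x, j := y))) =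
         (\<integral>\<^sup>+u. f (\<eta>(i := u * (x + y), j := (1 - u) * (x + y))) \<partial>beta_distr s)"
        using ij by (subst nn_integral_kmp_kernel_bulk[OF s \<theta>' _ f]) (auto simp: fun_upd_twist)
      also have "\<dots> = (\<integral>\<^sup>+u. g (u * (x + y), (1 - u) * (x + y)) \<eta> \<partial>beta_distr s)"
        using xy by (intro nn_integral_cong) (auto simp: g_def max_def not_le mult_less_0_iff)
      finally show "(\<integral>\<^sup>+z. f z \<partial>kmp_kernel s \<theta>' (Inl (i, j)) (\<eta>(i := x, j := y))) =
         (\<integral>\<^sup>+u. g (u * (x + y), (1 - u) * (x + y)) \<eta> \<partial>beta_distr s)" .
    qed
    also have "\<dots> = (\<integral>\<^sup>+u. \<integral>\<^sup>+\<eta>. g (u * (x + y), (1 - u) * (x + y)) \<eta> \<partial>\<nu>_off s \<theta> {i, j} \<partial>beta_distr s)"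
    proof (rule RB.Fubini'[symmetric])
      have [measurable]: "snd \<in> borel_measurable (\<nu>_off s \<theta> {i, j} \<Otimes>\<^sub>M beta_distr s)"
        by (rule measurable_compose[OF measurable_snd measurable_beta_borel])
      have "(\<lambda>w. ((snd w * (x + y), (1 - snd w) * (x + y)), fst w)) \<in>
          \<nu>_off s \<theta> {i, j} \<Otimes>\<^sub>M beta_distr s \<rightarrow>\<^sub>M (borel \<Otimes>\<^sub>M borel) \<Otimes>\<^sub>M \<nu>_off s \<theta> {i, j}"
        by measurable
      from measurable_compose[OF this g]
      show "(\<lambda>(\<eta>, u). g (u * (x + y), (1 - u) * (x + y)) \<eta>) \<in> borel_measurable (\<nu>_off s \<theta> {i, j} \<Otimes>\<^sub>M beta_distr s)"
        by (simp add: case_prod_beta')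
    qed
    finally show "(\<integral>\<^sup>+\<eta>. \<integral>\<^sup>+z. f z \<partial>kmp_kernel s \<theta>' (Inl (i, j)) (\<eta>(i := x, j := y)) \<partial>\<nu>_off s \<theta> {i, j}) =
      (\<integral>\<^sup>+u. F (u * (x + y)) ((1 - u) * (x + y)) \<partial>beta_distr s)"
      by (simp only: F_def)
  qed
  also have "\<dots> = (\<integral>\<^sup>+u. \<integral>\<^sup>+x. \<integral>\<^sup>+y. F x y \<partial>\<nu> s (\<theta> i * u + \<theta> j * (1 - u)) \<partial>\<nu> s (\<theta> i * u + \<theta> j * (1 - u)) \<partial>beta_distr s)"
    by (rule nn_integral_gamma_beta_exchange[OF F s \<theta> \<theta>])
  also have "\<dots> = (\<integral>\<^sup>+u. \<integral>\<^sup>+\<zeta>. f \<zeta> \<partial>\<nu>_prod s (hidden_map \<theta>' (Inl (i, j)) \<theta> u) \<partial>beta_distr s)"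
  proof (rule nn_integral_cong)
    fix u assume "u \<in> space (beta_distr s)"
    then have u: "u \<in> {0..1}" by simp
    let ?m = "hidden_map \<theta>' (Inl (i, j)) \<theta> u" and ?t = "\<theta> i * u + \<theta> j * (1 - u)"
    have m0: "?m l \<ge> 0" for l
      by (rule less_imp_le, rule hidden_map_pos) (use \<theta>' \<theta> u in auto)
    \<comment> \<open>The hidden move changes parameters at \<open>i\<close> and \<open>j\<close>
      only, hence the same \<open>F\<close> can be used after it.\<close>
    have off: "\<nu>_off s ?m {i, j} = \<nu>_off s \<theta> {i, j}"
      by (rule PiM_cong) auto
    have mi: "?m i = ?t" "?m j = ?t" by auto
    have "(\<integral>\<^sup>+\<zeta>. f \<zeta> \<partial>\<nu>_prod s ?m) = (\<integral>\<^sup>+x. \<integral>\<^sup>+y. \<integral>\<^sup>+\<eta>. f (\<eta>(i := x, j := y)) \<partial>\<nu>_off s \<theta> {i, j} \<partial>\<nu> s ?t \<partial>\<nu> s ?t)"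
      unfolding nn_integral_\<nu>_prod_pair_inner[OF s m0 ij f] off mi ..
    also have "\<dots> = (\<integral>\<^sup>+x. \<integral>\<^sup>+y. F x y \<partial>\<nu> s ?t \<partial>\<nu> s ?t)"
      by (intro nn_integral_cong) (simp add: F_def g_def)
    finally show "(\<integral>\<^sup>+x. \<integral>\<^sup>+y. F x y \<partial>\<nu> s ?t \<partial>\<nu> s ?t) = (\<integral>\<^sup>+\<zeta>. f \<zeta> \<partial>\<nu>_prod s ?m)" ..
  qed
  finally show ?thesis .
qed

text \<open>The injected energy plays the role of a second site with parameter
  \<open>\<theta>' i\<close>: the exchange identity is applied to a function that ignores the share
  of this site.\<close>

lemma kmp_hidden_intertwining_site:
  fixes \<theta> :: "'v::finite \<Rightarrow> real"
  assumes s: "s > 0" and \<theta>': "\<And>i. \<theta>' i > 0" and \<theta>: "\<And>i. \<theta> i > 0"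
    and f: "f \<in> borel_measurable config"
  shows "(\<integral>\<^sup>+\<zeta>. \<integral>\<^sup>+x. f x \<partial>kmp_kernel s \<theta>' (Inr i) \<zeta> \<partial>\<nu>_prod s \<theta>) =
    (\<integral>\<^sup>+u. \<integral>\<^sup>+\<zeta>. f \<zeta> \<partial>\<nu>_prod s (hidden_map \<theta>' (Inr i) \<theta> u) \<partial>beta_distr s)"
proof -
  have \<theta>0: "\<theta> l \<ge> 0" for l using \<theta>[of l] by simp
  interpret R: prob_space "\<nu>_off s \<theta> {i}" by (rule prob_space_\<nu>_off[OF s \<theta>0])
  interpret B: prob_space "beta_distr s" by (rule prob_space_beta_distr[OF s])
  interpret Y: prob_space "\<nu> s (\<theta>' i)" by (rule prob_space_\<nu>) (use s \<theta>'[of i] in auto)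
  interpret RB: pair_sigma_finite "\<nu>_off s \<theta> {i}" "beta_distr s" ..
  interpret RY: pair_sigma_finite "\<nu>_off s \<theta> {i}" "\<nu> s (\<theta>' i)" ..
  define g where "g x \<eta> = f (\<eta>(i := max 0 x))" for x :: real and \<eta>
  \<comment> \<open>The second argument, the energy left at the auxiliary site, is
    discarded.\<close>
  define F where "F a b = (\<integral>\<^sup>+\<eta>. g a \<eta> \<partial>\<nu>_off s \<theta> {i})" for a b :: real
  have g: "case_prod g \<in> borel_measurable (borel \<Otimes>\<^sub>M \<nu>_off s \<theta> {i})"
    using measurable_compose[OF update_site_measurable f, of i s \<theta>] by (simp add: g_def case_prod_beta')
  have F0: "(\<lambda>a. \<integral>\<^sup>+\<eta>. g a \<eta> \<partial>\<nu>_off s \<theta> {i}) \<in> borel_measurable borel"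
    using R.borel_measurable_nn_integral[OF g] .
  have F: "case_prod F \<in> borel_measurable (borel \<Otimes>\<^sub>M borel)"
    using measurable_compose[OF measurable_fst F0] by (simp add: F_def case_prod_beta')
  have "(\<integral>\<^sup>+\<zeta>. \<integral>\<^sup>+x. f x \<partial>kmp_kernel s \<theta>' (Inr i) \<zeta> \<partial>\<nu>_prod s \<theta>) =
     (\<integral>\<^sup>+x. \<integral>\<^sup>+\<eta>. \<integral>\<^sup>+z. f z \<partial>kmp_kernel s \<theta>' (Inr i) (\<eta>(i := x)) \<partial>\<nu>_off s \<theta> {i} \<partial>\<nu> s (\<theta> i))"
    by (rule nn_integral_\<nu>_prod_site_inner[OF s \<theta>0 nn_kmp_kernel_measurable[OF s \<theta>' f]])
  also have "\<dots> = (\<integral>\<^sup>+x. \<integral>\<^sup>+y. \<integral>\<^sup>+u. F (u * (x + y)) ((1 - u) * (x + y)) \<partial>beta_distr s \<partial>\<nu> s (\<theta>' i) \<partial>\<nu> s (\<theta> i))"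
  proof (rule nn_integral_cong)
    fix x assume "x \<in> space (\<nu> s (\<theta> i))"
    then have x: "x \<ge> 0" by auto
    have [measurable]: "(\<lambda>w. snd w) \<in> borel_measurable ((\<nu>_off s \<theta> {i} \<Otimes>\<^sub>M \<nu> s (\<theta>' i)) \<Otimes>\<^sub>M beta_distr s)"
      by (rule measurable_compose[OF measurable_snd measurable_beta_borel])
    have [measurable]: "(\<lambda>w. snd (fst w)) \<in> borel_measurable ((\<nu>_off s \<theta> {i} \<Otimes>\<^sub>M \<nu> s (\<theta>' i)) \<Otimes>\<^sub>M beta_distr s)"
      by (rule measurable_halflineD) measurable
    have "(\<lambda>w. (snd w * (x + snd (fst w)), fst (fst w))) \<in>
          (\<nu>_off s \<theta> {i} \<Otimes>\<^sub>M \<nu> s (\<theta>' i)) \<Otimes>\<^sub>M beta_distr s \<rightarrow>\<^sub>M borel \<Otimes>\<^sub>M \<nu>_off s \<theta> {i}"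
      by measurable
    from measurable_compose[OF this g]
    have joint: "(\<lambda>(w, u). g (u * (x + snd w)) (fst w)) \<in> borel_measurable ((\<nu>_off s \<theta> {i} \<Otimes>\<^sub>M \<nu> s (\<theta>' i)) \<Otimes>\<^sub>M beta_distr s)"
      by (simp add: case_prod_beta')
    have "(\<integral>\<^sup>+\<eta>. \<integral>\<^sup>+z. f z \<partial>kmp_kernel s \<theta>' (Inr i) (\<eta>(i := x)) \<partial>\<nu>_off s \<theta> {i}) =
      (\<integral>\<^sup>+\<eta>. \<integral>\<^sup>+y. \<integral>\<^sup>+u. g (u * (x + y)) \<eta> \<partial>beta_distr s \<partial>\<nu> s (\<theta>' i) \<partial>\<nu>_off s \<theta> {i})"
    proof (rule nn_integral_cong)
      fix \<eta> assume \<eta>: "\<eta> \<in> space (\<nu>_off s \<theta> {i})"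
      have "\<eta>(i := x) \<in> space config"
        using x space_\<nu>_off[OF \<eta>] by auto
      then have "(\<integral>\<^sup>+z. f z \<partial>kmp_kernel s \<theta>' (Inr i) (\<eta>(i := x))) =
         (\<integral>\<^sup>+y. \<integral>\<^sup>+u. f (\<eta>(i := (x + y) * u)) \<partial>beta_distr s \<partial>\<nu> s (\<theta>' i))"
        by (subst nn_integral_kmp_kernel_site[OF s \<theta>' _ f]) auto
      also have "\<dots> = (\<integral>\<^sup>+y. \<integral>\<^sup>+u. g (u * (x + y)) \<eta> \<partial>beta_distr s \<partial>\<nu> s (\<theta>' i))"
        using x by (intro nn_integral_cong) (auto simp: g_def max_def not_le mult_less_0_iff mult.commute)
      finally show "(\<integral>\<^sup>+z. f z \<partial>kmp_kernel s \<theta>' (Inr i) (\<eta>(i := x))) =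
         (\<integral>\<^sup>+y. \<integral>\<^sup>+u. g (u * (x + y)) \<eta> \<partial>beta_distr s \<partial>\<nu> s (\<theta>' i))" .
    qed
    also have "\<dots> = (\<integral>\<^sup>+y. \<integral>\<^sup>+\<eta>. \<integral>\<^sup>+u. g (u * (x + y)) \<eta> \<partial>beta_distr s \<partial>\<nu>_off s \<theta> {i} \<partial>\<nu> s (\<theta>' i))"
      by (rule RY.Fubini'[symmetric])
        (use B.borel_measurable_nn_integral[OF joint] in \<open>simp add: case_prod_beta'\<close>)
    also have "\<dots> = (\<integral>\<^sup>+y. \<integral>\<^sup>+u. \<integral>\<^sup>+\<eta>. g (u * (x + y)) \<eta> \<partial>\<nu>_off s \<theta> {i} \<partial>beta_distr s \<partial>\<nu> s (\<theta>' i))"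
    proof (rule nn_integral_cong)
      fix y assume y: "y \<in> space (\<nu> s (\<theta>' i))"
      have "(\<lambda>w. ((fst w, y), snd w)) \<in> \<nu>_off s \<theta> {i} \<Otimes>\<^sub>M beta_distr s \<rightarrow>\<^sub>M (\<nu>_off s \<theta> {i} \<Otimes>\<^sub>M \<nu> s (\<theta>' i)) \<Otimes>\<^sub>M beta_distr s"
        using y by measurable
      from measurable_compose[OF this joint]
      show "(\<integral>\<^sup>+\<eta>. \<integral>\<^sup>+u. g (u * (x + y)) \<eta> \<partial>beta_distr s \<partial>\<nu>_off s \<theta> {i}) = (\<integral>\<^sup>+u. \<integral>\<^sup>+\<eta>. g (u * (x + y)) \<eta> \<partial>\<nu>_off s \<theta> {i} \<partial>beta_distr s)"
        by (intro RB.Fubini'[symmetric]) (simp add: case_prod_beta')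
    qed
    finally show "(\<integral>\<^sup>+\<eta>. \<integral>\<^sup>+z. f z \<partial>kmp_kernel s \<theta>' (Inr i) (\<eta>(i := x)) \<partial>\<nu>_off s \<theta> {i}) =
      (\<integral>\<^sup>+y. \<integral>\<^sup>+u. F (u * (x + y)) ((1 - u) * (x + y)) \<partial>beta_distr s \<partial>\<nu> s (\<theta>' i))"
      by (simp only: F_def)
  qed
  also have "\<dots> = (\<integral>\<^sup>+u. \<integral>\<^sup>+x. \<integral>\<^sup>+y. F x y \<partial>\<nu> s (\<theta> i * u + \<theta>' i * (1 - u)) \<partial>\<nu> s (\<theta> i * u + \<theta>' i * (1 - u)) \<partial>beta_distr s)"
    by (rule nn_integral_gamma_beta_exchange[OF F s \<theta> \<theta>'])
  also have "\<dots> = (\<integral>\<^sup>+u. \<integral>\<^sup>+x. (\<integral>\<^sup>+\<eta>. g x \<eta> \<partial>\<nu>_off s \<theta> {i}) \<partial>\<nu> s (\<theta> i * u + \<theta>' i * (1 - u)) \<partial>beta_distr s)"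
  proof (intro nn_integral_cong)
    fix u x assume "u \<in> space (beta_distr s)"
    then have "\<theta> i * u + \<theta>' i * (1 - u) \<ge> 0"
      using \<theta>0[of i] \<theta>'[of i] by auto
    then show "(\<integral>\<^sup>+y. F x y \<partial>\<nu> s (\<theta> i * u + \<theta>' i * (1 - u))) = (\<integral>\<^sup>+\<eta>. g x \<eta> \<partial>\<nu>_off s \<theta> {i})"
      unfolding F_def using prob_space.emeasure_space_1[OF prob_space_\<nu>[OF s]] by simp
  qed
  \<comment> \<open>Scaling moves the dependence on \<open>u\<close> from the measure into the
    integrand, so that it can be treated as a Borel function of all real \<open>u\<close>. The
    truncation changes nothing for \<open>u\<close> in the unit interval.\<close>
  also have "\<dots> = (\<integral>\<^sup>+u. \<integral>\<^sup>+x. (\<integral>\<^sup>+\<eta>. g (max 0 (\<theta> i * u + \<theta>' i * (1 - u)) * x) \<eta> \<partial>\<nu>_off s \<theta> {i}) \<partial>\<nu> s 1 \<partial>beta_distr s)"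
  proof (intro nn_integral_cong)
    fix u assume "u \<in> space (beta_distr s)"
    then have u: "u \<in> {0..1}" by simp
    have "hidden_map \<theta>' (Inr i) \<theta> (1 - u) i > 0"
      by (rule hidden_map_pos[OF \<theta>' \<theta>]) (use u in auto)
    then have pos: "\<theta> i * u + \<theta>' i * (1 - u) > 0" by (simp add: algebra_simps)
    show "(\<integral>\<^sup>+x. (\<integral>\<^sup>+\<eta>. g x \<eta> \<partial>\<nu>_off s \<theta> {i}) \<partial>\<nu> s (\<theta> i * u + \<theta>' i * (1 - u))) =
      (\<integral>\<^sup>+x. (\<integral>\<^sup>+\<eta>. g (max 0 (\<theta> i * u + \<theta>' i * (1 - u)) * x) \<eta> \<partial>\<nu>_off s \<theta> {i}) \<partial>\<nu> s 1)"
      using nn_integral_\<nu>_scale[OF pos F0] pos by (simp add: max_def)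
  qed
  \<comment> \<open>In the exchange identity \<open>u\<close> weights the old parameter, in
    \<open>hidden_map\<close> it weights the reservoir; the symmetry of the Beta law reconciles the
    two.\<close>
  also have "\<dots> = (\<integral>\<^sup>+u. \<integral>\<^sup>+x. (\<integral>\<^sup>+\<eta>. g (max 0 (\<theta> i * (1 - u) + \<theta>' i * (1 - (1 - u))) * x) \<eta> \<partial>\<nu>_off s \<theta> {i}) \<partial>\<nu> s 1 \<partial>beta_distr s)"
  proof (rule nn_integral_beta_distr_flip[symmetric])
    interpret V: prob_space "\<nu> s 1" by (rule prob_space_\<nu>[OF s]) simp
    have "(\<lambda>w. snd w) \<in> borel_measurable (borel \<Otimes>\<^sub>M \<nu> s 1)"
      by (rule measurable_halflineD) measurable
    then have "(\<lambda>w. max 0 (\<theta> i * fst w + \<theta>' i * (1 - fst w)) * snd w) \<in> borel_measurable (borel \<Otimes>\<^sub>M \<nu> s 1)"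
      by measurable
    from measurable_compose[OF this F0]
    show "(\<lambda>u. \<integral>\<^sup>+x. (\<integral>\<^sup>+\<eta>. g (max 0 (\<theta> i * u + \<theta>' i * (1 - u)) * x) \<eta> \<partial>\<nu>_off s \<theta> {i}) \<partial>\<nu> s 1) \<in> borel_measurable borel"
      by (intro V.borel_measurable_nn_integral) (simp add: case_prod_beta')
  qed
  also have "\<dots> = (\<integral>\<^sup>+u. \<integral>\<^sup>+\<zeta>. f \<zeta> \<partial>\<nu>_prod s (hidden_map \<theta>' (Inr i) \<theta> u) \<partial>beta_distr s)"
  proof (rule nn_integral_cong)
    fix u assume "u \<in> space (beta_distr s)"
    then have u: "u \<in> {0..1}" by simp
    let ?m = "hidden_map \<theta>' (Inr i) \<theta> u"
    have m0: "?m l \<ge> 0" and mi0: "?m i > 0" for l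
      using hidden_map_pos[OF \<theta>' \<theta> u, where k="Inr i"] by (auto intro: less_imp_le simp del: hidden_map.simps)
    have off: "\<nu>_off s ?m {i} = \<nu>_off s \<theta> {i}"
      by (rule PiM_cong) auto
    have mi: "max 0 (\<theta> i * (1 - u) + \<theta>' i * (1 - (1 - u))) = ?m i"
      using mi0 by (simp add: max_def mult.commute)
    have "(\<integral>\<^sup>+\<zeta>. f \<zeta> \<partial>\<nu>_prod s ?m) = (\<integral>\<^sup>+x. \<integral>\<^sup>+\<eta>. f (\<eta>(i := x)) \<partial>\<nu>_off s \<theta> {i} \<partial>\<nu> s (?m i))"
      unfolding nn_integral_\<nu>_prod_site_inner[OF s m0 f, where i=i] off ..
    also have "\<dots> = (\<integral>\<^sup>+x. \<integral>\<^sup>+\<eta>. g x \<eta> \<partial>\<nu>_off s \<theta> {i} \<partial>\<nu> s (?m i))"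
      by (intro nn_integral_cong) (simp add: g_def)
    also have "\<dots> = (\<integral>\<^sup>+x. \<integral>\<^sup>+\<eta>. g (?m i * x) \<eta> \<partial>\<nu>_off s \<theta> {i} \<partial>\<nu> s 1)"
      by (rule nn_integral_\<nu>_scale[OF mi0 F0])
    finally show "(\<integral>\<^sup>+x. (\<integral>\<^sup>+\<eta>. g (max 0 (\<theta> i * (1 - u) + \<theta>' i * (1 - (1 - u))) * x) \<eta> \<partial>\<nu>_off s \<theta> {i}) \<partial>\<nu> s 1) =
       (\<integral>\<^sup>+\<zeta>. f \<zeta> \<partial>\<nu>_prod s ?m)" unfolding mi ..
  qed
  finally show ?thesis .
qed

text \<open>For frozen values at the other sites this is the two-variable identity, applied to
  sections of \<open>f\<close> and \<open>g\<close>.\<close>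

lemma kmp_reversible_bulk:
  fixes f g :: "('v::finite \<Rightarrow> real) \<Rightarrow> ennreal"
  assumes s: "s > 0" and \<theta>': "\<And>i. \<theta>' i > 0" and \<theta>: "\<theta> > 0"
    and f: "f \<in> borel_measurable config" and g: "g \<in> borel_measurable config" and ij: "i \<noteq> j"
  shows "(\<integral>\<^sup>+\<zeta>. g \<zeta> * (\<integral>\<^sup>+x. f x \<partial>kmp_kernel s \<theta>' (Inl (i, j)) \<zeta>) \<partial>\<nu>_prod s (\<lambda>_. \<theta>)) =
    (\<integral>\<^sup>+\<zeta>. f \<zeta> * (\<integral>\<^sup>+x. g x \<partial>kmp_kernel s \<theta>' (Inl (i, j)) \<zeta>) \<partial>\<nu>_prod s (\<lambda>_. \<theta>))"
proof -
  define F where "F h \<eta> a b = h (\<eta>(i := max 0 a, j := max 0 b))" for h :: "('v \<Rightarrow> real) \<Rightarrow> ennreal" and \<eta> and a b :: real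
  have F: "case_prod (F h \<eta>) \<in> borel_measurable (borel \<Otimes>\<^sub>M borel)"
    if h: "h \<in> borel_measurable config" and \<eta>: "\<eta> \<in> space (\<nu>_off s (\<lambda>_. \<theta>) {i, j})" for h \<eta>
    using measurable_Pair1[OF measurable_compose[OF update_pair_measurable h] \<eta>]
    by (simp add: F_def case_prod_beta')
  have \<theta>0: "\<theta> \<ge> 0" using \<theta> by simp
  have expand: "(\<integral>\<^sup>+\<zeta>. g \<zeta> * (\<integral>\<^sup>+x. f x \<partial>kmp_kernel s \<theta>' (Inl (i, j)) \<zeta>) \<partial>\<nu>_prod s (\<lambda>_. \<theta>)) =
     (\<integral>\<^sup>+\<eta>. \<integral>\<^sup>+x. \<integral>\<^sup>+y. F g \<eta> x y * (\<integral>\<^sup>+u. F f \<eta> (u * (x + y)) ((1 - u) * (x + y)) \<partial>beta_distr s)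
        \<partial>\<nu> s \<theta> \<partial>\<nu> s \<theta> \<partial>\<nu>_off s (\<lambda>_. \<theta>) {i, j})"
    if f: "f \<in> borel_measurable config" and g: "g \<in> borel_measurable config" for f g
  proof -
    have "(\<lambda>\<zeta>. g \<zeta> * (\<integral>\<^sup>+x. f x \<partial>kmp_kernel s \<theta>' (Inl (i, j)) \<zeta>)) \<in> borel_measurable config"
      by (intro borel_measurable_times_ennreal g nn_kmp_kernel_measurable[OF s \<theta>' f])
    from nn_integral_\<nu>_prod_pair_outer[OF s \<theta>0 ij this]
    show ?thesis
    proof (simp only:, intro nn_integral_cong)
      fix \<eta> x y assume \<eta>: "\<eta> \<in> space (\<nu>_off s (\<lambda>_. \<theta>) {i, j})" and "x \<in> space (\<nu> s \<theta>)" "y \<in> space (\<nu> s \<theta>)"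
      then have xy: "x \<ge> 0" "y \<ge> 0" by auto
      have "\<eta>(i := x, j := y) \<in> space config"
        using xy space_\<nu>_off[OF \<eta>] by auto
      then have "(\<integral>\<^sup>+z. f z \<partial>kmp_kernel s \<theta>' (Inl (i, j)) (\<eta>(i := x, j := y))) =
         (\<integral>\<^sup>+u. f (\<eta>(i := u * (x + y), j := (1 - u) * (x + y))) \<partial>beta_distr s)"
        using ij by (subst nn_integral_kmp_kernel_bulk[OF s \<theta>' _ f]) (auto simp: fun_upd_twist)
      also have "\<dots> = (\<integral>\<^sup>+u. F f \<eta> (u * (x + y)) ((1 - u) * (x + y)) \<partial>beta_distr s)"
        using xy by (intro nn_integral_cong) (auto simp: F_def max_def not_le mult_less_0_iff)
      finally show "g (\<eta>(i := x, j := y)) * (\<integral>\<^sup>+z. f z \<partial>kmp_kernel s \<theta>' (Inl (i, j)) (\<eta>(i := x, j := y))) =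
         F g \<eta> x y * (\<integral>\<^sup>+u. F f \<eta> (u * (x + y)) ((1 - u) * (x + y)) \<partial>beta_distr s)"
        using xy by (simp add: F_def)
    qed
  qed
  show ?thesis
    unfolding expand[OF f g] expand[OF g f]
    by (rule nn_integral_cong, rule nn_integral_gamma_beta_reversible[OF F F s \<theta>]) (use f g in auto)
qed

text \<open>When the reservoir parameter equals that of the site, the site and the injected energy
  are independent with the same law. The two-variable identity then applies to functions that ignore
  the second variable.\<close>

lemma kmp_reversible_site:
  fixes f g :: "('v::finite \<Rightarrow> real) \<Rightarrow> ennreal"
  assumes s: "s > 0" and \<theta>': "\<And>i. \<theta>' i = \<theta>" and \<theta>: "\<theta> > 0"
    and f: "f \<in> borel_measurable config" and g: "g \<in> borel_measurable config"
  shows "(\<integral>\<^sup>+\<zeta>. g \<zeta> * (\<integral>\<^sup>+x. f x \<partial>kmp_kernel s \<theta>' (Inr i) \<zeta>) \<partial>\<nu>_prod s (\<lambda>_. \<theta>)) =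
    (\<integral>\<^sup>+\<zeta>. f \<zeta> * (\<integral>\<^sup>+x. g x \<partial>kmp_kernel s \<theta>' (Inr i) \<zeta>) \<partial>\<nu>_prod s (\<lambda>_. \<theta>))"
proof -
  have \<theta>'pos: "\<theta>' i > 0" for i using \<theta> \<theta>' by simp
  define F where "F h \<eta> a b = h (\<eta>(i := max 0 a))" for h :: "('v \<Rightarrow> real) \<Rightarrow> ennreal" and \<eta> and a b :: real
  have F: "case_prod (F h \<eta>) \<in> borel_measurable (borel \<Otimes>\<^sub>M borel)"
    if h: "h \<in> borel_measurable config" and \<eta>: "\<eta> \<in> space (\<nu>_off s (\<lambda>_. \<theta>) {i})" for h \<eta>
    using measurable_compose[OF measurable_fst measurable_Pair1[OF measurable_compose[OF update_site_measurable h] \<eta>]]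
    by (simp add: F_def case_prod_beta')
  have \<theta>0: "\<theta> \<ge> 0" using \<theta> by simp
  interpret B: prob_space "beta_distr s" by (rule prob_space_beta_distr[OF s])
  have expand: "(\<integral>\<^sup>+\<zeta>. g \<zeta> * (\<integral>\<^sup>+x. f x \<partial>kmp_kernel s \<theta>' (Inr i) \<zeta>) \<partial>\<nu>_prod s (\<lambda>_. \<theta>)) =
     (\<integral>\<^sup>+\<eta>. \<integral>\<^sup>+x. \<integral>\<^sup>+y. F g \<eta> x y * (\<integral>\<^sup>+u. F f \<eta> (u * (x + y)) ((1 - u) * (x + y)) \<partial>beta_distr s)
        \<partial>\<nu> s \<theta> \<partial>\<nu> s \<theta> \<partial>\<nu>_off s (\<lambda>_. \<theta>) {i})"
    if f: "f \<in> borel_measurable config" and g: "g \<in> borel_measurable config" for f g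
  proof -
    have "(\<lambda>\<zeta>. g \<zeta> * (\<integral>\<^sup>+x. f x \<partial>kmp_kernel s \<theta>' (Inr i) \<zeta>)) \<in> borel_measurable config"
      by (intro borel_measurable_times_ennreal g nn_kmp_kernel_measurable[OF s \<theta>'pos f])
    from nn_integral_\<nu>_prod_site_outer[OF s \<theta>0 this, of i]
    show ?thesis
    proof (simp only:, intro nn_integral_cong)
      fix \<eta> x assume \<eta>: "\<eta> \<in> space (\<nu>_off s (\<lambda>_. \<theta>) {i})" and "x \<in> space (\<nu> s \<theta>)"
      then have x: "x \<ge> 0" by auto
      have "\<eta>(i := x) \<in> space config"
        using x space_\<nu>_off[OF \<eta>] by auto
      then have "(\<integral>\<^sup>+z. f z \<partial>kmp_kernel s \<theta>' (Inr i) (\<eta>(i := x))) =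
         (\<integral>\<^sup>+y. \<integral>\<^sup>+u. f (\<eta>(i := (x + y) * u)) \<partial>beta_distr s \<partial>\<nu> s \<theta>)"
        by (subst nn_integral_kmp_kernel_site[OF s \<theta>'pos _ f]) (auto simp: \<theta>')
      also have "\<dots> = (\<integral>\<^sup>+y. \<integral>\<^sup>+u. F f \<eta> (u * (x + y)) ((1 - u) * (x + y)) \<partial>beta_distr s \<partial>\<nu> s \<theta>)"
        using x by (intro nn_integral_cong) (auto simp: F_def max_def not_le mult_less_0_iff mult.commute)
      finally have "g (\<eta>(i := x)) * (\<integral>\<^sup>+z. f z \<partial>kmp_kernel s \<theta>' (Inr i) (\<eta>(i := x))) =
         g (\<eta>(i := x)) * (\<integral>\<^sup>+y. \<integral>\<^sup>+u. F f \<eta> (u * (x + y)) ((1 - u) * (x + y)) \<partial>beta_distr s \<partial>\<nu> s \<theta>)"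
        by (simp only:)
      also have "\<dots> = (\<integral>\<^sup>+y. g (\<eta>(i := x)) * (\<integral>\<^sup>+u. F f \<eta> (u * (x + y)) ((1 - u) * (x + y)) \<partial>beta_distr s) \<partial>\<nu> s \<theta>)"
      proof (rule nn_integral_cmult[symmetric])
        have [measurable]: "(\<lambda>y. y) \<in> borel_measurable (\<nu> s \<theta>)"
          by (rule measurable_halflineD, rule measurable_ident_sets) simp
        show "(\<lambda>y. \<integral>\<^sup>+u. F f \<eta> (u * (x + y)) ((1 - u) * (x + y)) \<partial>beta_distr s) \<in> borel_measurable (\<nu> s \<theta>)"
          unfolding polar_average_eq[OF F[OF f \<eta>]]
          by (rule measurable_compose[OF _ measurable_polar_average[OF F[OF f \<eta>]]]) measurable
      qed
      finally show "g (\<eta>(i := x)) * (\<integral>\<^sup>+z. f z \<partial>kmp_kernel s \<theta>' (Inr i) (\<eta>(i := x))) =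
         (\<integral>\<^sup>+y. F g \<eta> x y * (\<integral>\<^sup>+u. F f \<eta> (u * (x + y)) ((1 - u) * (x + y)) \<partial>beta_distr s) \<partial>\<nu> s \<theta>)"
        using x by (simp add: F_def)
    qed
  qed
  show ?thesis
    unfolding expand[OF f g] expand[OF g f]
    by (rule nn_integral_cong, rule nn_integral_gamma_beta_reversible[OF F F s \<theta>]) (use f g in auto)
qed

section \<open>Lipschitz functions determine weak convergence\<close>

text \<open>A distance adapted to the moves: it adds up the discrepancies of the sites, and a single
  move acts on these coordinatewise or in pairs.\<close>

definition l1_dist :: "('v::finite \<Rightarrow> real) \<Rightarrow> ('v \<Rightarrow> real) \<Rightarrow> real" where
  "l1_dist x y = (\<Sum>i\<in>UNIV. \<bar>x i - y i\<bar>)"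

definition config_lipschitz :: "real \<Rightarrow> (('v::finite \<Rightarrow> real) \<Rightarrow> real) \<Rightarrow> bool" where
  "config_lipschitz L f \<longleftrightarrow> (\<forall>x\<in>space config. \<forall>y\<in>space config. \<bar>f x - f y\<bar> \<le> L * l1_dist x y)"

lemma l1_dist_nonneg: "l1_dist x y \<ge> 0"
  by (auto simp: l1_dist_def intro: sum_nonneg)

lemma l1_dist_self [simp]: "l1_dist x x = 0"
  by (simp add: l1_dist_def)

lemma l1_dist_commute: "l1_dist x y = l1_dist y x"
  by (simp add: l1_dist_def abs_minus_commute)

lemma l1_dist_triangle: "l1_dist x z \<le> l1_dist x y + l1_dist y z"
  unfolding l1_dist_def sum.distrib[symmetric] by (rule sum_mono) linarith

lemma continuous_on_config_measurable:
  fixes f :: "('v::finite \<Rightarrow> real) \<Rightarrow> real"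
  assumes "continuous_on (space config) f"
  shows "f \<in> borel_measurable config"
proof -
  have f: "f \<in> borel_measurable (restrict_space borel (space config))"
    by (rule borel_measurable_continuous_on_restrict[OF assms])
  have "(\<lambda>x. x) \<in> config \<rightarrow>\<^sub>M Pi\<^sub>M UNIV (\<lambda>_::'v. borel :: real measure)"
    by (rule measurable_PiM_single'[of UNIV "\<lambda>l z. z l", simplified]) (auto intro: measurable_config_component)
  then have "(\<lambda>x::'v \<Rightarrow> real. x) \<in> config \<rightarrow>\<^sub>M borel"
    using measurable_cong_sets[OF refl sets_PiM_equal_borel] by blast
  then have "(\<lambda>x::'v \<Rightarrow> real. x) \<in> config \<rightarrow>\<^sub>M restrict_space borel (space config)"
    by (rule measurable_restrict_space2[rotated]) auto
  from measurable_compose[OF this f] show ?thesis .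
qed

lemma config_lipschitz_continuous:
  fixes f :: "('v::finite \<Rightarrow> real) \<Rightarrow> real"
  assumes f: "config_lipschitz L f"
  shows "continuous_on (space config) f"
  unfolding continuous_on_def
proof
  fix x :: "'v \<Rightarrow> real" assume x: "x \<in> space config"
  have "((\<lambda>y. L * l1_dist y x) \<longlongrightarrow> L * l1_dist x x) (at x within space config)"
    unfolding l1_dist_def
    by (intro tendsto_intros continuous_on_def[THEN iffD1, rule_format, OF continuous_on_product_coordinates[THEN continuous_on_subset]] x)
       auto
  then have lim: "((\<lambda>y. L * l1_dist y x) \<longlongrightarrow> 0) (at x within space config)"
    by simp
  have "((\<lambda>y. f y - f x) \<longlongrightarrow> 0) (at x within space config)"
  proof (rule Lim_null_comparison[OF _ lim])
    show "\<forall>\<^sub>F y in at x within space config. norm (f y - f x) \<le> L * l1_dist y x"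
      using f x by (auto simp: eventually_at_filter config_lipschitz_def)
  qed
  then show "(f \<longlongrightarrow> f x) (at x within space config)"
    by (rule LIM_zero_cancel)
qed

lemma open_l1_ball:
  fixes x :: "'v::finite \<Rightarrow> real"
  assumes "open U" "x \<in> U"
  obtains \<delta> where "\<delta> > 0" "\<And>y. l1_dist x y < \<delta> \<Longrightarrow> y \<in> U"
proof -
  obtain K :: "('v \<Rightarrow> real) set set" where K: "topological_basis K"
    "\<And>k. k \<in> K \<Longrightarrow> \<exists>X. k = Pi\<^sub>E UNIV X \<and> (\<forall>i. open (X i)) \<and> finite {i. X i \<noteq> UNIV}"
    using product_topology_countable_basis by metis
  obtain k where k: "k \<in> K" "x \<in> k" "k \<subseteq> U"
    using topological_basisE[OF K(1) assms] by blast
  obtain X where X: "k = Pi\<^sub>E UNIV X" "\<And>i. open (X i)"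
    using K(2)[OF k(1)] by blast
  have "\<exists>e>0. \<forall>z. \<bar>x i - z\<bar> < e \<longrightarrow> z \<in> X i" for i
  proof -
    have "x i \<in> X i" using k(2) X(1) by auto
    then obtain e where "e > 0" "ball (x i) e \<subseteq> X i"
      using X(2) open_contains_ball by metis
    then show ?thesis by (intro exI[of _ e]) (auto simp: ball_def dist_real_def)
  qed
  then obtain e where e: "\<And>i. e i > 0" "\<And>i z. \<bar>x i - z\<bar> < e i \<Longrightarrow> z \<in> X i"
    by metis
  define \<delta> where "\<delta> = Min (range e)"
  have "\<delta> > 0" unfolding \<delta>_def using e(1) by (subst Min_gr_iff) auto
  moreover have "y \<in> U" if y: "l1_dist x y < \<delta>" for y
  proof -
    have "y i \<in> X i" for i
    proof (rule e(2))
      have "\<bar>x i - y i\<bar> \<le> l1_dist x y"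
        unfolding l1_dist_def by (rule member_le_sum) auto
      also have "\<dots> < \<delta>" by fact
      also have "\<dots> \<le> e i" unfolding \<delta>_def by (rule Min_le) auto
      finally show "\<bar>x i - y i\<bar> < e i" .
    qed
    then show ?thesis using k(3) X(1) by auto
  qed
  ultimately show ?thesis using that by blast
qed

text \<open>The infimum of \<open>f y + n * l1_dist x y\<close> over \<open>y\<close>, the
  Pasch-Hausdorff envelope, is the largest \<open>n\<close>-Lipschitz minorant of \<open>f\<close>.
  For large \<open>n\<close> distant points are too expensive to lower the infimum, and near points
  have values almost as large as \<open>f x\<close> by lower semicontinuity.\<close>

lemma lipschitz_lower_approximation:
  fixes f :: "('v::finite \<Rightarrow> real) \<Rightarrow> real"
  assumes B: "\<And>x. x \<in> space config \<Longrightarrow> \<bar>f x\<bar> \<le> B"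
    and lsc: "\<And>x \<epsilon>. x \<in> space config \<Longrightarrow> \<epsilon> > 0 \<Longrightarrow>
       \<exists>\<delta>>0. \<forall>y\<in>space config. l1_dist x y < \<delta> \<longrightarrow> f x - \<epsilon> < f y"
  obtains g where "\<And>n. config_lipschitz (real n) (g n)"
    "\<And>n x. x \<in> space config \<Longrightarrow> \<bar>g n x\<bar> \<le> B" "\<And>n x. x \<in> space config \<Longrightarrow> g n x \<le> f x"
    "\<And>x. x \<in> space config \<Longrightarrow> (\<lambda>n. g n x) \<longlonglongrightarrow> f x"
proof -
  let ?S = "space config :: ('v \<Rightarrow> real) set"
  define g where "g n x = (INF y\<in>?S. f y + real n * l1_dist x y)" for n x
  have ne: "?S \<noteq> {}" by (auto intro!: exI[of _ "\<lambda>_. 0"])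
  have low: "- B \<le> f y + real n * l1_dist x y" if "y \<in> ?S" for n x y
  proof -
    have "- B \<le> f y" using B[OF that] by (simp add: abs_le_iff)
    moreover have "0 \<le> real n * l1_dist x y" by (simp add: l1_dist_nonneg)
    ultimately show ?thesis by linarith
  qed
  have bdd: "bdd_below ((\<lambda>y. f y + real n * l1_dist x y) ` ?S)" for n x
    using low by (intro bdd_belowI2)
  have upper: "g n x \<le> f z + real n * l1_dist x z" if "z \<in> ?S" for n x z
    unfolding g_def by (rule cINF_lower[OF bdd that])
  have le: "g n x \<le> f x" if "x \<in> ?S" for n x
    using upper[OF that, of n x] by simp
  have ge: "- B \<le> g n x" for n x
    unfolding g_def by (rule cINF_greatest[OF ne low])
  have lip1: "g n x \<le> g n y + real n * l1_dist x y" for n x y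
  proof -
    have "g n x - real n * l1_dist x y \<le> g n y"
      unfolding g_def[of n y]
    proof (rule cINF_greatest[OF ne])
      fix z assume "z \<in> ?S"
      then have "g n x \<le> f z + real n * l1_dist x z" by (rule upper)
      also have "real n * l1_dist x z \<le> real n * (l1_dist x y + l1_dist y z)"
        by (rule mult_left_mono[OF l1_dist_triangle]) simp
      finally show "g n x - real n * l1_dist x y \<le> f z + real n * l1_dist y z"
        by (simp add: algebra_simps)
    qed
    then show ?thesis by simp
  qed
  show ?thesis
  proof (rule that[of g])
    show "config_lipschitz (real n) (g n)" for n
      unfolding config_lipschitz_def
    proof (intro ballI)
      fix x y
      show "\<bar>g n x - g n y\<bar> \<le> real n * l1_dist x y"
        using lip1[of n x y] lip1[of n y x] l1_dist_commute[of x y] by (simp add: abs_le_iff)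
    qed
    show "\<bar>g n x\<bar> \<le> B" if "x \<in> ?S" for n x
      using ge[of n x] le[OF that, of n] B[OF that] by (simp add: abs_le_iff)
    show "g n x \<le> f x" if "x \<in> ?S" for n x by (rule le[OF that])
    show "(\<lambda>n. g n x) \<longlonglongrightarrow> f x" if x: "x \<in> ?S" for x
    proof (rule LIMSEQ_I)
      fix r :: real assume "r > 0"
      then have r: "r / 2 > 0" by simp
      obtain \<delta> where \<delta>: "\<delta> > 0" "\<And>y. y \<in> ?S \<Longrightarrow> l1_dist x y < \<delta> \<Longrightarrow> f x - r / 2 < f y"
        using lsc[OF x r] by blast
      \<comment> \<open>Beyond this index a point at distance at least \<delta> costs
        \<open>2 * B\<close>, which lifts its value from at least \<open>- B\<close> to at least
        \<open>B \<ge> f x\<close>.\<close>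
      obtain N where N: "real N > 2 * B / \<delta>" using reals_Archimedean2 by blast
      have "norm (g n x - f x) < r" if n: "n \<ge> N" for n
      proof -
        have "f x - r / 2 \<le> g n x"
          unfolding g_def
        proof (rule cINF_greatest[OF ne])
          fix y assume y: "y \<in> ?S"
          show "f x - r / 2 \<le> f y + real n * l1_dist x y"
          proof (cases "l1_dist x y < \<delta>")
            case True
            have "0 \<le> real n * l1_dist x y" by (simp add: l1_dist_nonneg)
            with \<delta>(2)[OF y True] show ?thesis by linarith
          next
            case False
            have "2 * B \<le> real N * \<delta>" using N \<delta>(1) by (simp add: field_simps)
            also have "\<dots> \<le> real n * l1_dist x y"
              using n False \<delta>(1) by (intro mult_mono) auto
            finally show ?thesis using B[OF y] B[OF x] r by linarith
          qed
        qed
        with le[OF x, of n] r show ?thesis by simp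
      qed
      then show "\<exists>no. \<forall>n\<ge>no. norm (g n x - f x) < r" by blast
    qed
  qed
qed

text \<open>One half of the portmanteau theorem: a Lipschitz minorant that loses less than
  \<epsilon> under \<mu> transfers the lower bound to \<open>\<mu>t t\<close>. Semicontinuous
  \<open>f\<close> are allowed so that the lemma covers indicators of open sets as well as
  continuous functions and their negatives.\<close>

lemma eventually_integral_greater:
  fixes f :: "('v::finite \<Rightarrow> real) \<Rightarrow> real"
  assumes \<mu>: "\<mu> \<in> space (prob_algebra config)"
    and \<mu>t: "\<forall>\<^sub>F t in F. \<mu>t t \<in> space (prob_algebra config)"
    and conv: "\<And>g L B. config_lipschitz L g \<Longrightarrow> (\<And>x. x \<in> space config \<Longrightarrow> \<bar>g x\<bar> \<le> B) \<Longrightarrow>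
       ((\<lambda>t. \<integral>x. g x \<partial>\<mu>t t) \<longlongrightarrow> (\<integral>x. g x \<partial>\<mu>)) F"
    and f: "f \<in> borel_measurable config" and B: "\<And>x. x \<in> space config \<Longrightarrow> \<bar>f x\<bar> \<le> B"
    and lsc: "\<And>x \<epsilon>. x \<in> space config \<Longrightarrow> \<epsilon> > 0 \<Longrightarrow>
       \<exists>\<delta>>0. \<forall>y\<in>space config. l1_dist x y < \<delta> \<longrightarrow> f x - \<epsilon> < f y"
    and \<epsilon>: "\<epsilon> > 0"
  shows "\<forall>\<^sub>F t in F. (\<integral>x. f x \<partial>\<mu>) - \<epsilon> < (\<integral>x. f x \<partial>\<mu>t t)"
proof -
  obtain g where lip: "\<And>n. config_lipschitz (real n) (g n)"
    and gB: "\<And>n x. x \<in> space config \<Longrightarrow> \<bar>g n x\<bar> \<le> B" and le: "\<And>n x. x \<in> space config \<Longrightarrow> g n x \<le> f x"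
    and lim: "\<And>x. x \<in> space config \<Longrightarrow> (\<lambda>n. g n x) \<longlonglongrightarrow> f x"
    using lipschitz_lower_approximation[OF B lsc] by metis
  have gm: "g n \<in> borel_measurable config" for n
    by (rule continuous_on_config_measurable[OF config_lipschitz_continuous[OF lip]])
  have sets: "sets \<mu> = sets config" and prob: "prob_space \<mu>"
    using \<mu> by (auto simp: space_prob_algebra)
  then have sp: "space \<mu> = space config" by (metis sets_eq_imp_space_eq)
  interpret prob_space \<mu> by fact
  have "(\<lambda>n. \<integral>x. g n x \<partial>\<mu>) \<longlonglongrightarrow> (\<integral>x. f x \<partial>\<mu>)"
  proof (rule integral_dominated_convergence[of _ _ _ "\<lambda>_. B"])
    show "f \<in> borel_measurable \<mu>" "g n \<in> borel_measurable \<mu>" for n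
      using f gm measurable_cong_sets[OF sets refl] by blast+
    show "AE x in \<mu>. (\<lambda>n. g n x) \<longlonglongrightarrow> f x"
      using lim sp by (intro AE_I2) auto
    show "AE x in \<mu>. norm (g n x) \<le> B" for n
      using gB sp by (intro AE_I2) auto
  qed simp
  then have "\<forall>\<^sub>F n in sequentially. (\<integral>x. f x \<partial>\<mu>) - \<epsilon> < (\<integral>x. g n x \<partial>\<mu>)"
    by (rule order_tendstoD) (use \<epsilon> in simp)
  then obtain n where n: "(\<integral>x. f x \<partial>\<mu>) - \<epsilon> < (\<integral>x. g n x \<partial>\<mu>)"
    by (auto simp: eventually_sequentially)
  have "\<forall>\<^sub>F t in F. (\<integral>x. f x \<partial>\<mu>) - \<epsilon> < (\<integral>x. g n x \<partial>\<mu>t t)"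
    by (rule order_tendstoD(1)[OF conv[OF lip gB] n])
  then show ?thesis
    using \<mu>t
  proof eventually_elim
    case (elim t)
    have sp: "space (\<mu>t t) = space config"
      using elim(2) by (auto simp: space_prob_algebra dest: sets_eq_imp_space_eq)
    have "(\<integral>x. g n x \<partial>\<mu>t t) \<le> (\<integral>x. f x \<partial>\<mu>t t)"
      using prob_algebra_bounded_integral(1)[OF elim(2) gm gB] prob_algebra_bounded_integral(1)[OF elim(2) f B] le sp
      by (intro integral_mono) auto
    with elim(1) show ?case by linarith
  qed
qed

lemma continuous_on_config_lsc:
  fixes f :: "('v::finite \<Rightarrow> real) \<Rightarrow> real"
  assumes f: "continuous_on (space config) f" and x: "x \<in> space config" and \<epsilon>: "\<epsilon> > 0"
  shows "\<exists>\<delta>>0. \<forall>y\<in>space config. l1_dist x y < \<delta> \<longrightarrow> f x - \<epsilon> < f y"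
proof -
  obtain U where U: "open U" "x \<in> U" "\<forall>y\<in>space config. y \<in> U \<longrightarrow> f y \<in> {f x - \<epsilon><..}"
    using f[unfolded continuous_on_topological, rule_format, OF x, of "{f x - \<epsilon><..}"] \<epsilon> by auto
  obtain \<delta> where "\<delta> > 0" "\<And>y. l1_dist x y < \<delta> \<Longrightarrow> y \<in> U"
    using open_l1_ball[OF U(1,2)] by blast
  then show ?thesis using U(3) by auto
qed

text \<open>The lower bound for \<open>f\<close> and for \<open>- f\<close> together give
  convergence. The condition on \<open>\<mu>t\<close> is only eventual because the kernels
  \<open>P t\<close> are controlled for nonnegative times only.\<close>

lemma weakly_converges_lipschitz:
  assumes \<mu>: "\<mu> \<in> space (prob_algebra config)"
    and \<mu>t: "\<forall>\<^sub>F t in at_top. \<mu>t t \<in> space (prob_algebra config)"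
    and conv: "\<And>g L B. config_lipschitz L g \<Longrightarrow> (\<And>x. x \<in> space config \<Longrightarrow> \<bar>g x\<bar> \<le> B) \<Longrightarrow>
       ((\<lambda>t. \<integral>x. g x \<partial>\<mu>t t) \<longlongrightarrow> (\<integral>x. g x \<partial>\<mu>)) at_top"
  shows "weakly_converges config \<mu>t \<mu>"
  unfolding weakly_converges_def
proof (intro allI impI, elim conjE)
  fix f :: "('a \<Rightarrow> real) \<Rightarrow> real"
  assume cont: "continuous_on (space config) f" and bd: "bounded (f ` space config)"
  from bd obtain B where B: "\<And>x. x \<in> space config \<Longrightarrow> \<bar>f x\<bar> \<le> B"
    by (auto simp: bounded_iff)
  have f: "f \<in> borel_measurable config" by (rule continuous_on_config_measurable[OF cont])
  have cont': "continuous_on (space config) (\<lambda>x. - f x)" by (intro continuous_intros cont)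
  have f': "(\<lambda>x. - f x) \<in> borel_measurable config" using f by simp
  have B': "\<bar>- f x\<bar> \<le> B" if "x \<in> space config" for x using B[OF that] by simp
  show "((\<lambda>t. \<integral>x. f x \<partial>\<mu>t t) \<longlongrightarrow> (\<integral>x. f x \<partial>\<mu>)) at_top"
  proof (rule tendstoI)
    fix e :: real assume e: "e > 0"
    have "\<forall>\<^sub>F t in at_top. (\<integral>x. f x \<partial>\<mu>) - e < (\<integral>x. f x \<partial>\<mu>t t)"
      by (rule eventually_integral_greater[OF \<mu> \<mu>t conv f B continuous_on_config_lsc[OF cont] e])
    moreover have "\<forall>\<^sub>F t in at_top. (\<integral>x. - f x \<partial>\<mu>) - e < (\<integral>x. - f x \<partial>\<mu>t t)"
      by (rule eventually_integral_greater[OF \<mu> \<mu>t conv f' B' continuous_on_config_lsc[OF cont'] e])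
    ultimately show "\<forall>\<^sub>F t in at_top. dist (\<integral>x. f x \<partial>\<mu>t t) (\<integral>x. f x \<partial>\<mu>) < e"
      by eventually_elim (simp add: dist_real_def abs_less_iff)
  qed
qed

lemma sets_config_restrict: "sets (config :: ('v::finite \<Rightarrow> real) measure) = sets (restrict_space borel (space config))"
proof
  have "(\<lambda>x. x) \<in> restrict_space borel (space config) \<rightarrow>\<^sub>M (config :: ('v \<Rightarrow> real) measure)"
  proof (rule measurable_configI)
    have "(\<lambda>x::'v \<Rightarrow> real. x l) \<in> borel_measurable borel" for l
      by (rule borel_measurable_continuous_onI) (rule continuous_on_product_coordinates)
    then show "(\<lambda>x::'v \<Rightarrow> real. x l) \<in> borel_measurable (restrict_space borel (space config))" for l
      by (rule measurable_restrict_space1)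
  qed (auto simp: space_restrict_space)
  note id = this
  show "sets (config :: ('v \<Rightarrow> real) measure) \<subseteq> sets (restrict_space borel (space config))"
  proof
    fix A :: "('v \<Rightarrow> real) set" assume A: "A \<in> sets config"
    have "(\<lambda>x. x) -` A \<inter> space (restrict_space borel (space config)) = A"
      using sets.sets_into_space[OF A] by (auto simp: space_restrict_space)
    with measurable_sets[OF id A] show "A \<in> sets (restrict_space borel (space config))"
      by simp
  qed
next
  have "(\<lambda>x. x) \<in> config \<rightarrow>\<^sub>M Pi\<^sub>M UNIV (\<lambda>_::'v. borel :: real measure)"
    by (rule measurable_PiM_single'[of UNIV "\<lambda>l z. z l", simplified]) (auto intro: measurable_config_component)
  then have "(\<lambda>x::'v \<Rightarrow> real. x) \<in> config \<rightarrow>\<^sub>M borel"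
    using measurable_cong_sets[OF refl sets_PiM_equal_borel] by blast
  then show "sets (restrict_space borel (space config)) \<subseteq> sets (config :: ('v \<Rightarrow> real) measure)"
  proof (intro subsetI, unfold sets_restrict_space, elim imageE)
    fix A D :: "('v \<Rightarrow> real) set" assume id: "(\<lambda>x::'v \<Rightarrow> real. x) \<in> config \<rightarrow>\<^sub>M borel" and D: "D \<in> sets borel" "A = space config \<inter> D"
    have "(\<lambda>x. x) -` D \<inter> space config = A" using D(2) by auto
    with measurable_sets[OF id D(1)] show "A \<in> sets config" by simp
  qed
qed

text \<open>The portmanteau bound for a constant family compares the masses of open sets, and
  exchanging the two laws gives equality. Open sets form an intersection-stable generator of the
  Borel sets, to which the product sigma-algebra reduces by
  \<open>sets_config_restrict\<close>.\<close>

lemma prob_algebra_config_eqI: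
  assumes \<mu>: "\<mu> \<in> space (prob_algebra (config :: ('v::finite \<Rightarrow> real) measure))"
    and \<mu>': "\<mu>' \<in> space (prob_algebra config)"
    and eq: "\<And>g L B. config_lipschitz L g \<Longrightarrow> (\<And>x. x \<in> space config \<Longrightarrow> \<bar>g x\<bar> \<le> B) \<Longrightarrow>
       (\<integral>x. g x \<partial>\<mu>) = (\<integral>x. g x \<partial>\<mu>')"
  shows "\<mu> = \<mu>'"
proof -
  let ?S = "space config :: ('v \<Rightarrow> real) set"
  have le: "measure \<mu> (U \<inter> ?S) \<le> measure \<mu>' (U \<inter> ?S)"
    if U: "open U" and \<mu>: "\<mu> \<in> space (prob_algebra (config :: ('v \<Rightarrow> real) measure))"
    and \<mu>': "\<mu>' \<in> space (prob_algebra config)"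
    and eq: "\<And>g L B. config_lipschitz L g \<Longrightarrow> (\<And>x. x \<in> space config \<Longrightarrow> \<bar>g x\<bar> \<le> B) \<Longrightarrow>
       (\<integral>x. g x \<partial>\<mu>) = (\<integral>x. g x \<partial>\<mu>')" for U \<mu> \<mu>'
  proof (rule field_le_epsilon)
    fix e :: real assume e: "e > 0"
    have US: "U \<inter> ?S \<in> sets config"
      unfolding sets_config_restrict sets_restrict_space using U by auto
    let ?f = "indicator (U \<inter> ?S) :: ('v \<Rightarrow> real) \<Rightarrow> real"
    have lsc: "\<exists>\<delta>>0. \<forall>y\<in>space config. l1_dist x y < \<delta> \<longrightarrow> ?f x - \<epsilon> < ?f y"
      if x: "x \<in> space config" and \<epsilon>: "\<epsilon> > 0" for x :: "'v \<Rightarrow> real" and \<epsilon> :: real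
    proof (cases "x \<in> U")
      case True
      obtain \<delta> where "\<delta> > 0" "\<And>y. l1_dist x y < \<delta> \<Longrightarrow> y \<in> U"
        using open_l1_ball[OF U True] by blast
      then show ?thesis using \<epsilon> by (intro exI[of _ \<delta>]) (auto simp: indicator_def)
    next
      case False
      then show ?thesis using \<epsilon> by (intro exI[of _ 1]) (auto simp: indicator_def)
    qed
    have "\<forall>\<^sub>F t in sequentially. integral\<^sup>L \<mu> ?f - e < integral\<^sup>L \<mu>' ?f"
    \<comment> \<open>The family is constant, so any proper filter would do; the indicator of a
      relatively open set is lower semicontinuous.\<close>
    proof (rule eventually_integral_greater[where \<mu>t="\<lambda>_. \<mu>'" and B=1, OF \<mu> _ _ _ _ lsc e])
      show "((\<lambda>t. \<integral>x. g x \<partial>\<mu>') \<longlongrightarrow> (\<integral>x. g x \<partial>\<mu>)) sequentially"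
        if "config_lipschitz L g" "\<And>x. x \<in> space config \<Longrightarrow> \<bar>g x\<bar> \<le> B" for g L B
        using eq[OF that] by simp
      show "\<forall>\<^sub>F t in sequentially. \<mu>' \<in> space (prob_algebra config)"
        using \<mu>' by simp
      show "?f \<in> borel_measurable config" using US by simp
    qed (auto simp: indicator_def)
    then have "integral\<^sup>L \<mu> ?f - e < integral\<^sup>L \<mu>' ?f"
      by (auto dest: eventually_happens)
    moreover have "space \<mu> = ?S" "space \<mu>' = ?S"
      using \<mu> \<mu>' by (auto simp: space_prob_algebra dest: sets_eq_imp_space_eq)
    ultimately show "measure \<mu> (U \<inter> ?S) \<le> measure \<mu>' (U \<inter> ?S) + e"
      by (simp add: Int_absorb2)
  qed
  have sets: "sets \<mu> = sets config" "sets \<mu>' = sets config" and ps: "prob_space \<mu>" "prob_space \<mu>'"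
    using \<mu> \<mu>' by (auto simp: space_prob_algebra)
  have sp: "space \<mu> = ?S" "space \<mu>' = ?S"
    using sets by (auto dest: sets_eq_imp_space_eq)
  have meas: "(\<lambda>x. x) \<in> \<mu> \<rightarrow>\<^sub>M borel" "(\<lambda>x. x) \<in> \<mu>' \<rightarrow>\<^sub>M borel"
  proof -
    have "(\<lambda>x. x) \<in> restrict_space borel ?S \<rightarrow>\<^sub>M borel" by (rule measurable_restrict_space1) simp
    then show "(\<lambda>x. x) \<in> \<mu> \<rightarrow>\<^sub>M borel" "(\<lambda>x. x) \<in> \<mu>' \<rightarrow>\<^sub>M borel"
      using measurable_cong_sets[OF sets(1)[unfolded sets_config_restrict] refl]
        measurable_cong_sets[OF sets(2)[unfolded sets_config_restrict] refl] by blast+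
  qed
  have "distr \<mu> borel (\<lambda>x. x) = distr \<mu>' borel (\<lambda>x. x)"
  proof (rule measure_eqI_generator_eq[of "{U. open U}" UNIV _ _ "\<lambda>_. UNIV"])
    show "Int_stable {U :: ('v \<Rightarrow> real) set. open U}" by (auto simp: Int_stable_def)
    fix U :: "('v \<Rightarrow> real) set" assume "U \<in> {U. open U}"
    then have U: "open U" by simp
    have "measure \<mu> (U \<inter> ?S) = measure \<mu>' (U \<inter> ?S)"
    proof (rule antisym)
      show "measure \<mu> (U \<inter> ?S) \<le> measure \<mu>' (U \<inter> ?S)"
        by (rule le[OF U \<mu> \<mu>']) (rule eq)
      show "measure \<mu>' (U \<inter> ?S) \<le> measure \<mu> (U \<inter> ?S)"
        by (rule le[OF U \<mu>' \<mu>]) (rule eq[symmetric])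
    qed
    then show "emeasure (distr \<mu> borel (\<lambda>x. x)) U = emeasure (distr \<mu>' borel (\<lambda>x. x)) U"
      using U ps sp
      by (simp add: emeasure_distr[OF meas(1)] emeasure_distr[OF meas(2)] vimage_def
          finite_measure.emeasure_eq_measure prob_space.finite_measure)
  next
    show "emeasure (distr \<mu> borel (\<lambda>x. x)) UNIV \<noteq> \<infinity>" for i :: nat
      using prob_space.finite_measure[OF prob_space.prob_space_distr[OF ps(1) meas(1)]]
      by (simp add: finite_measure.emeasure_finite)
  qed (auto simp: sets_borel)
  then have distr: "emeasure (distr \<mu> borel (\<lambda>x. x)) A = emeasure (distr \<mu>' borel (\<lambda>x. x)) A" for A
    by simp
  show ?thesis
  proof (rule measure_eqI)
    fix A assume "A \<in> sets \<mu>"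
    then obtain D where D: "D \<in> sets borel" "A = ?S \<inter> D"
      using sets by (auto simp: sets_config_restrict sets_restrict_space)
    show "emeasure \<mu> A = emeasure \<mu>' A"
      using distr[of D] D sp
      by (simp add: emeasure_distr[OF meas(1)] emeasure_distr[OF meas(2)] vimage_def Int_commute)
  qed (use sets in simp)
qed

section \<open>Contraction of the semigroups\<close>

context bounded_generator
begin

lemma taylor_series_pointwise:
  assumes f: "f \<in> borel_measurable X" and B: "\<And>x. x \<in> space X \<Longrightarrow> \<bar>f x\<bar> \<le> B"
    and x: "x \<in> space X" and t: "0 \<le> t"
  shows "(\<lambda>j. t ^ j / fact j * (N ^^ j) f x) sums (exp (\<Lambda> * t) * (\<integral>y. f y \<partial>P t x))"
proof -
  have \<mu>: "return X x \<in> space (prob_algebra X)"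
    using x by (simp add: space_prob_algebra prob_space_return)
  have Pm: "(\<lambda>x. \<integral>y. f y \<partial>P t x) \<in> borel_measurable X"
    by (rule prob_algebra_integral_measurable[OF kernel[OF t] f])
  have Nm: "(N ^^ j) f \<in> borel_measurable X" for j
    using jump_iterates[OF f B] by blast
  show ?thesis
    using taylor_series_integrated[OF \<mu> f B, of "\<lambda>_. 1" 1 t] t x
    by (simp add: integral_return[OF x Pm] integral_return[OF x Nm])
qed

text \<open>Comparing the two exponential series term by term bounds the difference, multiplied by
  \<open>exp (\<Lambda> * t)\<close>, by \<open>C * exp (q * t)\<close>. The decay rate is thus the
  gap between the total rate and the growth rate of Lipschitz bounds under \<open>N\<close>.\<close>

lemma semigroup_contraction:
  assumes f: "f \<in> borel_measurable X" and B: "\<And>x. x \<in> space X \<Longrightarrow> \<bar>f x\<bar> \<le> B"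
    and x: "x \<in> space X" and y: "y \<in> space X" and t: "0 \<le> t"
    and contr: "\<And>n. \<bar>(N ^^ n) f x - (N ^^ n) f y\<bar> \<le> C * q ^ n"
  shows "\<bar>(\<integral>z. f z \<partial>P t x) - (\<integral>z. f z \<partial>P t y)\<bar> \<le> C * exp (- (\<Lambda> - q) * t)"
proof -
  let ?D = "(\<integral>z. f z \<partial>P t x) - (\<integral>z. f z \<partial>P t y)"
  let ?a = "\<lambda>j. t ^ j / fact j * ((N ^^ j) f x - (N ^^ j) f y)"
  have s1: "?a sums (exp (\<Lambda> * t) * ?D)"
    using sums_diff[OF taylor_series_pointwise[OF f B x t] taylor_series_pointwise[OF f B y t]]
    by (simp add: algebra_simps)
  have "(\<lambda>j. (q * t) ^ j /\<^sub>R fact j) sums exp (q * t)"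
    by (rule exp_converges)
  from sums_mult[OF this, of C]
  have s2: "(\<lambda>j. C * (t ^ j / fact j * q ^ j)) sums (C * exp (q * t))"
    by (simp add: power_mult_distrib field_simps)
  have abs: "\<bar>?a j\<bar> \<le> C * (t ^ j / fact j * q ^ j)" for j
  proof -
    have "\<bar>?a j\<bar> = t ^ j / fact j * \<bar>(N ^^ j) f x - (N ^^ j) f y\<bar>"
      using t by (simp add: abs_mult)
    also have "\<dots> \<le> t ^ j / fact j * (C * q ^ j)"
      using t by (intro mult_left_mono contr) simp
    finally show ?thesis by (simp add: mult_ac)
  qed
  have bnd: "- (C * (t ^ j / fact j * q ^ j)) \<le> ?a j" "?a j \<le> C * (t ^ j / fact j * q ^ j)" for j
    using abs[of j] by linarith+
  have "exp (\<Lambda> * t) * ?D \<le> C * exp (q * t)"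
    using sums_le[OF bnd(2) s1 s2] .
  moreover have "- (C * exp (q * t)) \<le> exp (\<Lambda> * t) * ?D"
    using sums_le[OF bnd(1) sums_minus[OF s2] s1] .
  ultimately have "exp (\<Lambda> * t) * \<bar>?D\<bar> \<le> C * exp (q * t)"
    using abs_mult[of "exp (\<Lambda> * t)" ?D] by (simp add: abs_le_iff)
  then have "\<bar>?D\<bar> \<le> C * exp (q * t) / exp (\<Lambda> * t)"
    by (simp add: field_simps)
  also have "\<dots> = C * exp (- (\<Lambda> - q) * t)"
  proof -
    have "- (\<Lambda> - q) * t = q * t - \<Lambda> * t" by (simp add: algebra_simps)
    then show ?thesis by (simp only: exp_diff) simp
  qed
  finally show ?thesis .
qed

lemma bind_semigroup_space:
  assumes "\<mu> \<in> space (prob_algebra X)" "t \<ge> 0"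
  shows "\<mu> \<bind> P t \<in> space (prob_algebra X)"
  using prob_space_bind'[OF assms(1) kernel[OF assms(2)]] sets_bind'[OF assms(1) kernel[OF assms(2)]]
  by (simp add: space_prob_algebra)

text \<open>If \<open>N\<close> multiplies the \<mu>-integral of every bounded function by
  \<Lambda>, the integrated series is that of \<open>exp (\<Lambda> * t)\<close>, which
  cancels.\<close>

lemma stationaryI:
  assumes \<mu>: "\<mu> \<in> space (prob_algebra X)"
    and inv: "\<And>f B. f \<in> borel_measurable X \<Longrightarrow> (\<And>x. x \<in> space X \<Longrightarrow> \<bar>f x\<bar> \<le> B) \<Longrightarrow>
        (\<integral>x. N f x \<partial>\<mu>) = \<Lambda> * (\<integral>x. f x \<partial>\<mu>)"
  shows "stationary X P \<mu>"
  unfolding stationary_def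
proof (intro conjI allI impI \<mu>)
  fix t :: real assume t: "t \<ge> 0"
  show "\<mu> \<bind> P t = \<mu>"
  proof (rule prob_algebra_eqI[OF bind_semigroup_space[OF \<mu> t] \<mu>])
    fix f :: "'a \<Rightarrow> real" assume f: "f \<in> borel_measurable X" and B: "\<And>x. x \<in> space X \<Longrightarrow> \<bar>f x\<bar> \<le> 1"
    have it: "(\<integral>x. (N ^^ j) f x \<partial>\<mu>) = \<Lambda> ^ j * (\<integral>x. f x \<partial>\<mu>)" for j
    proof (induction j)
      case (Suc j)
      have "(\<integral>x. N ((N ^^ j) f) x \<partial>\<mu>) = \<Lambda> * (\<integral>x. (N ^^ j) f x \<partial>\<mu>)"
        using jump_iterates[OF f B, of j] by (intro inv[of _ "\<Lambda> ^ j * 1"]) auto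
      then show ?case using Suc by simp
    qed simp
    have "(\<lambda>j. t ^ j / fact j * (\<Lambda> ^ j * (\<integral>x. f x \<partial>\<mu>))) sums (exp (\<Lambda> * t) * (\<integral>x. \<integral>y. f y \<partial>P t x \<partial>\<mu>))"
      using taylor_series_integrated[OF \<mu> f B, of "\<lambda>_. 1" 1 t] t by (simp add: it)
    moreover have "(\<lambda>j. t ^ j / fact j * (\<Lambda> ^ j * (\<integral>x. f x \<partial>\<mu>))) sums (exp (\<Lambda> * t) * (\<integral>x. f x \<partial>\<mu>))"
      using sums_mult2[OF exp_converges[of "\<Lambda> * t"], of "\<integral>x. f x \<partial>\<mu>"]
      by (simp add: power_mult_distrib field_simps)
    ultimately have "exp (\<Lambda> * t) * (\<integral>x. \<integral>y. f y \<partial>P t x \<partial>\<mu>) = exp (\<Lambda> * t) * (\<integral>x. f x \<partial>\<mu>)"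
      by (rule sums_unique2)
    then have "(\<integral>x. \<integral>y. f y \<partial>P t x \<partial>\<mu>) = (\<integral>x. f x \<partial>\<mu>)" by simp
    then show "(\<integral>x. f x \<partial>(\<mu> \<bind> P t)) = (\<integral>x. f x \<partial>\<mu>)"
      by (simp add: prob_algebra_integral_bind[OF \<mu> kernel[OF t] f B])
  qed
qed

end

section \<open>Contraction of Lipschitz weights in one move\<close>

text \<open>The dual action of a move on the coefficients of a Lipschitz bound. After a bulk move a
  discrepancy at \<open>i\<close> or \<open>j\<close> is on average felt with the mean of the two
  weights; a reservoir contact halves the discrepancy of its site.\<close>

fun averaged_weight :: "'v move \<Rightarrow> ('v \<Rightarrow> real) \<Rightarrow> 'v \<Rightarrow> real" where
  "averaged_weight (Inl (i, j)) w = w(i := (w i + w j) / 2, j := (w i + w j) / 2)"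
| "averaged_weight (Inr i) w = w(i := w i / 2)"

definition weighted_dist :: "('v::finite \<Rightarrow> real) \<Rightarrow> ('v \<Rightarrow> real) \<Rightarrow> ('v \<Rightarrow> real) \<Rightarrow> real" where
  "weighted_dist w x y = (\<Sum>l\<in>UNIV. w l * \<bar>x l - y l\<bar>)"

text \<open>The variables \<open>u\<close> and \<open>1 - u\<close> have the same law, so their
  means are equal and add up to 1.\<close>

lemma beta_distr_mean:
  assumes s: "s > 0"
  shows "integrable (beta_distr s) (\<lambda>u. u)" and "(\<integral>u. u \<partial>beta_distr s) = 1 / 2"
proof -
  interpret prob_space "beta_distr s" by (rule prob_space_beta_distr[OF s])
  note [measurable] = measurable_beta_borel[of s]
  show int: "integrable (beta_distr s) (\<lambda>u. u)"
    by (rule integrable_const_bound[of _ 1]) auto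
  have "(\<integral>u. u \<partial>beta_distr s) = enn2real (\<integral>\<^sup>+u. ennreal u \<partial>beta_distr s)"
    by (rule integral_eq_nn_integral) auto
  also have "(\<integral>\<^sup>+u. ennreal u \<partial>beta_distr s) = (\<integral>\<^sup>+u. ennreal (1 - u) \<partial>beta_distr s)"
    by (rule nn_integral_beta_distr_flip[symmetric]) simp
  also have "enn2real \<dots> = (\<integral>u. 1 - u \<partial>beta_distr s)"
    by (rule integral_eq_nn_integral[symmetric]) auto
  also have "\<dots> = 1 - (\<integral>u. u \<partial>beta_distr s)"
    using int prob_space by simp
  finally show "(\<integral>u. u \<partial>beta_distr s) = 1 / 2" by simp
qed

text \<open>Synchronous coupling: both starting points are moved with the same noise. Here \<phi>
  stands for the Beta component of the noise, and as the bound is affine in it, only its mean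
  enters.\<close>

lemma integral_distr_diff_le:
  fixes f :: "'a \<Rightarrow> real"
  assumes M: "prob_space M" and T: "T \<in> M \<rightarrow>\<^sub>M X" and T': "T' \<in> M \<rightarrow>\<^sub>M X"
    and f: "f \<in> borel_measurable X" and B: "\<And>x. x \<in> space X \<Longrightarrow> \<bar>f x\<bar> \<le> B"
    and \<phi>: "integrable M \<phi>" "(\<integral>\<omega>. \<phi> \<omega> \<partial>M) = 1 / 2"
    and le: "\<And>\<omega>. \<omega> \<in> space M \<Longrightarrow> \<bar>f (T \<omega>) - f (T' \<omega>)\<bar> \<le> a + b * \<phi> \<omega>"
  shows "\<bar>(\<integral>x. f x \<partial>distr M X T) - (\<integral>x. f x \<partial>distr M X T')\<bar> \<le> a + b / 2"
proof -
  interpret prob_space M by fact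
  have int: "integrable M (\<lambda>\<omega>. f (T \<omega>))" "integrable M (\<lambda>\<omega>. f (T' \<omega>))"
    using measurable_space[OF T] measurable_space[OF T'] B measurable_compose[OF T f] measurable_compose[OF T' f]
    by (auto intro!: integrable_const_bound[of _ B])
  have "\<bar>(\<integral>x. f x \<partial>distr M X T) - (\<integral>x. f x \<partial>distr M X T')\<bar> = \<bar>\<integral>\<omega>. f (T \<omega>) - f (T' \<omega>) \<partial>M\<bar>"
    using int by (simp add: integral_distr[OF T f] integral_distr[OF T' f])
  also have "\<dots> \<le> (\<integral>\<omega>. \<bar>f (T \<omega>) - f (T' \<omega>)\<bar> \<partial>M)"
    by (rule integral_abs_bound)
  also have "\<dots> \<le> (\<integral>\<omega>. a + b * \<phi> \<omega> \<partial>M)"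
    using int \<phi>(1) le by (intro integral_mono) auto
  also have "\<dots> = a + b / 2"
    using \<phi> by (simp add: prob_space)
  finally show ?thesis .
qed

lemma sum_split_pair:
  fixes h :: "'v::finite \<Rightarrow> real"
  assumes "i \<noteq> j"
  shows "(\<Sum>l\<in>UNIV. h l) = h i + h j + (\<Sum>l\<in>UNIV - {i, j}. h l)"
proof -
  have "(\<Sum>l\<in>UNIV. h l) = h i + (\<Sum>l\<in>UNIV - {i}. h l)" by (rule sum.remove) auto
  also have "(\<Sum>l\<in>UNIV - {i}. h l) = h j + (\<Sum>l\<in>UNIV - {i} - {j}. h l)"
    using assms by (intro sum.remove) auto
  also have "UNIV - {i} - {j} = UNIV - {i, j}" by auto
  finally show ?thesis by simp
qed

lemma sum_split_site:
  fixes h :: "'v::finite \<Rightarrow> real"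
  shows "(\<Sum>l\<in>UNIV. h l) = h i + (\<Sum>l\<in>UNIV - {i}. h l)"
  by (rule sum.remove) auto

text \<open>With common noise a bulk move splits the discrepancy of the totals in the proportion
  \<open>u\<close> to \<open>1 - u\<close>. In a reservoir move the common injected energy cancels,
  and the factor \<open>u\<close> shrinks the discrepancy of the site.\<close>

lemma kmp_kernel_lipschitz:
  fixes f :: "('v::finite \<Rightarrow> real) \<Rightarrow> real"
  assumes s: "s > 0" and \<theta>': "\<And>i. \<theta>' i > 0"
    and f: "f \<in> borel_measurable config" and B: "\<And>x. x \<in> space config \<Longrightarrow> \<bar>f x\<bar> \<le> B"
    and w: "\<And>l. w l \<ge> 0" and lip: "\<And>x y. x \<in> space config \<Longrightarrow> y \<in> space config \<Longrightarrow> \<bar>f x - f y\<bar> \<le> weighted_dist w x y"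
    and x: "x \<in> space config" and y: "y \<in> space config" and k: "\<And>i. k \<noteq> Inl (i, i)"
  shows "\<bar>(\<integral>z. f z \<partial>kmp_kernel s \<theta>' k x) - (\<integral>z. f z \<partial>kmp_kernel s \<theta>' k y)\<bar> \<le> weighted_dist (averaged_weight k w) x y"
proof (cases k)
  case (Inl q)
  obtain i j where q: "q = (i, j)" by (cases q)
  with k[of i] Inl have ij: "i \<noteq> j" by auto
  let ?R = "\<Sum>l\<in>UNIV - {i, j}. w l * \<bar>x l - y l\<bar>" and ?d = "\<lambda>l. \<bar>x l - y l\<bar>"
  let ?T = "\<lambda>x u. x(i := u * (x i + x j), j := (1 - u) * (x i + x j))"
  note m = kmp_bulk_map_measurable[OF s x, of i j] kmp_bulk_map_measurable[OF s y, of i j]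
  \<comment> \<open>The bound \<open>(w i * u + w j * (1 - u)) * (?d i + ?d j) + ?R\<close>, sorted
    by powers of \<open>u\<close>.\<close>
  have "\<bar>(\<integral>z. f z \<partial>distr (beta_distr s) config (?T x)) - (\<integral>z. f z \<partial>distr (beta_distr s) config (?T y))\<bar>
    \<le> (?R + w j * (?d i + ?d j)) + ((w i - w j) * (?d i + ?d j)) / 2"
  proof (rule integral_distr_diff_le[OF prob_space_beta_distr[OF s] m f B beta_distr_mean[OF s]])
    fix u assume u: "u \<in> space (beta_distr s)"
    then have u01: "0 \<le> u" "u \<le> 1" by auto
    have "\<bar>f (?T x u) - f (?T y u)\<bar> \<le> weighted_dist w (?T x u) (?T y u)"
      by (rule lip[OF measurable_space[OF m(1) u] measurable_space[OF m(2) u]])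
    also have "\<dots> = w i * \<bar>u * (x i + x j) - u * (y i + y j)\<bar> + w j * \<bar>(1 - u) * (x i + x j) - (1 - u) * (y i + y j)\<bar> + ?R"
      unfolding weighted_dist_def using ij by (subst sum_split_pair[OF ij]) (auto intro!: sum.cong)
    also have "\<dots> = (w i * u + w j * (1 - u)) * \<bar>(x i + x j) - (y i + y j)\<bar> + ?R"
      unfolding right_diff_distrib[symmetric] abs_mult using u01 by (simp add: algebra_simps)
    also have "\<dots> \<le> (w i * u + w j * (1 - u)) * (?d i + ?d j) + ?R"
      using u01 w by (intro add_right_mono mult_left_mono add_nonneg_nonneg mult_nonneg_nonneg) auto
    finally show "\<bar>f (?T x u) - f (?T y u)\<bar> \<le> (?R + w j * (?d i + ?d j)) + ((w i - w j) * (?d i + ?d j)) * u"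
      by (simp add: algebra_simps)
  qed auto
  also have "\<dots> = weighted_dist (averaged_weight k w) x y"
  proof -
    have "(\<Sum>l\<in>UNIV - {i, j}. averaged_weight k w l * \<bar>x l - y l\<bar>) = ?R"
      by (rule sum.cong) (auto simp: Inl q)
    then show ?thesis
      unfolding weighted_dist_def using ij by (subst sum_split_pair[OF ij]) (simp add: Inl q field_simps)
  qed
  finally show ?thesis
    unfolding Inl q kmp_kernel_bulk[OF s \<theta>' x] kmp_kernel_bulk[OF s \<theta>' y] .
next
  case (Inr i)
  let ?R = "\<Sum>l\<in>UNIV - {i}. w l * \<bar>x l - y l\<bar>"
  let ?M = "injected_law s \<theta>' k \<Otimes>\<^sub>M beta_distr s"
  note m = kmp_map_measurable_noise[OF x, of k s \<theta>'] kmp_map_measurable_noise[OF y, of k s \<theta>']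
  have pN: "prob_space (injected_law s \<theta>' k)" by (rule prob_space_injected_law[OF s \<theta>'])
  interpret B: prob_space "beta_distr s" by (rule prob_space_beta_distr[OF s])
  have ds: "distr ?M (beta_distr s) snd = beta_distr s"
    by (rule prob_space.distr_pair_snd[OF pN]) (rule prob_space_imp_sigma_finite[OF prob_space_beta_distr[OF s]])
  have mean: "integrable ?M snd" "(\<integral>z. snd z \<partial>?M) = 1 / 2"
    using integrable_distr_eq[of snd ?M "beta_distr s" "\<lambda>u. u"] integral_distr[of snd ?M "beta_distr s" "\<lambda>u. u"]
      beta_distr_mean[OF s] measurable_beta_borel[of s] by (simp_all add: ds)
  have "\<bar>(\<integral>z. f z \<partial>distr ?M config (kmp_map k x)) - (\<integral>z. f z \<partial>distr ?M config (kmp_map k y))\<bar>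
    \<le> ?R + (w i * \<bar>x i - y i\<bar>) / 2"
  proof (rule integral_distr_diff_le[OF prob_space_pair[OF pN prob_space_beta_distr[OF s]] m f B mean])
    fix z assume z: "z \<in> space ?M"
    then have u01: "0 \<le> snd z" by (auto simp: space_pair_measure)
    have "\<bar>f (kmp_map k x z) - f (kmp_map k y z)\<bar> \<le> weighted_dist w (kmp_map k x z) (kmp_map k y z)"
      by (rule lip[OF measurable_space[OF m(1) z] measurable_space[OF m(2) z]])
    also have "\<dots> = w i * \<bar>(x i + fst z) * snd z - (y i + fst z) * snd z\<bar> + ?R"
      unfolding weighted_dist_def by (subst sum_split_site[of _ i], cases z) (auto simp: Inr intro!: sum.cong)
    also have "\<dots> = ?R + (w i * \<bar>x i - y i\<bar>) * snd z"
      unfolding left_diff_distrib[symmetric] abs_mult using u01 by simp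
    finally show "\<bar>f (kmp_map k x z) - f (kmp_map k y z)\<bar> \<le> ?R + (w i * \<bar>x i - y i\<bar>) * snd z" .
  qed auto
  also have "\<dots> = weighted_dist (averaged_weight k w) x y"
    unfolding weighted_dist_def by (subst sum_split_site[of _ i]) (auto simp: Inr intro!: sum.cong)
  finally show ?thesis by (simp add: kmp_kernel_def)
qed

text \<open>The averaged weights arise in another way than for the energies: both sites of a pair
  receive the same discrepancy, a convex combination of the old ones, and this is weighted by
  \<open>w i + w j\<close>.\<close>

lemma hidden_kernel_lipschitz:
  fixes f :: "('v::finite \<Rightarrow> real) \<Rightarrow> real"
  assumes s: "s > 0" and \<theta>': "\<And>i. \<theta>' i > 0"
    and f: "f \<in> borel_measurable config" and B: "\<And>x. x \<in> space config \<Longrightarrow> \<bar>f x\<bar> \<le> B"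
    and w: "\<And>l. w l \<ge> 0" and lip: "\<And>x y. x \<in> space config \<Longrightarrow> y \<in> space config \<Longrightarrow> \<bar>f x - f y\<bar> \<le> weighted_dist w x y"
    and x: "x \<in> space config" and y: "y \<in> space config" and k: "\<And>i. k \<noteq> Inl (i, i)"
  shows "\<bar>(\<integral>z. f z \<partial>hidden_kernel s \<theta>' k x) - (\<integral>z. f z \<partial>hidden_kernel s \<theta>' k y)\<bar> \<le> weighted_dist (averaged_weight k w) x y"
proof -
  let ?T = "hidden_map \<theta>' k" and ?d = "\<lambda>l. \<bar>x l - y l\<bar>"
  have m: "?T x \<in> beta_distr s \<rightarrow>\<^sub>M config" "?T y \<in> beta_distr s \<rightarrow>\<^sub>M config"
    by (rule hidden_map_measurable_noise, rule \<theta>', rule x, rule hidden_map_measurable_noise, rule \<theta>', rule y)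
  have lip': "\<bar>f (?T x u) - f (?T y u)\<bar> \<le> weighted_dist w (?T x u) (?T y u)" if u: "u \<in> space (beta_distr s)" for u
    by (rule lip[OF measurable_space[OF m(1) u] measurable_space[OF m(2) u]])
  note rule = integral_distr_diff_le[OF prob_space_beta_distr[OF s] m f B beta_distr_mean[OF s]]
  show ?thesis
  proof (cases k)
    case (Inl q)
    obtain i j where q: "q = (i, j)" by (cases q)
    with k[of i] Inl have ij: "i \<noteq> j" by auto
    let ?R = "\<Sum>l\<in>UNIV - {i, j}. w l * \<bar>x l - y l\<bar>"
    \<comment> \<open>The bound \<open>(w i + w j) * (?d i * u + ?d j * (1 - u)) + ?R\<close>,
      sorted by powers of \<open>u\<close>.\<close>
    have "\<bar>(\<integral>z. f z \<partial>distr (beta_distr s) config (?T x)) - (\<integral>z. f z \<partial>distr (beta_distr s) config (?T y))\<bar>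
      \<le> (?R + (w i + w j) * ?d j) + ((w i + w j) * (?d i - ?d j)) / 2"
    proof (rule rule)
      fix u assume u: "u \<in> space (beta_distr s)"
      then have u01: "0 \<le> u" "u \<le> 1" by auto
      have e: "(x i * u + x j * (1 - u)) - (y i * u + y j * (1 - u)) = (x i - y i) * u + (x j - y j) * (1 - u)"
        by (simp add: algebra_simps)
      have "weighted_dist w (?T x u) (?T y u) = (w i + w j) * \<bar>(x i - y i) * u + (x j - y j) * (1 - u)\<bar> + ?R"
        unfolding weighted_dist_def e[symmetric] using ij
        by (subst sum_split_pair[OF ij]) (auto simp: Inl q distrib_right intro!: sum.cong)
      also have "\<dots> \<le> (w i + w j) * (?d i * u + ?d j * (1 - u)) + ?R"
      proof -
        have "\<bar>(x i - y i) * u + (x j - y j) * (1 - u)\<bar> \<le> \<bar>(x i - y i) * u\<bar> + \<bar>(x j - y j) * (1 - u)\<bar>"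
          by (rule abs_triangle_ineq)
        also have "\<dots> = ?d i * u + ?d j * (1 - u)"
          unfolding abs_mult using u01 by simp
        finally show ?thesis using w[of i] w[of j] by (intro add_right_mono mult_left_mono) auto
      qed
      finally show "\<bar>f (?T x u) - f (?T y u)\<bar> \<le> (?R + (w i + w j) * ?d j) + ((w i + w j) * (?d i - ?d j)) * u"
        using lip'[OF u] by (simp add: algebra_simps)
    qed auto
    also have "\<dots> = weighted_dist (averaged_weight k w) x y"
    proof -
      have "(\<Sum>l\<in>UNIV - {i, j}. averaged_weight k w l * \<bar>x l - y l\<bar>) = ?R"
        by (rule sum.cong) (auto simp: Inl q)
      then show ?thesis
        unfolding weighted_dist_def using ij by (subst sum_split_pair[OF ij]) (simp add: Inl q field_simps)
    qed
    finally show ?thesis by (simp add: hidden_kernel_def)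
  next
    case (Inr i)
    let ?R = "\<Sum>l\<in>UNIV - {i}. w l * \<bar>x l - y l\<bar>"
    \<comment> \<open>Here \<open>u\<close> weights the reservoir parameter, which cancels; the
      discrepancy is multiplied by \<open>1 - u\<close>, hence the negative coefficient of
      \<open>u\<close>.\<close>
    have "\<bar>(\<integral>z. f z \<partial>distr (beta_distr s) config (?T x)) - (\<integral>z. f z \<partial>distr (beta_distr s) config (?T y))\<bar>
      \<le> (?R + w i * ?d i) + (- (w i * ?d i)) / 2"
    proof (rule rule)
      fix u assume u: "u \<in> space (beta_distr s)"
      then have u01: "0 \<le> u" "u \<le> 1" by auto
      have e: "((1 - u) * x i + u * \<theta>' i) - ((1 - u) * y i + u * \<theta>' i) = (1 - u) * (x i - y i)"
        by (simp add: algebra_simps)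
      have "weighted_dist w (?T x u) (?T y u) = w i * \<bar>(1 - u) * (x i - y i)\<bar> + ?R"
        unfolding weighted_dist_def e[symmetric]
        by (subst sum_split_site[of _ i]) (auto simp: Inr intro!: sum.cong)
      also have "\<dots> = (?R + w i * ?d i) + (- (w i * ?d i)) * u"
        unfolding abs_mult using u01 by (simp add: algebra_simps)
      finally show "\<bar>f (?T x u) - f (?T y u)\<bar> \<le> (?R + w i * ?d i) + (- (w i * ?d i)) * u"
        using lip'[OF u] by simp
    qed auto
    also have "\<dots> = weighted_dist (averaged_weight k w) x y"
      unfolding weighted_dist_def by (subst sum_split_site[of _ i]) (auto simp: Inr intro!: sum.cong)
    finally show ?thesis by (simp add: hidden_kernel_def)
  qed
qed

section \<open>The random walk killed at the reservoirs\<close>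

text \<open>At a positive maximum the jump term and the killing term are both nonpositive
  contributions, so both vanish: the neighbours attain the maximum too and there is no killing. By
  irreducibility this reaches the site \<open>k\<close>, where the walk is killed.\<close>

lemma killed_walk_maximum_principle:
  fixes p :: "'v::finite \<Rightarrow> 'v \<Rightarrow> real"
  assumes p_nonneg: "\<And>i j. p i j \<ge> 0" and irr: "irreducible_weights p"
    and c_nonneg: "\<And>i. c i \<ge> 0" and c_pos: "c k > 0"
    and eq: "\<And>l. (\<Sum>j\<in>UNIV. p l j * (w j - w l)) - c l * w l / 2 = 0"
  shows "w i \<le> 0"
proof (rule ccontr)
  assume "\<not> w i \<le> 0"
  define m where "m = Max (range w)"
  have le: "w j \<le> m" for j unfolding m_def by (rule Max_ge) auto
  have m: "m > 0" using le[of i] \<open>\<not> w i \<le> 0\<close> by simp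
  have step: "c l = 0 \<and> (\<forall>j. p l j > 0 \<longrightarrow> w j = m)" if l: "w l = m" for l
  proof -
    have neg: "p l j * (w j - w l) \<le> 0" for j
      using le[of j] p_nonneg[of l j] l by (simp add: mult_nonneg_nonpos)
    then have "(\<Sum>j\<in>UNIV. p l j * (w j - w l)) \<le> 0" by (intro sum_nonpos)
    moreover have "c l * w l \<ge> 0" using c_nonneg[of l] m l by simp
    ultimately have s0: "(\<Sum>j\<in>UNIV. p l j * (w j - w l)) = 0" and c0: "c l * w l = 0"
      using eq[of l] by linarith+
    have "(\<Sum>j\<in>UNIV. - (p l j * (w j - w l))) = 0" using s0 by (simp add: sum_negf)
    then have "p l j * (w j - w l) = 0" for j
      using sum_nonneg_eq_0_iff[of UNIV "\<lambda>j. - (p l j * (w j - w l))"] neg by simp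
    then have "p l j = 0 \<or> w j = w l" for j by simp
    moreover have "c l = 0" using c0 m l by simp
    ultimately show ?thesis using l by (metis less_irrefl)
  qed
  have "m \<in> range w" unfolding m_def by (rule Max_in) auto
  then obtain l where l: "w l = m" by auto
  have "(l, k) \<in> {(k, l). p k l > 0}\<^sup>*" using irr by (auto simp: irreducible_weights_def)
  then have "w k = m"
    by (induction rule: rtrancl_induct) (use l step in auto)
  then show False using step c_pos by auto
qed

text \<open>\<open>w\<close> is the expected lifetime of the walk with jump rates \<open>p\<close>
  and killing rate \<open>c / 2\<close>. The maximum principle for a solution and for its negative
  makes the linear operator injective, hence surjective in finite dimension, and the lifetime
  equation is solvable.\<close>

lemma killed_walk_supersolution:
  fixes p :: "'v::finite \<Rightarrow> 'v \<Rightarrow> real"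
  assumes p_nonneg: "\<And>i j. p i j \<ge> 0" and irr: "irreducible_weights p"
    and c_nonneg: "\<And>i. c i \<ge> 0" and c_pos: "c k > 0"
  obtains w where "\<And>l. w l > 0" "\<And>l. (\<Sum>j\<in>UNIV. p l j * (w j - w l)) - c l * w l / 2 = -1"
proof -
  define A :: "real ^ 'v \<Rightarrow> real ^ 'v" where
    "A v = (\<chi> l. (\<Sum>j\<in>UNIV. p l j * (v $ j - v $ l)) - c l * v $ l / 2)" for v
  have lin: "linear A"
  proof (rule linearI)
    fix v v' :: "real ^ 'v" and r :: real
    have "(\<Sum>j\<in>UNIV. p l j * ((v + v') $ j - (v + v') $ l)) =
        (\<Sum>j\<in>UNIV. p l j * (v $ j - v $ l)) + (\<Sum>j\<in>UNIV. p l j * (v' $ j - v' $ l))" for l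
      by (simp add: sum.distrib[symmetric] algebra_simps)
    then show "A (v + v') = A v + A v'"
      by (simp add: A_def vec_eq_iff field_simps)
    have "(\<Sum>j\<in>UNIV. p l j * ((r *\<^sub>R v) $ j - (r *\<^sub>R v) $ l)) = r * (\<Sum>j\<in>UNIV. p l j * (v $ j - v $ l))" for l
      by (simp add: sum_distrib_left algebra_simps)
    then show "A (r *\<^sub>R v) = r *\<^sub>R A v"
      by (simp add: A_def vec_eq_iff algebra_simps)
  qed
  have "v = 0" if "A v = 0" for v
  proof -
    have eq: "(\<Sum>j\<in>UNIV. p l j * (v $ j - v $ l)) - c l * v $ l / 2 = 0" for l
      using that by (simp add: A_def vec_eq_iff)
    have "v $ i \<le> 0" for i
      by (rule killed_walk_maximum_principle[where p=p and c=c and w="\<lambda>i. v $ i", OF p_nonneg irr c_nonneg c_pos eq])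
    moreover have "- v $ i \<le> 0" for i
    proof (rule killed_walk_maximum_principle[where p=p and c=c and w="\<lambda>i. - v $ i", OF p_nonneg irr c_nonneg c_pos])
      fix l
      have "(\<Sum>j\<in>UNIV. p l j * (- v $ j - - v $ l)) = - (\<Sum>j\<in>UNIV. p l j * (v $ j - v $ l))"
        unfolding sum_negf[symmetric] by (simp add: algebra_simps)
      then show "(\<Sum>j\<in>UNIV. p l j * (- v $ j - - v $ l)) - c l * - v $ l / 2 = 0"
        using eq[of l] by simp
    qed
    ultimately show ?thesis by (simp add: vec_eq_iff antisym)
  qed
  then have "inj A" using linear_injective_0[OF lin] by auto
  then have "surj A" by (rule linear_injective_imp_surjective[OF lin]) simp
  then obtain v where v: "A v = (\<chi> l. - 1)" by (metis surjD)
  define w where "w l = v $ l" for l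
  have w: "(\<Sum>j\<in>UNIV. p l j * (w j - w l)) - c l * w l / 2 = -1" for l
    using v by (simp add: A_def vec_eq_iff w_def)
  \<comment> \<open>At a minimum of \<open>w\<close> the jump term is nonnegative, so the equation
    forces \<open>c i * w i > 0\<close> there, and the minimal value is positive.\<close>
  define m where "m = Min (range w)"
  have le: "m \<le> w j" for j unfolding m_def by (rule Min_le) auto
  have "m \<in> range w" unfolding m_def by (rule Min_in) auto
  then obtain i where i: "w i = m" by auto
  have "(\<Sum>j\<in>UNIV. p i j * (w j - w i)) \<ge> 0"
    using le p_nonneg i by (intro sum_nonneg mult_nonneg_nonneg) auto
  then have "c i * w i > 0" using w[of i] by linarith
  then have "w i > 0" using c_nonneg[of i] by (metis zero_less_mult_pos less_le mult_zero_left)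
  then have "w l > 0" for l using le[of l] i by linarith
  then show ?thesis using that w by blast
qed

text \<open>Averaging over one ordered pair moves the weight at \<open>l\<close> by half the
  difference to its neighbour. Both orderings of the pair occur, and by symmetry of \<open>p\<close>
  the halves add up to the full rate; a reservoir occurs once, which leaves the factor 1/2 on
  \<open>c\<close>.\<close>

lemma averaged_weight_drift:
  fixes p :: "'v::finite \<Rightarrow> 'v \<Rightarrow> real"
  assumes sym: "\<And>i j. p i j = p j i"
  shows "(\<Sum>k\<in>UNIV. rate p c k * averaged_weight k w l) =
    sum (rate p c) UNIV * w l + ((\<Sum>j\<in>UNIV. p l j * (w j - w l)) - c l * w l / 2)"
proof -
  have "(\<Sum>k\<in>UNIV. rate p c k * averaged_weight k w l) - sum (rate p c) UNIV * w l
      = (\<Sum>k\<in>UNIV. rate p c k * (averaged_weight k w l - w l))"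
    by (simp add: right_diff_distrib sum_subtractf sum_distrib_right)
  also have "\<dots> = (\<Sum>i\<in>UNIV. \<Sum>j\<in>UNIV. (if i = l then p l j * (w j - w l) / 2 else 0) + (if j = l then p i l * (w i - w l) / 2 else 0))
      + (\<Sum>i\<in>UNIV. if i = l then - (c l * w l / 2) else 0)"
    unfolding sum_move by (intro arg_cong2[where f="(+)"] sum.cong) (auto simp: field_simps)
  also have "\<dots> = (\<Sum>i\<in>UNIV. if i = l then \<Sum>j\<in>UNIV. p l j * (w j - w l) / 2 else 0)
      + (\<Sum>i\<in>UNIV. p i l * (w i - w l) / 2) - c l * w l / 2"
  proof -
    have "(\<Sum>j\<in>UNIV. if i = l then p l j * (w j - w l) / 2 else 0) = (if i = l then \<Sum>j\<in>UNIV. p l j * (w j - w l) / 2 else 0)" for i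
      by simp
    then show ?thesis by (simp add: sum.distrib)
  qed
  also have "\<dots> = (\<Sum>j\<in>UNIV. p l j * (w j - w l)) - c l * w l / 2"
  proof -
    have "(\<Sum>i\<in>UNIV. p i l * (w i - w l) / 2) = (\<Sum>j\<in>UNIV. p l j * (w j - w l) / 2)"
      by (rule sum.cong) (auto simp: sym)
    then show ?thesis by (simp add: sum_divide_distrib[symmetric])
  qed
  finally show ?thesis by simp
qed

lemma contracting_weight:
  fixes p :: "'v::finite \<Rightarrow> 'v \<Rightarrow> real"
  assumes sym: "\<And>i j. p i j = p j i" and p_nonneg: "\<And>i j. p i j \<ge> 0" and irr: "irreducible_weights p"
    and c_nonneg: "\<And>i. c i \<ge> 0" and c_pos: "c k > 0"
  shows "\<exists>w \<delta>. (\<forall>l. w l > 0) \<and> \<delta> > 0 \<and> \<delta> \<le> sum (rate p c) UNIV \<and>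
    (\<forall>l. (\<Sum>k\<in>UNIV. rate p c k * averaged_weight k w l) \<le> (sum (rate p c) UNIV - \<delta>) * w l)"
proof -
  obtain w where w: "\<And>l. w l > 0" "\<And>l. (\<Sum>j\<in>UNIV. p l j * (w j - w l)) - c l * w l / 2 = -1"
    using killed_walk_supersolution[of p c k] p_nonneg irr c_nonneg c_pos by metis
  \<comment> \<open>Chosen so that \<open>\<delta> * w l \<le> 1\<close>, the constant drift of the
    lifetime function.\<close>
  define \<delta> where "\<delta> = 1 / Max (range w)"
  have Max: "w l \<le> Max (range w)" for l by (rule Max_ge) auto
  then have M0: "Max (range w) > 0" using w(1) less_le_trans by blast
  have \<delta>: "\<delta> > 0" using M0 by (simp add: \<delta>_def)
  have le: "(\<Sum>k\<in>UNIV. rate p c k * averaged_weight k w l) \<le> (sum (rate p c) UNIV - \<delta>) * w l" for l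
  proof -
    have "\<delta> * w l \<le> 1" using Max[of l] M0 by (simp add: \<delta>_def field_simps)
    then show ?thesis
      unfolding averaged_weight_drift[OF sym] w(2) by (simp add: algebra_simps)
  qed
  \<comment> \<open>Nonnegativity of the averaged weights forces
    \<open>\<delta> \<le> \<Lambda>\<close>, so that \<open>\<Lambda> - \<delta>\<close> can serve
    as a growth factor in powers.\<close>
  have "0 \<le> (\<Sum>q\<in>UNIV. rate p c q * averaged_weight q w k)"
  proof (intro sum_nonneg mult_nonneg_nonneg)
    fix q :: "'v move"
    show "rate p c q \<ge> 0" using p_nonneg c_nonneg by (cases q) (auto split: prod.split)
    show "averaged_weight q w k \<ge> 0" using w(1) by (cases q) (auto split: prod.split simp: less_imp_le add_nonneg_nonneg)
  qed
  with le[of k] have "0 \<le> (sum (rate p c) UNIV - \<delta>) * w k" by linarith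
  then have "\<delta> \<le> sum (rate p c) UNIV" using w(1)[of k] by (simp add: zero_le_mult_iff)
  with w(1) \<delta> le show ?thesis by blast
qed

section \<open>Existence of the stationary law of the hidden model\<close>

lemma hidden_map_mono:
  assumes "u \<in> {0..1}" "\<And>l. \<theta> l \<le> \<eta> l"
  shows "hidden_map \<theta>' k \<theta> u l \<le> hidden_map \<theta>' k \<eta> u l"
proof -
  have "\<theta> i * u + \<theta> j * (1 - u) \<le> \<eta> i * u + \<eta> j * (1 - u)" for i j
    using assms by (intro add_mono mult_right_mono) auto
  moreover have "(1 - u) * \<theta> i \<le> (1 - u) * \<eta> i" for i
    using assms by (intro mult_left_mono) auto
  ultimately show ?thesis
    using assms(2) by (cases k) auto
qed

lemma convex_combination_bounds:
  fixes a b m r u :: real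
  assumes "u \<in> {0..1}" "a \<in> {m..r}" "b \<in> {m..r}"
  shows "a * u + b * (1 - u) \<in> {m..r}"
proof -
  have "m * u \<le> a * u" "a * u \<le> r * u" "m * (1 - u) \<le> b * (1 - u)" "b * (1 - u) \<le> r * (1 - u)"
    using assms by (auto intro: mult_right_mono)
  then show ?thesis by (auto simp: algebra_simps)
qed

lemma hidden_map_bounds:
  assumes u: "u \<in> {0..1}" and \<theta>: "\<And>l. \<theta> l \<in> {m..r}" and \<theta>': "\<And>l. \<theta>' l \<in> {m..r}"
  shows "hidden_map \<theta>' k \<theta> u l \<in> {m..r}"
proof (cases k)
  case (Inl q)
  obtain i j where "q = (i, j)" by (cases q)
  with Inl \<theta>[of l] convex_combination_bounds[OF u \<theta> \<theta>, of i j] show ?thesis by auto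
next
  case (Inr i)
  with \<theta>[of l] convex_combination_bounds[OF u \<theta>' \<theta>, of i i] show ?thesis by (auto simp: mult.commute add.commute)
qed

text \<open>Coupling from the past: \<open>backward_chain r n \<omega>\<close> applies the last of the first \<open>n\<close> random moves
  first. Started from the upper bound \<open>r\<close> of the reservoir parameters it is decreasing in \<open>n\<close>,
  because all moves are monotone and map the constant \<open>r\<close> below itself.\<close>

fun backward_chain :: "('v \<Rightarrow> real) \<Rightarrow> real \<Rightarrow> nat \<Rightarrow> ('v move \<times> real) stream \<Rightarrow> 'v \<Rightarrow> real" where
  "backward_chain \<theta>' r 0 \<omega> = (\<lambda>_. r)"
| "backward_chain \<theta>' r (Suc n) \<omega> = hidden_map \<theta>' (fst (shd \<omega>)) (backward_chain \<theta>' r n (stl \<omega>)) (snd (shd \<omega>))"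

definition backward_limit :: "('v \<Rightarrow> real) \<Rightarrow> real \<Rightarrow> ('v move \<times> real) stream \<Rightarrow> 'v \<Rightarrow> real" where
  "backward_limit \<theta>' r \<omega> l = lim (\<lambda>n. backward_chain \<theta>' r n \<omega> l)"

context
  fixes \<theta>' :: "'v::finite \<Rightarrow> real" and m r :: real
  assumes \<theta>': "\<And>l. \<theta>' l \<in> {m..r}" and m: "0 < m"
begin

abbreviation noise_streams :: "('v move \<times> real) stream set" where
  "noise_streams \<equiv> streams (UNIV \<times> {0..1})"

lemma backward_chain_bounds:
  "\<omega> \<in> noise_streams \<Longrightarrow> backward_chain \<theta>' r n \<omega> l \<in> {m..r}"
proof (induction n arbitrary: \<omega> l)
  case 0
  then show ?case using \<theta>'[of l] by auto
next
  case (Suc n)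
  have "shd \<omega> \<in> UNIV \<times> {0..1}" "stl \<omega> \<in> noise_streams"
    using Suc.prems by (auto elim: streams.cases)
  then show ?case
    using hidden_map_bounds[of "snd (shd \<omega>)" "backward_chain \<theta>' r n (stl \<omega>)" m r \<theta>', OF _ Suc.IH \<theta>']
    by auto
qed

lemma backward_chain_decreasing:
  "\<omega> \<in> noise_streams \<Longrightarrow> backward_chain \<theta>' r (Suc n) \<omega> l \<le> backward_chain \<theta>' r n \<omega> l"
proof (induction n arbitrary: \<omega> l)
  case 0
  then show ?case using backward_chain_bounds[of \<omega> "Suc 0" l] by simp
next
  case (Suc n)
  have "snd (shd \<omega>) \<in> {0..1}" "stl \<omega> \<in> noise_streams"
    using Suc.prems by (auto elim: streams.cases)
  then show ?case
    unfolding backward_chain.simps(2)[of _ _ "Suc n"] backward_chain.simps(2)[of _ _ n \<omega>]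
    by (intro hidden_map_mono Suc.IH)
qed

lemma backward_chain_tendsto:
  assumes "\<omega> \<in> noise_streams"
  shows "(\<lambda>n. backward_chain \<theta>' r n \<omega> l) \<longlonglongrightarrow> backward_limit \<theta>' r \<omega> l"
proof -
  have "decseq (\<lambda>n. backward_chain \<theta>' r n \<omega> l)"
    using backward_chain_decreasing[OF assms] by (intro decseq_SucI)
  then obtain L where "(\<lambda>n. backward_chain \<theta>' r n \<omega> l) \<longlonglongrightarrow> L"
    using backward_chain_bounds[OF assms] by (elim decseq_convergent[of _ m]) auto
  then show ?thesis
    unfolding backward_limit_def by (simp add: limI)
qed

lemma backward_limit_lower_bound:
  assumes "\<omega> \<in> noise_streams"
  shows "m \<le> backward_limit \<theta>' r \<omega> l"
  by (rule LIMSEQ_le_const[OF backward_chain_tendsto[OF assms]])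
    (use backward_chain_bounds[OF assms] in auto)

text \<open>The head of the stream is the move applied last, and moves are continuous in the
  configuration, so it passes through the limit. Since a fresh letter in front does not change the
  law of the stream, this pathwise equation is the invariance of the law of the limit.\<close>

lemma backward_limit_step:
  assumes z: "z \<in> UNIV \<times> {0..1}" and \<omega>: "\<omega> \<in> noise_streams"
  shows "backward_limit \<theta>' r (z ## \<omega>) = hidden_map \<theta>' (fst z) (backward_limit \<theta>' r \<omega>) (snd z)"
proof
  fix l
  have z\<omega>: "z ## \<omega> \<in> noise_streams" using z \<omega> by auto
  have 1: "(\<lambda>n. hidden_map \<theta>' (fst z) (backward_chain \<theta>' r n \<omega>) (snd z) l) \<longlonglongrightarrow> backward_limit \<theta>' r (z ## \<omega>) l"
    using LIMSEQ_Suc[OF backward_chain_tendsto[OF z\<omega>, of l]] by simp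
  have 2: "(\<lambda>n. hidden_map \<theta>' (fst z) (backward_chain \<theta>' r n \<omega>) (snd z) l)
      \<longlonglongrightarrow> hidden_map \<theta>' (fst z) (backward_limit \<theta>' r \<omega>) (snd z) l"
  proof (cases "fst z")
    case (Inl q)
    obtain i j where "q = (i, j)" by (cases q)
    with Inl show ?thesis
      by (auto intro!: tendsto_intros backward_chain_tendsto[OF \<omega>])
  next
    case (Inr i)
    then show ?thesis
      by (auto intro!: tendsto_intros backward_chain_tendsto[OF \<omega>])
  qed
  show "backward_limit \<theta>' r (z ## \<omega>) l = hidden_map \<theta>' (fst z) (backward_limit \<theta>' r \<omega>) (snd z) l"
    by (rule LIMSEQ_unique[OF 1 2])
qed

end

text \<open>The law of \<open>backward_limit\<close> over independent letters, each a move drawn in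
  proportion to its rate together with a Beta variable. Positivity is recorded since the
  intertwining with the energies holds for positive parameters.\<close>

lemma hidden_invariant_law:
  fixes p :: "'v::finite \<Rightarrow> 'v \<Rightarrow> real"
  assumes s: "s > 0" and \<theta>': "\<And>i. \<theta>' i > 0"
    and rate: "\<And>k. rate p c k \<ge> 0" and total: "sum (rate p c) UNIV > 0"
  obtains \<Xi> where "\<Xi> \<in> space (prob_algebra config)" "AE \<theta> in \<Xi>. \<forall>i. \<theta> i > 0"
    "\<And>f B. f \<in> borel_measurable config \<Longrightarrow> (\<And>x. x \<in> space config \<Longrightarrow> \<bar>f x\<bar> \<le> B) \<Longrightarrow>
      (\<integral>\<theta>. jump_op (rate p c) (hidden_kernel s \<theta>') f \<theta> \<partial>\<Xi>) = sum (rate p c) UNIV * (\<integral>\<theta>. f \<theta> \<partial>\<Xi>)"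
proof -
  define \<Lambda> where "\<Lambda> = sum (rate p c) UNIV"
  have \<Lambda>: "\<Lambda> > 0" using total by (simp add: \<Lambda>_def)
  \<comment> \<open>The box \<open>{m..r}\<close> contains all reservoir parameters and is preserved
    by every move; \<open>m\<close> bounds the limit away from 0.\<close>
  define m where "m = Min (range \<theta>')"
  define r where "r = Max (range \<theta>')"
  have mr: "\<theta>' l \<in> {m..r}" for l
    unfolding m_def r_def by simp
  have "m \<in> range \<theta>'" unfolding m_def by (rule Min_in) auto
  then have m0: "0 < m" using \<theta>' by auto
  \<comment> \<open>The law of the next move, a probability since \<open>\<Lambda> > 0\<close>: the
    jump operator is \<Lambda> times one step of the chain driven by it.\<close>
  define \<kappa> where "\<kappa> = point_measure (UNIV :: 'v move set) (\<lambda>k. ennreal (rate p c k / \<Lambda>))"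
  have sets_\<kappa> [measurable_cong]: "sets \<kappa> = sets (count_space UNIV)"
    by (simp add: \<kappa>_def sets_point_measure)
  have space_\<kappa>: "space \<kappa> = UNIV" by (simp add: \<kappa>_def space_point_measure)
  have prob_\<kappa>: "prob_space \<kappa>"
    unfolding \<kappa>_def
  proof (rule prob_space_point_measure)
    have "(\<Sum>k\<in>UNIV. ennreal (rate p c k / \<Lambda>)) = ennreal (\<Sum>k\<in>UNIV. rate p c k / \<Lambda>)"
      using rate \<Lambda> by (intro sum_ennreal) simp
    also have "(\<Sum>k\<in>UNIV. rate p c k / \<Lambda>) = 1"
      using \<Lambda> by (simp add: sum_divide_distrib[symmetric] \<Lambda>_def)
    finally show "(\<Sum>k\<in>UNIV. ennreal (rate p c k / \<Lambda>)) = 1" by simp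
  qed auto
  interpret K: prob_space \<kappa> by fact
  interpret B: prob_space "beta_distr s" by (rule prob_space_beta_distr[OF s])
  let ?\<Omega> = "\<kappa> \<Otimes>\<^sub>M beta_distr s"
  have prob_\<Omega>: "prob_space ?\<Omega>" by (rule prob_space_pair[OF prob_\<kappa> prob_space_beta_distr[OF s]])
  interpret O: prob_space ?\<Omega> by fact
  let ?S = "stream_space ?\<Omega>"
  interpret S: prob_space ?S by (rule O.prob_space_stream_space)
  have space_\<Omega>: "space ?\<Omega> = UNIV \<times> {0..1}" by (simp add: space_pair_measure space_\<kappa>)
  have space_S: "space ?S = streams (UNIV \<times> {0..1})" by (simp add: space_stream_space space_\<Omega>)
  have fst_shd: "(\<lambda>\<omega>. fst (shd \<omega>)) \<in> ?S \<rightarrow>\<^sub>M count_space UNIV"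
  proof -
    have "(\<lambda>\<omega>. fst (shd \<omega>)) \<in> ?S \<rightarrow>\<^sub>M \<kappa>"
      by (rule measurable_compose[OF measurable_shd measurable_fst])
    then show ?thesis using measurable_cong_sets[OF refl sets_\<kappa>] by blast
  qed
  have snd_shd: "(\<lambda>\<omega>. snd (shd \<omega>)) \<in> ?S \<rightarrow>\<^sub>M restrict_space borel {0..1}"
  proof -
    have "(\<lambda>\<omega>. snd (shd \<omega>)) \<in> ?S \<rightarrow>\<^sub>M beta_distr s"
      by (rule measurable_compose[OF measurable_shd measurable_snd])
    then show ?thesis using measurable_cong_sets[OF refl sets_beta_distr] by blast
  qed
  have chain_meas: "backward_chain \<theta>' r n \<in> ?S \<rightarrow>\<^sub>M config" for n
  proof (induction n)
    case 0
    have "0 \<le> r" using mr m0 by (metis atLeastAtMost_iff less_imp_le order_trans)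
    then have "(\<lambda>_. r) \<in> space (config :: ('v \<Rightarrow> real) measure)" by simp
    then have "(\<lambda>\<omega> :: ('v move \<times> real) stream. (\<lambda>_::'v. r)) \<in> ?S \<rightarrow>\<^sub>M config"
      by (rule measurable_const)
    then show ?case by (simp add: fun_eq_iff[of "backward_chain \<theta>' r 0"] cong: measurable_cong)
  next
    case (Suc n)
    \<comment> \<open>There are finitely many moves, so measurability may be checked with the move
      held fixed.\<close>
    have "(\<lambda>\<omega>. hidden_map \<theta>' k (backward_chain \<theta>' r n (stl \<omega>)) (snd (shd \<omega>))) \<in> ?S \<rightarrow>\<^sub>M config" for k
    proof -
      have "(\<lambda>\<omega>. (backward_chain \<theta>' r n (stl \<omega>), snd (shd \<omega>))) \<in> ?S \<rightarrow>\<^sub>M config \<Otimes>\<^sub>M restrict_space borel {0..1}"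
        by (rule measurable_Pair[OF measurable_compose[OF measurable_stl Suc] snd_shd])
      from measurable_compose[OF this hidden_map_measurable[where k=k and \<theta>'=\<theta>']] show ?thesis
        using \<theta>' by simp
    qed
    from measurable_compose_countable[OF this fst_shd]
    have "(\<lambda>\<omega>. hidden_map \<theta>' (fst (shd \<omega>)) (backward_chain \<theta>' r n (stl \<omega>)) (snd (shd \<omega>))) \<in> ?S \<rightarrow>\<^sub>M config" .
    moreover have "(\<lambda>\<omega>. hidden_map \<theta>' (fst (shd \<omega>)) (backward_chain \<theta>' r n (stl \<omega>)) (snd (shd \<omega>))) = backward_chain \<theta>' r (Suc n)"
      by (rule ext) simp
    ultimately show ?case by simp
  qed
  let ?Z = "backward_limit \<theta>' r"
  have Z_low: "m \<le> ?Z \<omega> l" if "\<omega> \<in> space ?S" for \<omega> l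
    by (rule backward_limit_lower_bound[OF mr m0]) (use that space_S in simp)
  have Z_meas: "?Z \<in> ?S \<rightarrow>\<^sub>M config"
  proof (rule measurable_configI)
    fix l
    have "(\<lambda>\<omega>. backward_chain \<theta>' r n \<omega> l) \<in> borel_measurable ?S" for n
      by (rule measurable_compose[OF chain_meas measurable_config_component])
    then show "(\<lambda>\<omega>. ?Z \<omega> l) \<in> borel_measurable ?S"
      unfolding backward_limit_def by (rule borel_measurable_lim_metric)
  qed (use Z_low m0 in \<open>meson less_imp_le order_trans\<close>)
  define \<Xi> where "\<Xi> = distr ?S config ?Z"
  have \<Xi>: "\<Xi> \<in> space (prob_algebra config)"
    using S.prob_space_distr[OF Z_meas] by (simp add: \<Xi>_def space_prob_algebra)
  interpret X: prob_space \<Xi> using \<Xi> by (simp add: space_prob_algebra)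
  have sets_\<Xi>: "sets \<Xi> = sets config" by (simp add: \<Xi>_def)
  have pos: "AE \<theta> in \<Xi>. \<forall>i. \<theta> i > 0"
  proof -
    have "AE \<omega> in ?S. \<forall>i. ?Z \<omega> i > 0"
      using Z_low m0 by (intro AE_I2) (meson less_le_trans)
    moreover have "{\<theta> \<in> space config. \<forall>i. \<theta> i > 0} \<in> sets (config :: ('v \<Rightarrow> real) measure)"
    proof -
      note [measurable] = measurable_config_component
      show ?thesis by measurable
    qed
    ultimately show ?thesis
      unfolding \<Xi>_def using AE_distr_iff[OF Z_meas, of "\<lambda>\<theta>. \<forall>i. \<theta> i > 0"] by simp
  qed
  have H: "hidden_kernel s \<theta>' k \<in> config \<rightarrow>\<^sub>M prob_algebra config" for k
    by (rule measurable_hidden_kernel[OF s \<theta>'])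
  have bindH: "\<Xi> \<bind> hidden_kernel s \<theta>' k \<in> space (prob_algebra config)" for k
    using prob_space_bind'[OF \<Xi> H] sets_bind'[OF \<Xi> H] by (simp add: space_prob_algebra)
  let ?L = "\<lambda>k. \<Xi> \<bind> hidden_kernel s \<theta>' k"
  have kern: "?L \<in> \<kappa> \<rightarrow>\<^sub>M prob_algebra config"
  proof -
    have "?L \<in> count_space UNIV \<rightarrow>\<^sub>M prob_algebra config"
      using bindH by simp
    then show ?thesis using measurable_cong_sets[OF sets_\<kappa> refl] by blast
  qed
  have \<kappa>_space: "\<kappa> \<in> space (prob_algebra \<kappa>)" using prob_\<kappa> by (simp add: space_prob_algebra)
  \<comment> \<open>Invariance in discrete time: drawing a move and applying it to a state with law
    \<Xi> reproduces \<Xi>.\<close>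
  have "\<kappa> \<bind> ?L = \<Xi>"
  proof (rule measure_eqI)
    show "sets (\<kappa> \<bind> ?L) = sets \<Xi>"
      using sets_bind'[OF \<kappa>_space kern] sets_\<Xi> by simp
    fix A assume "A \<in> sets (\<kappa> \<bind> ?L)"
    then have A: "A \<in> sets config" using sets_bind'[OF \<kappa>_space kern] by simp
    let ?f = "indicator A :: ('v \<Rightarrow> real) \<Rightarrow> ennreal"
    have f: "?f \<in> borel_measurable config" using A by simp
    have step: "(\<lambda>(\<theta>, u). ?f (hidden_map \<theta>' k \<theta> u)) \<in> borel_measurable (\<Xi> \<Otimes>\<^sub>M beta_distr s)" for k
    proof -
      have "case_prod (hidden_map \<theta>' k) \<in> \<Xi> \<Otimes>\<^sub>M beta_distr s \<rightarrow>\<^sub>M config"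
        using hidden_map_measurable[of \<theta>' k] \<theta>' measurable_cong_sets[OF sets_pair_measure_cong[OF sets_\<Xi> sets_beta_distr] refl]
        by blast
      from measurable_compose[OF this f] show ?thesis by (simp add: case_prod_beta')
    qed
    have step': "(\<lambda>z. \<integral>\<^sup>+\<theta>. ?f (hidden_map \<theta>' (fst z) \<theta> (snd z)) \<partial>\<Xi>) \<in> borel_measurable ?\<Omega>"
    proof -
      have "(\<lambda>u. \<integral>\<^sup>+\<theta>. ?f (hidden_map \<theta>' k \<theta> u) \<partial>\<Xi>) \<in> borel_measurable (beta_distr s)" for k
        using X.borel_measurable_nn_integral[of "\<lambda>u \<theta>. ?f (hidden_map \<theta>' k \<theta> u)"] measurable_pair_swap[OF step[of k]]
        by (simp add: case_prod_beta')
      from measurable_compose[OF measurable_snd this]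
      have "(\<lambda>z. \<integral>\<^sup>+\<theta>. ?f (hidden_map \<theta>' k \<theta> (snd z)) \<partial>\<Xi>) \<in> borel_measurable ?\<Omega>" for k .
      moreover have "fst \<in> ?\<Omega> \<rightarrow>\<^sub>M count_space UNIV"
        using measurable_fst[of \<kappa> "beta_distr s"] measurable_cong_sets[OF refl sets_\<kappa>] by blast
      ultimately show ?thesis by (rule measurable_compose_countable)
    qed
    have "emeasure \<Xi> A = (\<integral>\<^sup>+\<omega>. ?f (?Z \<omega>) \<partial>?S)"
      unfolding \<Xi>_def using A Z_meas by (simp add: nn_integral_distr[symmetric])
    \<comment> \<open>The stream splits into its first letter and an independent tail with the law
      of the whole stream.\<close>
    also have "\<dots> = (\<integral>\<^sup>+z. \<integral>\<^sup>+\<omega>. ?f (?Z (z ## \<omega>)) \<partial>?S \<partial>?\<Omega>)"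
      by (rule O.nn_integral_stream_space) (rule measurable_compose[OF Z_meas f])
    also have "\<dots> = (\<integral>\<^sup>+z. \<integral>\<^sup>+\<theta>. ?f (hidden_map \<theta>' (fst z) \<theta> (snd z)) \<partial>\<Xi> \<partial>?\<Omega>)"
    proof (rule nn_integral_cong)
      fix z assume z: "z \<in> space ?\<Omega>"
      have "(\<integral>\<^sup>+\<omega>. ?f (?Z (z ## \<omega>)) \<partial>?S) = (\<integral>\<^sup>+\<omega>. ?f (hidden_map \<theta>' (fst z) (?Z \<omega>) (snd z)) \<partial>?S)"
        using z by (intro nn_integral_cong) (simp add: space_S space_\<Omega> backward_limit_step[OF mr m0])
      also have "\<dots> = (\<integral>\<^sup>+\<theta>. ?f (hidden_map \<theta>' (fst z) \<theta> (snd z)) \<partial>\<Xi>)"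
        unfolding \<Xi>_def
      proof (rule nn_integral_distr[OF Z_meas, symmetric])
        have "snd z \<in> space (beta_distr s)" using z by (auto simp: space_pair_measure)
        from measurable_Pair1[OF step[of "fst z"] this]
        have "(\<lambda>\<theta>. ?f (hidden_map \<theta>' (fst z) \<theta> (snd z))) \<in> borel_measurable \<Xi>" by simp
        then show "(\<lambda>\<theta>. ?f (hidden_map \<theta>' (fst z) \<theta> (snd z))) \<in> borel_measurable (distr ?S config ?Z)"
          by (simp add: \<Xi>_def)
      qed
      finally show "(\<integral>\<^sup>+\<omega>. ?f (?Z (z ## \<omega>)) \<partial>?S) = (\<integral>\<^sup>+\<theta>. ?f (hidden_map \<theta>' (fst z) \<theta> (snd z)) \<partial>\<Xi>)" .
    qed
    also have "\<dots> = (\<integral>\<^sup>+k. \<integral>\<^sup>+u. \<integral>\<^sup>+\<theta>. ?f (hidden_map \<theta>' k \<theta> u) \<partial>\<Xi> \<partial>beta_distr s \<partial>\<kappa>)"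
      using B.nn_integral_fst[OF step'] by simp
    also have "\<dots> = (\<integral>\<^sup>+k. emeasure (\<Xi> \<bind> hidden_kernel s \<theta>' k) A \<partial>\<kappa>)"
    proof (rule nn_integral_cong)
      fix k
      interpret XB: pair_sigma_finite \<Xi> "beta_distr s" ..
      have "(\<integral>\<^sup>+u. \<integral>\<^sup>+\<theta>. ?f (hidden_map \<theta>' k \<theta> u) \<partial>\<Xi> \<partial>beta_distr s) = (\<integral>\<^sup>+\<theta>. \<integral>\<^sup>+u. ?f (hidden_map \<theta>' k \<theta> u) \<partial>beta_distr s \<partial>\<Xi>)"
        by (rule XB.Fubini'[OF step])
      also have "\<dots> = (\<integral>\<^sup>+\<theta>. emeasure (hidden_kernel s \<theta>' k \<theta>) A \<partial>\<Xi>)"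
      proof (rule nn_integral_cong)
        fix \<theta> assume "\<theta> \<in> space \<Xi>"
        then have \<theta>: "\<theta> \<in> space config" using sets_eq_imp_space_eq[OF sets_\<Xi>] by simp
        show "(\<integral>\<^sup>+u. ?f (hidden_map \<theta>' k \<theta> u) \<partial>beta_distr s) = emeasure (hidden_kernel s \<theta>' k \<theta>) A"
          using nn_integral_hidden_kernel[of \<theta>' \<theta> ?f s k, OF \<theta>' \<theta> f] A by (simp add: hidden_kernel_def)
      qed
      also have "\<dots> = emeasure (\<Xi> \<bind> hidden_kernel s \<theta>' k) A"
        by (rule emeasure_bind_prob_algebra[OF \<Xi> H A, symmetric])
      finally show "(\<integral>\<^sup>+u. \<integral>\<^sup>+\<theta>. ?f (hidden_map \<theta>' k \<theta> u) \<partial>\<Xi> \<partial>beta_distr s) = emeasure (\<Xi> \<bind> hidden_kernel s \<theta>' k) A" .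
    qed
    also have "\<dots> = emeasure (\<kappa> \<bind> ?L) A"
      by (rule emeasure_bind_prob_algebra[OF \<kappa>_space kern A, symmetric])
    finally show "emeasure (\<kappa> \<bind> ?L) A = emeasure \<Xi> A" ..
  qed
  note mixture = this
  show ?thesis
  proof (rule that[OF \<Xi> pos])
    fix f :: "('v \<Rightarrow> real) \<Rightarrow> real" and B :: real
    assume f: "f \<in> borel_measurable config" and B: "\<And>x. x \<in> space config \<Longrightarrow> \<bar>f x\<bar> \<le> B"
    let ?I = "\<lambda>k. \<integral>\<theta>. \<integral>y. f y \<partial>hidden_kernel s \<theta>' k \<theta> \<partial>\<Xi>"
    have "(\<integral>\<theta>. f \<theta> \<partial>\<Xi>) = (\<integral>\<theta>. f \<theta> \<partial>(\<kappa> \<bind> ?L))"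
      by (simp add: mixture)
    also have "\<dots> = (\<integral>k. \<integral>\<theta>. f \<theta> \<partial>(\<Xi> \<bind> hidden_kernel s \<theta>' k) \<partial>\<kappa>)"
      by (rule prob_algebra_integral_bind[OF \<kappa>_space kern f B])
    also have "\<dots> = (\<integral>k. ?I k \<partial>\<kappa>)"
      by (simp only: prob_algebra_integral_bind[OF \<Xi> H f B])
    also have "\<dots> = (\<Sum>k\<in>UNIV. rate p c k / \<Lambda> * ?I k)"
      unfolding \<kappa>_def using rate \<Lambda> by (subst lebesgue_integral_point_measure_finite) auto
    finally have eq: "\<Lambda> * (\<integral>\<theta>. f \<theta> \<partial>\<Xi>) = (\<Sum>k\<in>UNIV. rate p c k * ?I k)"
      using \<Lambda> by (simp add: sum_distrib_left)
    have int: "integrable \<Xi> (\<lambda>\<theta>. \<integral>y. f y \<partial>hidden_kernel s \<theta>' k \<theta>)" for k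
      by (rule prob_algebra_bounded_integral(1)[OF \<Xi> prob_algebra_integral_measurable[OF H f]])
         (rule prob_algebra_bounded_integral(2)[OF measurable_space[OF H] f B])
    have "(\<integral>\<theta>. jump_op (rate p c) (hidden_kernel s \<theta>') f \<theta> \<partial>\<Xi>) = (\<Sum>k\<in>UNIV. rate p c k * ?I k)"
      unfolding jump_op_def using int by simp
    then show "(\<integral>\<theta>. jump_op (rate p c) (hidden_kernel s \<theta>') f \<theta> \<partial>\<Xi>) = sum (rate p c) UNIV * (\<integral>\<theta>. f \<theta> \<partial>\<Xi>)"
      using eq by (simp add: \<Lambda>_def)
  qed
qed

section \<open>Intertwining, ergodicity and reversibility of the semigroups\<close>

lemma rate_nonneg: "(\<And>i j. p i j \<ge> 0) \<Longrightarrow> (\<And>i. c i \<ge> 0) \<Longrightarrow> rate p c k \<ge> 0"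
  by (cases k) (auto split: prod.split)

text \<open>Diagonal moves must be excluded: as defined, \<open>Inl (i, i)\<close> multiplies the
  energy by \<open>2 * (1 - u)\<close> but leaves the parameter unchanged. They have rate 0.\<close>

lemma kmp_hidden_intertwining:
  assumes s: "s > 0" and \<theta>': "\<And>i. \<theta>' i > 0" and \<theta>: "\<And>i. \<theta> i > 0" and k: "\<And>i. k \<noteq> Inl (i, i)"
  shows "\<nu>_prod s \<theta> \<bind> kmp_kernel s \<theta>' k = hidden_kernel s \<theta>' k \<theta> \<bind> \<nu>_prod s"
proof -
  have \<theta>c: "\<theta> \<in> space config" using \<theta> by (simp add: less_imp_le)
  have \<nu>: "\<nu>_prod s \<theta> \<in> space (prob_algebra config)"
    by (rule \<nu>_prod_space[OF s]) (use \<theta> in \<open>simp add: less_imp_le\<close>)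
  have J: "kmp_kernel s \<theta>' k \<in> config \<rightarrow>\<^sub>M prob_algebra config" and H: "hidden_kernel s \<theta>' k \<in> config \<rightarrow>\<^sub>M prob_algebra config"
    by (rule measurable_kmp_kernel[OF s \<theta>'] measurable_hidden_kernel[OF s \<theta>'])+
  note H\<theta> = measurable_space[OF H \<theta>c]
  note K = measurable_\<nu>_prod[OF s]
  show ?thesis
  proof (rule measure_eqI)
    show "sets (\<nu>_prod s \<theta> \<bind> kmp_kernel s \<theta>' k) = sets (hidden_kernel s \<theta>' k \<theta> \<bind> \<nu>_prod s)"
      using sets_bind'[OF \<nu> J] sets_bind'[OF H\<theta> K] by simp
    fix A assume "A \<in> sets (\<nu>_prod s \<theta> \<bind> kmp_kernel s \<theta>' k)"
    then have A: "A \<in> sets config" using sets_bind'[OF \<nu> J] by simp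
    let ?f = "indicator A :: _ \<Rightarrow> ennreal"
    have f: "?f \<in> borel_measurable config" using A by simp
    have Kf: "(\<lambda>\<eta>. \<integral>\<^sup>+\<zeta>. ?f \<zeta> \<partial>\<nu>_prod s \<eta>) \<in> borel_measurable config"
      by (rule measurable_compose[OF measurable_prob_algebraD[OF K] nn_integral_measurable_subprob_algebra[OF f]])
    have "(\<integral>\<^sup>+\<zeta>. \<integral>\<^sup>+x. ?f x \<partial>kmp_kernel s \<theta>' k \<zeta> \<partial>\<nu>_prod s \<theta>) =
       (\<integral>\<^sup>+u. \<integral>\<^sup>+\<zeta>. ?f \<zeta> \<partial>\<nu>_prod s (hidden_map \<theta>' k \<theta> u) \<partial>beta_distr s)"
    proof (cases k)
      case (Inl q)
      obtain i j where "q = (i, j)" by (cases q)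
      moreover have "i \<noteq> j" using k[of i] Inl calculation by auto
      ultimately show ?thesis
        using kmp_hidden_intertwining_bulk[OF s \<theta>' \<theta> f] Inl by simp
    next
      case (Inr i)
      then show ?thesis
        using kmp_hidden_intertwining_site[OF s \<theta>' \<theta> f] by simp
    qed
    also have "\<dots> = (\<integral>\<^sup>+\<eta>. \<integral>\<^sup>+\<zeta>. ?f \<zeta> \<partial>\<nu>_prod s \<eta> \<partial>hidden_kernel s \<theta>' k \<theta>)"
      by (rule nn_integral_hidden_kernel[symmetric]) (use \<theta>' \<theta>c Kf in auto)
    finally show "emeasure (\<nu>_prod s \<theta> \<bind> kmp_kernel s \<theta>' k) A = emeasure (hidden_kernel s \<theta>' k \<theta> \<bind> \<nu>_prod s) A"
      unfolding emeasure_bind_prob_algebra[OF \<nu> J A] emeasure_bind_prob_algebra[OF H\<theta> K A]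
      using A by (simp add: kmp_kernel_def)
  qed
qed

text \<open>Started from a positive configuration, a hidden move ends in one. Identities known for
  positive parameters alone can therefore be used under the kernel.\<close>

lemma integral_hidden_kernel_cong:
  fixes g h :: "('v::finite \<Rightarrow> real) \<Rightarrow> real"
  assumes \<theta>': "\<And>i. \<theta>' i > 0" and \<theta>: "\<And>i. \<theta> i > 0"
    and g: "g \<in> borel_measurable config" and h: "h \<in> borel_measurable config"
    and eq: "\<And>\<eta>. (\<And>i. \<eta> i > 0) \<Longrightarrow> g \<eta> = h \<eta>"
  shows "(\<integral>\<eta>. g \<eta> \<partial>hidden_kernel s \<theta>' k \<theta>) = (\<integral>\<eta>. h \<eta> \<partial>hidden_kernel s \<theta>' k \<theta>)"
proof -
  have "\<theta> \<in> space config" using \<theta> by (simp add: less_imp_le)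
  with \<theta>' have m: "hidden_map \<theta>' k \<theta> \<in> beta_distr s \<rightarrow>\<^sub>M config"
    by (intro hidden_map_measurable_noise)
  show ?thesis
    unfolding hidden_kernel_def integral_distr[OF m g] integral_distr[OF m h]
  proof (rule Bochner_Integration.integral_cong[OF refl])
    fix u assume "u \<in> space (beta_distr s)"
    then have "hidden_map \<theta>' k \<theta> u i > 0" for i
      by (intro hidden_map_pos \<theta>' \<theta>) simp
    then show "g (hidden_map \<theta>' k \<theta> u) = h (hidden_map \<theta>' k \<theta> u)" by (rule eq)
  qed
qed

lemma jump_op_intertwining:
  fixes f :: "('v::finite \<Rightarrow> real) \<Rightarrow> real"
  assumes s: "s > 0" and \<theta>': "\<And>i. \<theta>' i > 0" and \<theta>: "\<And>i. \<theta> i > 0"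
    and f: "f \<in> borel_measurable config" and B: "\<And>x. x \<in> space config \<Longrightarrow> \<bar>f x\<bar> \<le> B"
  shows "(\<integral>\<zeta>. jump_op (rate p c) (kmp_kernel s \<theta>') f \<zeta> \<partial>\<nu>_prod s \<theta>) =
    jump_op (rate p c) (hidden_kernel s \<theta>') (\<lambda>\<eta>. \<integral>\<zeta>. f \<zeta> \<partial>\<nu>_prod s \<eta>) \<theta>"
proof -
  have \<theta>c: "\<theta> \<in> space config" using \<theta> by (simp add: less_imp_le)
  have \<nu>: "\<nu>_prod s \<theta> \<in> space (prob_algebra config)"
    by (rule \<nu>_prod_space[OF s]) (use \<theta> in \<open>simp add: less_imp_le\<close>)
  have J: "kmp_kernel s \<theta>' k \<in> config \<rightarrow>\<^sub>M prob_algebra config" and H: "hidden_kernel s \<theta>' k \<in> config \<rightarrow>\<^sub>M prob_algebra config" for k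
    by (rule measurable_kmp_kernel[OF s \<theta>'] measurable_hidden_kernel[OF s \<theta>'])+
  have int: "integrable (\<nu>_prod s \<theta>) (\<lambda>\<zeta>. \<integral>y. f y \<partial>kmp_kernel s \<theta>' k \<zeta>)" for k
    by (rule prob_algebra_bounded_integral(1)[OF \<nu> prob_algebra_integral_measurable[OF J f]])
       (rule prob_algebra_bounded_integral(2)[OF measurable_space[OF J] f B])
  \<comment> \<open>Keeping the factor \<open>rate p c k\<close> makes the equation trivial for the
    diagonal moves, whose kernels do not intertwine.\<close>
  have "rate p c k * (\<integral>\<zeta>. \<integral>y. f y \<partial>kmp_kernel s \<theta>' k \<zeta> \<partial>\<nu>_prod s \<theta>) =
     rate p c k * (\<integral>\<eta>. \<integral>\<zeta>. f \<zeta> \<partial>\<nu>_prod s \<eta> \<partial>hidden_kernel s \<theta>' k \<theta>)" for k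
  proof (cases "\<exists>i. k = Inl (i, i)")
    case False
    then have "\<nu>_prod s \<theta> \<bind> kmp_kernel s \<theta>' k = hidden_kernel s \<theta>' k \<theta> \<bind> \<nu>_prod s"
      by (intro kmp_hidden_intertwining s \<theta>' \<theta>) auto
    then show ?thesis
      using prob_algebra_integral_bind[OF \<nu> J[of k] f B]
        prob_algebra_integral_bind[OF measurable_space[OF H[of k] \<theta>c] measurable_\<nu>_prod[OF s] f B] by simp
  qed auto
  note eq = this
  show ?thesis
    unfolding jump_op_def eq[symmetric] using int by simp
qed

text \<open>The induction runs over all positive \<theta> at once, because the hypothesis is needed
  at the configurations reached by one hidden move.\<close>

lemma jump_op_iterates_intertwining:
  fixes f :: "('v::finite \<Rightarrow> real) \<Rightarrow> real"
  assumes s: "s > 0" and \<theta>': "\<And>i. \<theta>' i > 0" and \<theta>: "\<And>i. \<theta> i > 0"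
    and P: "bounded_generator config P (jump_op (rate p c) (kmp_kernel s \<theta>')) \<Lambda>"
    and Q: "bounded_generator config Q (jump_op (rate p c) (hidden_kernel s \<theta>')) \<Lambda>"
    and f: "f \<in> borel_measurable config" and B: "\<And>x. x \<in> space config \<Longrightarrow> \<bar>f x\<bar> \<le> B"
  shows "(\<integral>\<zeta>. (jump_op (rate p c) (kmp_kernel s \<theta>') ^^ n) f \<zeta> \<partial>\<nu>_prod s \<theta>) =
    (jump_op (rate p c) (hidden_kernel s \<theta>') ^^ n) (\<lambda>\<eta>. \<integral>\<zeta>. f \<zeta> \<partial>\<nu>_prod s \<eta>) \<theta>"
  using \<theta>
proof (induction n arbitrary: \<theta>)
  case (Suc n)
  let ?N = "jump_op (rate p c) (kmp_kernel s \<theta>')" and ?M = "jump_op (rate p c) (hidden_kernel s \<theta>')"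
  let ?K = "\<lambda>f \<eta>. \<integral>\<zeta>. f \<zeta> \<partial>\<nu>_prod s \<eta>"
  note K = measurable_\<nu>_prod[OF s]
  have Kf: "?K f \<in> borel_measurable config" "\<And>x. x \<in> space config \<Longrightarrow> \<bar>?K f x\<bar> \<le> B"
    by (rule prob_algebra_integral_measurable[OF K f])
       (rule prob_algebra_bounded_integral(2)[OF measurable_space[OF K] f B])
  have Nf: "(?N ^^ n) f \<in> borel_measurable config" "\<And>x. x \<in> space config \<Longrightarrow> \<bar>(?N ^^ n) f x\<bar> \<le> \<Lambda> ^ n * B"
    using bounded_generator.jump_iterates[OF P f B] by auto
  have MKf: "(?M ^^ n) (?K f) \<in> borel_measurable config"
    using bounded_generator.jump_iterates[OF Q Kf] by blast
  have "(\<integral>\<zeta>. ?N ((?N ^^ n) f) \<zeta> \<partial>\<nu>_prod s \<theta>) = ?M (?K ((?N ^^ n) f)) \<theta>"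
    by (rule jump_op_intertwining[OF s \<theta>' Suc.prems Nf])
  also have "\<dots> = ?M ((?M ^^ n) (?K f)) \<theta>"
    unfolding jump_op_def[of _ "hidden_kernel s \<theta>'" "?K ((?N ^^ n) f)"]
      jump_op_def[of _ "hidden_kernel s \<theta>'" "(?M ^^ n) (?K f)"]
  proof (intro sum.cong refl arg_cong2[where f="(*)"] integral_hidden_kernel_cong \<theta>' Suc.prems MKf)
    show "?K ((?N ^^ n) f) \<in> borel_measurable config"
      by (rule prob_algebra_integral_measurable[OF K Nf(1)])
  qed (rule Suc.IH)
  finally show ?case by simp
qed simp

lemma duality_semigroup:
  fixes \<theta> :: "'v::finite \<Rightarrow> real"
  assumes s: "s > 0" and \<theta>': "\<And>i. \<theta>' i > 0" and \<theta>: "\<And>i. \<theta> i > 0"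
    and P: "bounded_generator config P (jump_op (rate p c) (kmp_kernel s \<theta>')) \<Lambda>"
    and Q: "bounded_generator config Q (jump_op (rate p c) (hidden_kernel s \<theta>')) \<Lambda>"
    and t: "t \<ge> 0"
  shows "\<nu>_prod s \<theta> \<bind> P t = Q t \<theta> \<bind> \<nu>_prod s"
proof -
  interpret P: bounded_generator config P "jump_op (rate p c) (kmp_kernel s \<theta>')" \<Lambda> by fact
  interpret Q: bounded_generator config Q "jump_op (rate p c) (hidden_kernel s \<theta>')" \<Lambda> by fact
  have \<theta>c: "\<theta> \<in> space config" using \<theta> by (simp add: less_imp_le)
  have \<nu>: "\<nu>_prod s \<theta> \<in> space (prob_algebra config)"
    by (rule \<nu>_prod_space[OF s]) (use \<theta> in \<open>simp add: less_imp_le\<close>)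
  note K = measurable_\<nu>_prod[OF s]
  note Q\<theta> = Q.kernel_space[OF t \<theta>c]
  show ?thesis
  proof (rule prob_algebra_eqI[OF P.bind_semigroup_space[OF \<nu> t]])
    show "Q t \<theta> \<bind> \<nu>_prod s \<in> space (prob_algebra config)"
      using prob_space_bind'[OF Q\<theta> K] sets_bind'[OF Q\<theta> K] by (simp add: space_prob_algebra)
    fix f :: "('v \<Rightarrow> real) \<Rightarrow> real" assume f: "f \<in> borel_measurable config" and B: "\<And>x. x \<in> space config \<Longrightarrow> \<bar>f x\<bar> \<le> 1"
    let ?K = "\<lambda>\<eta>. \<integral>\<zeta>. f \<zeta> \<partial>\<nu>_prod s \<eta>"
    have Kf: "?K \<in> borel_measurable config" "\<And>x. x \<in> space config \<Longrightarrow> \<bar>?K x\<bar> \<le> 1"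
      by (rule prob_algebra_integral_measurable[OF K f])
         (rule prob_algebra_bounded_integral(2)[OF measurable_space[OF K] f B])
    have it: "(\<integral>\<zeta>. (jump_op (rate p c) (kmp_kernel s \<theta>') ^^ j) f \<zeta> \<partial>\<nu>_prod s \<theta>) =
        (jump_op (rate p c) (hidden_kernel s \<theta>') ^^ j) ?K \<theta>" for j
      by (rule jump_op_iterates_intertwining[OF s \<theta>' \<theta> P Q f B])
    have "(\<lambda>j. t ^ j / fact j * (jump_op (rate p c) (hidden_kernel s \<theta>') ^^ j) ?K \<theta>) sums
        (exp (\<Lambda> * t) * (\<integral>x. \<integral>y. f y \<partial>P t x \<partial>\<nu>_prod s \<theta>))"
      using P.taylor_series_integrated[OF \<nu> f B, of "\<lambda>_. 1" 1 t] t
      by (simp add: it)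
    from sums_unique2[OF this Q.taylor_series_pointwise[OF Kf \<theta>c t]]
    have "(\<integral>x. \<integral>y. f y \<partial>P t x \<partial>\<nu>_prod s \<theta>) = (\<integral>y. ?K y \<partial>Q t \<theta>)" by simp
    moreover have "(\<integral>x. f x \<partial>(\<nu>_prod s \<theta> \<bind> P t)) = (\<integral>x. \<integral>y. f y \<partial>P t x \<partial>\<nu>_prod s \<theta>)"
      by (rule prob_algebra_integral_bind[OF \<nu> P.kernel[OF t] f B])
    moreover have "(\<integral>x. f x \<partial>(Q t \<theta> \<bind> \<nu>_prod s)) = (\<integral>y. ?K y \<partial>Q t \<theta>)"
      by (rule prob_algebra_integral_bind[OF Q\<theta> K f B])
    ultimately show "(\<integral>x. f x \<partial>(\<nu>_prod s \<theta> \<bind> P t)) = (\<integral>x. f x \<partial>(Q t \<theta> \<bind> \<nu>_prod s))"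
      by (simp only:)
  qed
qed

section \<open>Exponential loss of memory\<close>

text \<open>One application of the jump operator replaces the weight vector by the rate-weighted sum
  of its averages, which the drift condition bounds by \<open>q\<close> times the old vector. Each
  iteration therefore costs a factor \<open>q\<close>.\<close>

lemma jump_op_iterates_lipschitz:
  fixes f :: "('v::finite \<Rightarrow> real) \<Rightarrow> real"
  assumes P: "bounded_generator config P (jump_op (rate p c) J) \<Lambda>"
    and rate: "\<And>k. rate p c k \<ge> 0"
    and J: "\<And>k f B v x y. f \<in> borel_measurable config \<Longrightarrow> (\<And>x. x \<in> space config \<Longrightarrow> \<bar>f x\<bar> \<le> B) \<Longrightarrow>
       (\<And>l. v l \<ge> 0) \<Longrightarrow> (\<And>x y. x \<in> space config \<Longrightarrow> y \<in> space config \<Longrightarrow> \<bar>f x - f y\<bar> \<le> weighted_dist v x y) \<Longrightarrow>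
       x \<in> space config \<Longrightarrow> y \<in> space config \<Longrightarrow> (\<And>i. k \<noteq> Inl (i, i)) \<Longrightarrow>
       \<bar>(\<integral>z. f z \<partial>J k x) - (\<integral>z. f z \<partial>J k y)\<bar> \<le> weighted_dist (averaged_weight k v) x y"
    and w: "\<And>l. w l > 0" and q: "q \<ge> 0"
    and drift: "\<And>l. (\<Sum>k\<in>UNIV. rate p c k * averaged_weight k w l) \<le> q * w l"
    and f: "f \<in> borel_measurable config" and B: "\<And>x. x \<in> space config \<Longrightarrow> \<bar>f x\<bar> \<le> B"
    and C: "C \<ge> 0" and lip: "\<And>x y. x \<in> space config \<Longrightarrow> y \<in> space config \<Longrightarrow> \<bar>f x - f y\<bar> \<le> C * weighted_dist w x y"
    and xy: "x \<in> space config" "y \<in> space config"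
  shows "\<bar>(jump_op (rate p c) J ^^ n) f x - (jump_op (rate p c) J ^^ n) f y\<bar> \<le> (C * weighted_dist w x y) * q ^ n"
  using xy
proof (induction n arbitrary: x y)
  case 0
  then show ?case using lip by simp
next
  case (Suc n)
  let ?N = "jump_op (rate p c) J"
  define g where "g = (?N ^^ n) f"
  \<comment> \<open>The Lipschitz weights of the \<open>n\<close>-th iterate; averaging is linear in
    the weights, so the scalar \<open>C * q ^ n\<close> passes through.\<close>
  define v where "v l = C * q ^ n * w l" for l
  have g: "g \<in> borel_measurable config" "\<And>x. x \<in> space config \<Longrightarrow> \<bar>g x\<bar> \<le> \<Lambda> ^ n * B"
    using bounded_generator.jump_iterates[OF P f B] by (auto simp: g_def)
  have v: "v l \<ge> 0" for l using C q w[of l] by (simp add: v_def)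
  have gv: "\<bar>g x - g y\<bar> \<le> weighted_dist v x y" if "x \<in> space config" "y \<in> space config" for x y
    using Suc.IH[OF that] by (simp add: g_def v_def weighted_dist_def sum_distrib_left mult_ac)
  have avg: "averaged_weight k v l = C * q ^ n * averaged_weight k w l" for k l
    by (cases k) (auto simp: v_def algebra_simps add_divide_distrib split: prod.split)
  have bnd: "\<bar>rate p c k * ((\<integral>z. g z \<partial>J k x) - (\<integral>z. g z \<partial>J k y))\<bar> \<le> rate p c k * weighted_dist (averaged_weight k v) x y" for k
  proof (cases "\<exists>i. k = Inl (i, i)")
    case False
    then have "\<bar>(\<integral>z. g z \<partial>J k x) - (\<integral>z. g z \<partial>J k y)\<bar> \<le> weighted_dist (averaged_weight k v) x y"
      by (intro J[OF g v gv Suc.prems]) auto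
    then show ?thesis using rate[of k] by (simp add: abs_mult mult_left_mono)
  qed auto
  have "\<bar>?N g x - ?N g y\<bar> = \<bar>\<Sum>k\<in>UNIV. rate p c k * ((\<integral>z. g z \<partial>J k x) - (\<integral>z. g z \<partial>J k y))\<bar>"
    by (simp add: jump_op_def sum_subtractf[symmetric] right_diff_distrib)
  also have "\<dots> \<le> (\<Sum>k\<in>UNIV. rate p c k * weighted_dist (averaged_weight k v) x y)"
    by (rule order_trans[OF sum_abs sum_mono[OF bnd]])
  also have "\<dots> = (\<Sum>l\<in>UNIV. (\<Sum>k\<in>UNIV. rate p c k * averaged_weight k v l) * \<bar>x l - y l\<bar>)"
    unfolding weighted_dist_def sum_distrib_left sum_distrib_right by (subst sum.swap) (simp add: mult_ac)
  also have "\<dots> \<le> (\<Sum>l\<in>UNIV. (C * q ^ n * (q * w l)) * \<bar>x l - y l\<bar>)"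
  proof (intro sum_mono mult_right_mono)
    fix l
    have "(\<Sum>k\<in>UNIV. rate p c k * averaged_weight k v l) = C * q ^ n * (\<Sum>k\<in>UNIV. rate p c k * averaged_weight k w l)"
      by (simp add: avg sum_distrib_left mult_ac)
    also have "\<dots> \<le> C * q ^ n * (q * w l)"
      using C q by (intro mult_left_mono drift) simp
    finally show "(\<Sum>k\<in>UNIV. rate p c k * averaged_weight k v l) \<le> C * q ^ n * (q * w l)" .
  qed simp
  also have "\<dots> = (C * weighted_dist w x y) * q ^ Suc n"
    by (simp add: weighted_dist_def sum_distrib_left sum_distrib_right mult_ac)
  finally show ?case by (simp add: g_def)
qed

lemma config_lipschitz_weighted:
  fixes w :: "'v::finite \<Rightarrow> real"
  assumes w: "\<And>l. w l > 0" and f: "config_lipschitz L f"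
  shows "\<exists>C\<ge>0. \<forall>x\<in>space config. \<forall>y\<in>space config. \<bar>f x - f y\<bar> \<le> C * weighted_dist w x y"
proof -
  define m where "m = Min (range w)"
  have "m \<in> range w" unfolding m_def by (rule Min_in) auto
  then have m: "m > 0" using w by auto
  have le: "m \<le> w l" for l unfolding m_def by (rule Min_le) auto
  define C where "C = \<bar>L\<bar> / m"
  have "L \<le> C * w l" for l
  proof -
    have "L \<le> C * m" using m by (simp add: C_def)
    also have "\<dots> \<le> C * w l" using m le by (intro mult_left_mono) (auto simp: C_def)
    finally show ?thesis .
  qed
  then have "L * l1_dist x y \<le> C * weighted_dist w x y" for x y
    unfolding l1_dist_def weighted_dist_def sum_distrib_left
    by (intro sum_mono) (simp add: mult.assoc[symmetric] mult_right_mono)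
  moreover have "C \<ge> 0" using m by (simp add: C_def)
  ultimately show ?thesis
    using f unfolding config_lipschitz_def by (meson order_trans)
qed

text \<open>The prefactor \<open>R x y\<close> may be unbounded and need not be integrable, so the
  decay is not uniform over initial laws. Pointwise decay together with the bound on
  \<open>f\<close> suffices for dominated convergence, first in \<open>y\<close> under \<pi> and
  then in \<open>x\<close> under \<mu>.\<close>

lemma (in bounded_generator) semigroup_forgets_initial_law:
  assumes f: "f \<in> borel_measurable X" and B: "\<And>x. x \<in> space X \<Longrightarrow> \<bar>f x\<bar> \<le> B"
    and \<delta>: "\<delta> > 0"
    and decay: "\<And>x y t. x \<in> space X \<Longrightarrow> y \<in> space X \<Longrightarrow> t \<ge> 0 \<Longrightarrow>
       \<bar>(\<integral>z. f z \<partial>P t x) - (\<integral>z. f z \<partial>P t y)\<bar> \<le> R x y * exp (- \<delta> * t)"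
    and \<mu>: "\<mu> \<in> space (prob_algebra X)" and \<pi>: "\<pi> \<in> space (prob_algebra X)"
  shows "((\<lambda>t. (\<integral>x. f x \<partial>(\<mu> \<bind> P t)) - (\<integral>x. f x \<partial>(\<pi> \<bind> P t))) \<longlongrightarrow> 0) at_top"
proof -
  \<comment> \<open>Time is truncated at 0 so that measurability and bounds hold for every real
    \<open>t\<close>, as dominated convergence along \<open>at_top\<close> demands.\<close>
  define F where "F t x = (\<integral>y. f y \<partial>P (max 0 t) x)" for t x
  have F: "F t \<in> borel_measurable X" for t
    unfolding F_def by (rule prob_algebra_integral_measurable[OF kernel f]) simp
  have FB: "\<bar>F t x\<bar> \<le> B" if "x \<in> space X" for t x
    unfolding F_def by (rule prob_algebra_bounded_integral(2)[OF kernel_space f B]) (use that in auto)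
  have prob: "prob_space \<mu>" "prob_space \<pi>" and sets: "sets \<mu> = sets X" "sets \<pi> = sets X"
    using \<mu> \<pi> by (auto simp: space_prob_algebra)
  have sp: "space \<mu> = space X" "space \<pi> = space X"
    using sets by (auto dest: sets_eq_imp_space_eq)
  interpret M: prob_space \<mu> by fact
  interpret P': prob_space \<pi> by fact
  have lim: "((\<lambda>t. F t x - F t y) \<longlongrightarrow> 0) at_top" if "x \<in> space X" "y \<in> space X" for x y
  proof (rule Lim_null_comparison)
    show "\<forall>\<^sub>F t in at_top. norm (F t x - F t y) \<le> R x y * exp (- \<delta> * t)"
      using eventually_ge_at_top[of 0]
      by eventually_elim (use decay[OF that] in \<open>simp add: F_def max_def\<close>)
    have "((\<lambda>t. exp (- \<delta> * t)) \<longlongrightarrow> 0) at_top"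
      using \<delta> by real_asymp
    then show "((\<lambda>t. R x y * exp (- \<delta> * t)) \<longlongrightarrow> 0) at_top"
      by (rule tendsto_mult_right_zero)
  qed
  have int\<pi>: "integrable \<pi> (F t)" and int\<mu>: "integrable \<mu> (F t)" for t
    using prob_algebra_bounded_integral(1)[OF \<pi> F FB] prob_algebra_bounded_integral(1)[OF \<mu> F FB] by auto
  have lim\<pi>: "((\<lambda>t. F t x - (\<integral>y. F t y \<partial>\<pi>)) \<longlongrightarrow> 0) at_top" if x: "x \<in> space X" for x
  proof -
    have "((\<lambda>t. \<integral>y. F t x - F t y \<partial>\<pi>) \<longlongrightarrow> (\<integral>y. 0 \<partial>\<pi>)) at_top"
    proof (rule integral_dominated_convergence_at_top[where w="\<lambda>_. 2 * B"])
      show "(\<lambda>y. F t x - F t y) \<in> borel_measurable \<pi>" for t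
        using F measurable_cong_sets[OF sets(2) refl] by (intro borel_measurable_diff borel_measurable_const) blast
      show "\<forall>\<^sub>F t in at_top. AE y in \<pi>. norm (F t x - F t y) \<le> 2 * B"
      proof (rule always_eventually, rule allI, rule AE_I2)
        fix t y assume "y \<in> space \<pi>"
        then show "norm (F t x - F t y) \<le> 2 * B"
          using FB[OF x, of t] FB[of y t] sp by (simp add: abs_le_iff)
      qed
      show "AE y in \<pi>. ((\<lambda>t. F t x - F t y) \<longlongrightarrow> 0) at_top"
        using lim[OF x] sp by (intro AE_I2) simp
    qed auto
    then show ?thesis using int\<pi> by (simp add: P'.prob_space)
  qed
  have "((\<lambda>t. \<integral>x. F t x - (\<integral>y. F t y \<partial>\<pi>) \<partial>\<mu>) \<longlongrightarrow> (\<integral>x. 0 \<partial>\<mu>)) at_top"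
  proof (rule integral_dominated_convergence_at_top[where w="\<lambda>_. 2 * B"])
    show "(\<lambda>x. F t x - (\<integral>y. F t y \<partial>\<pi>)) \<in> borel_measurable \<mu>" for t
      using F measurable_cong_sets[OF sets(1) refl] by (intro borel_measurable_diff borel_measurable_const) blast
    show "\<forall>\<^sub>F t in at_top. AE x in \<mu>. norm (F t x - (\<integral>y. F t y \<partial>\<pi>)) \<le> 2 * B"
    proof (rule always_eventually, rule allI, rule AE_I2)
      fix t x assume "x \<in> space \<mu>"
      then show "norm (F t x - (\<integral>y. F t y \<partial>\<pi>)) \<le> 2 * B"
        using FB[of x t] prob_algebra_bounded_integral(2)[OF \<pi> F FB, of t] sp by (simp add: abs_le_iff)
    qed
    show "AE x in \<mu>. ((\<lambda>t. F t x - (\<integral>y. F t y \<partial>\<pi>)) \<longlongrightarrow> 0) at_top"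
      using lim\<pi> sp by (intro AE_I2) simp
  qed auto
  then have "((\<lambda>t. (\<integral>x. F t x \<partial>\<mu>) - (\<integral>y. F t y \<partial>\<pi>)) \<longlongrightarrow> 0) at_top"
    using int\<mu> by (simp add: M.prob_space)
  then show ?thesis
  proof (rule Lim_transform_eventually)
    show "\<forall>\<^sub>F t in at_top. (\<integral>x. F t x \<partial>\<mu>) - (\<integral>y. F t y \<partial>\<pi>) = (\<integral>x. f x \<partial>(\<mu> \<bind> P t)) - (\<integral>x. f x \<partial>(\<pi> \<bind> P t))"
      using eventually_ge_at_top[of 0]
      by eventually_elim
        (simp add: F_def max_def prob_algebra_integral_bind[OF \<mu> kernel f B] prob_algebra_integral_bind[OF \<pi> kernel f B])
  qed
qed

text \<open>The law started from \<pi> stays at \<pi>, so forgetting the initial law means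
  convergence to \<pi>. A second stationary law is constant in time and converges to \<pi> as well,
  hence agrees with it on Lipschitz functions.\<close>

lemma stationary_unique_and_attracting:
  fixes P :: "real \<Rightarrow> ('v::finite \<Rightarrow> real) \<Rightarrow> ('v \<Rightarrow> real) measure"
  assumes P: "bounded_generator config P N \<Lambda>" and \<delta>: "\<delta> > 0"
    and decay: "\<And>f L B. config_lipschitz L f \<Longrightarrow> (\<And>x. x \<in> space config \<Longrightarrow> \<bar>f x\<bar> \<le> B) \<Longrightarrow>
       \<exists>R. \<forall>x\<in>space config. \<forall>y\<in>space config. \<forall>t\<ge>0.
         \<bar>(\<integral>z. f z \<partial>P t x) - (\<integral>z. f z \<partial>P t y)\<bar> \<le> R x y * exp (- \<delta> * t)"
    and \<pi>: "stationary config P \<pi>"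
  shows "unique_stationary config P \<pi> \<and> converges_to config P \<pi>"
proof -
  interpret bounded_generator config P N \<Lambda> by fact
  have \<pi>_prob: "\<pi> \<in> space (prob_algebra config)" and \<pi>_inv: "\<And>t. t \<ge> 0 \<Longrightarrow> \<pi> \<bind> P t = \<pi>"
    using \<pi> by (auto simp: stationary_def)
  have conv: "((\<lambda>t. \<integral>x. f x \<partial>(\<mu> \<bind> P t)) \<longlongrightarrow> (\<integral>x. f x \<partial>\<pi>)) at_top"
    if lip: "config_lipschitz L f" and B: "\<And>x. x \<in> space config \<Longrightarrow> \<bar>f x\<bar> \<le> B"
      and \<mu>: "\<mu> \<in> space (prob_algebra config)" for f L B \<mu>
  proof -
    have f: "f \<in> borel_measurable config"
      by (rule continuous_on_config_measurable[OF config_lipschitz_continuous[OF lip]])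
    obtain R where R: "\<And>x y t. x \<in> space config \<Longrightarrow> y \<in> space config \<Longrightarrow> t \<ge> 0 \<Longrightarrow>
         \<bar>(\<integral>z. f z \<partial>P t x) - (\<integral>z. f z \<partial>P t y)\<bar> \<le> R x y * exp (- \<delta> * t)"
      using decay[OF lip B] by blast
    have "((\<lambda>t. (\<integral>x. f x \<partial>(\<mu> \<bind> P t)) - (\<integral>x. f x \<partial>(\<pi> \<bind> P t))) \<longlongrightarrow> 0) at_top"
      by (rule semigroup_forgets_initial_law[OF f B \<delta> R \<mu> \<pi>_prob])
    then have "((\<lambda>t. (\<integral>x. f x \<partial>(\<mu> \<bind> P t)) - (\<integral>x. f x \<partial>\<pi>)) \<longlongrightarrow> 0) at_top"
    proof (rule Lim_transform_eventually)
      show "\<forall>\<^sub>F t in at_top. (\<integral>x. f x \<partial>(\<mu> \<bind> P t)) - (\<integral>x. f x \<partial>(\<pi> \<bind> P t)) = (\<integral>x. f x \<partial>(\<mu> \<bind> P t)) - (\<integral>x. f x \<partial>\<pi>)"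
        using eventually_ge_at_top[of "0::real"] by eventually_elim (simp add: \<pi>_inv)
    qed
    then show ?thesis by (rule LIM_zero_cancel)
  qed
  have "converges_to config P \<pi>"
    unfolding converges_to_def
  proof
    fix \<mu> :: "('v \<Rightarrow> real) measure" assume \<mu>: "\<mu> \<in> space (prob_algebra config)"
    show "weakly_converges config (\<lambda>t. \<mu> \<bind> P t) \<pi>"
    proof (rule weakly_converges_lipschitz[OF \<pi>_prob])
      show "\<forall>\<^sub>F t in at_top. \<mu> \<bind> P t \<in> space (prob_algebra config)"
        using eventually_ge_at_top[of "0::real"] by eventually_elim (rule bind_semigroup_space[OF \<mu>])
    qed (rule conv[OF _ _ \<mu>])
  qed
  moreover have "\<mu> = \<pi>" if \<mu>: "stationary config P \<mu>" for \<mu>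
  proof (rule prob_algebra_config_eqI)
    show \<mu>_prob: "\<mu> \<in> space (prob_algebra config)" using \<mu> by (simp add: stationary_def)
    show "\<pi> \<in> space (prob_algebra config)" by fact
    fix g :: "('v \<Rightarrow> real) \<Rightarrow> real" and L B assume g: "config_lipschitz L g" "\<And>x. x \<in> space config \<Longrightarrow> \<bar>g x\<bar> \<le> B"
    have "((\<lambda>t. \<integral>x. g x \<partial>\<mu>) \<longlongrightarrow> (\<integral>x. g x \<partial>\<pi>)) (at_top :: real filter)"
    proof (rule Lim_transform_eventually)
      show "((\<lambda>t. \<integral>x. g x \<partial>(\<mu> \<bind> P t)) \<longlongrightarrow> (\<integral>x. g x \<partial>\<pi>)) at_top"
        by (rule conv[OF g \<mu>_prob])
      show "\<forall>\<^sub>F t in at_top. (\<integral>x. g x \<partial>(\<mu> \<bind> P t)) = (\<integral>x. g x \<partial>\<mu>)"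
        using eventually_ge_at_top[of "0::real"] by eventually_elim (use \<mu> in \<open>simp add: stationary_def\<close>)
    qed
    then show "(\<integral>x. g x \<partial>\<mu>) = (\<integral>x. g x \<partial>\<pi>)"
      by (simp add: tendsto_const_iff)
  qed
  ultimately show ?thesis using \<pi> unfolding unique_stationary_def by blast
qed

section \<open>Reversibility of the semigroup\<close>

text \<open>Passes from the symmetry of single moves, stated for nonnegative extended integrals as
  the Gamma computations deliver it, to a symmetry of real integrals. Moves of rate 0 are exempt,
  since no symmetry is available for the diagonal ones.\<close>

lemma jump_op_reversible:
  fixes f g :: "'a \<Rightarrow> real"
  assumes J: "\<And>k. J k \<in> X \<rightarrow>\<^sub>M prob_algebra X" and r: "\<And>k. r k \<ge> 0"
    and \<mu>: "\<mu> \<in> space (prob_algebra X)"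
    and rev: "\<And>k f g. r k \<noteq> 0 \<Longrightarrow> f \<in> borel_measurable X \<Longrightarrow> g \<in> borel_measurable X \<Longrightarrow>
       (\<integral>\<^sup>+x. g x * (\<integral>\<^sup>+y. f y \<partial>J k x) \<partial>\<mu>) = (\<integral>\<^sup>+x. f x * (\<integral>\<^sup>+y. g y \<partial>J k x) \<partial>\<mu>)"
    and f: "f \<in> borel_measurable X" "\<And>x. x \<in> space X \<Longrightarrow> 0 \<le> f x" "\<And>x. x \<in> space X \<Longrightarrow> f x \<le> B"
    and g: "g \<in> borel_measurable X" "\<And>x. x \<in> space X \<Longrightarrow> 0 \<le> g x" "\<And>x. x \<in> space X \<Longrightarrow> g x \<le> C"
  shows "(\<integral>x. g x * jump_op r J f x \<partial>\<mu>) = (\<integral>x. f x * jump_op r J g x \<partial>\<mu>)"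
proof -
  have sets: "sets \<mu> = sets X" using \<mu> by (auto simp: space_prob_algebra)
  have sp: "space \<mu> = space X" using sets by (rule sets_eq_imp_space_eq)
  let ?I = "\<lambda>f k x. \<integral>y. f y \<partial>J k x"
  have I: "?I f k \<in> borel_measurable X" "\<And>x. x \<in> space X \<Longrightarrow> 0 \<le> ?I f k x" "\<And>x. x \<in> space X \<Longrightarrow> ?I f k x \<le> B"
    "\<And>x. x \<in> space X \<Longrightarrow> (\<integral>\<^sup>+y. ennreal (f y) \<partial>J k x) = ennreal (?I f k x)"
    if f: "f \<in> borel_measurable X" "\<And>x. x \<in> space X \<Longrightarrow> 0 \<le> f x" "\<And>x. x \<in> space X \<Longrightarrow> f x \<le> B" for f B k
  proof -
    have ab: "\<bar>f x\<bar> \<le> B" if "x \<in> space X" for x using f(2,3)[OF that] by simp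
    show "?I f k \<in> borel_measurable X" by (rule prob_algebra_integral_measurable[OF J f(1)])
    fix x assume x: "x \<in> space X"
    note Jx = measurable_space[OF J x, of k]
    have sp: "space (J k x) = space X" using Jx by (auto simp: space_prob_algebra dest: sets_eq_imp_space_eq)
    show "0 \<le> ?I f k x" using f(2) sp by (intro integral_nonneg_AE AE_I2) auto
    show "?I f k x \<le> B" using prob_algebra_bounded_integral(2)[OF Jx f(1) ab] by simp
    show "(\<integral>\<^sup>+y. ennreal (f y) \<partial>J k x) = ennreal (?I f k x)"
      by (rule nn_integral_eq_integral[OF prob_algebra_bounded_integral(1)[OF Jx f(1) ab]])
        (use f(2) sp in auto)
  qed
  have prod: "integrable \<mu> (\<lambda>x. g x * ?I f k x) \<and>
      (\<integral>\<^sup>+x. ennreal (g x) * (\<integral>\<^sup>+y. ennreal (f y) \<partial>J k x) \<partial>\<mu>) = ennreal (\<integral>x. g x * ?I f k x \<partial>\<mu>)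
      \<and> 0 \<le> (\<integral>x. g x * ?I f k x \<partial>\<mu>)"
    if f: "f \<in> borel_measurable X" "\<And>x. x \<in> space X \<Longrightarrow> 0 \<le> f x" "\<And>x. x \<in> space X \<Longrightarrow> f x \<le> B"
    and g: "g \<in> borel_measurable X" "\<And>x. x \<in> space X \<Longrightarrow> 0 \<le> g x" "\<And>x. x \<in> space X \<Longrightarrow> g x \<le> C" for f g B C k
  proof -
    note If = I[OF f]
    have ab: "\<bar>g x * ?I f k x\<bar> \<le> C * B" if "x \<in> space X" for x
      using mult_mono[OF g(3) If(3)] g(2) If(2) that order_trans[OF g(2) g(3)] by (simp add: abs_mult)
    have int: "integrable \<mu> (\<lambda>x. g x * ?I f k x)"
      by (rule prob_algebra_bounded_integral(1)[OF \<mu> borel_measurable_times[OF g(1) If(1)] ab])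
    have "(\<integral>\<^sup>+x. ennreal (g x) * (\<integral>\<^sup>+y. ennreal (f y) \<partial>J k x) \<partial>\<mu>) = (\<integral>\<^sup>+x. ennreal (g x * ?I f k x) \<partial>\<mu>)"
      using sp g(2) If(4) by (intro nn_integral_cong) (simp add: ennreal_mult')
    also have "\<dots> = ennreal (\<integral>x. g x * ?I f k x \<partial>\<mu>)"
      by (rule nn_integral_eq_integral[OF int]) (use sp g(2) If(2) in auto)
    finally show ?thesis
      using int sp g(2) If(2) by (auto intro!: integral_nonneg_AE)
  qed
  have key: "r k * (\<integral>x. g x * ?I f k x \<partial>\<mu>) = r k * (\<integral>x. f x * ?I g k x \<partial>\<mu>)" for k
  proof (cases "r k = 0")
    case False
    have "(\<integral>\<^sup>+x. ennreal (g x) * (\<integral>\<^sup>+y. ennreal (f y) \<partial>J k x) \<partial>\<mu>) = (\<integral>\<^sup>+x. ennreal (f x) * (\<integral>\<^sup>+y. ennreal (g y) \<partial>J k x) \<partial>\<mu>)"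
      by (rule rev[OF False]) (use f(1) g(1) in auto)
    then show ?thesis
      using prod[OF f g] prod[OF g f] by simp
  qed simp
  moreover have "(\<integral>x. g x * jump_op r J f x \<partial>\<mu>) = (\<Sum>k\<in>UNIV. r k * (\<integral>x. g x * ?I f k x \<partial>\<mu>))"
  proof -
    have "(\<lambda>x. g x * jump_op r J f x) = (\<lambda>x. \<Sum>k\<in>UNIV. r k * (g x * ?I f k x))"
      by (auto simp: jump_op_def sum_distrib_left mult_ac)
    then show ?thesis using prod[OF f g] by simp
  qed
  moreover have "(\<integral>x. f x * jump_op r J g x \<partial>\<mu>) = (\<Sum>k\<in>UNIV. r k * (\<integral>x. f x * ?I g k x \<partial>\<mu>))"
  proof -
    have "(\<lambda>x. f x * jump_op r J g x) = (\<lambda>x. \<Sum>k\<in>UNIV. r k * (f x * ?I g k x))"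
      by (auto simp: jump_op_def sum_distrib_left mult_ac)
    then show ?thesis using prod[OF g f] by simp
  qed
  ultimately show ?thesis by (simp only: key)
qed

text \<open>The factors \<open>N\<close> are carried over from \<open>f\<close> to \<open>g\<close>
  one at a time; positivity keeps the iterates in the class of functions covered by
  \<open>rev\<close>. All Taylor coefficients of the two sides of detailed balance then
  agree.\<close>

lemma (in bounded_generator) reversibleI:
  assumes \<mu>: "\<mu> \<in> space (prob_algebra X)"
    and pos: "\<And>f x. (\<And>x. x \<in> space X \<Longrightarrow> 0 \<le> f x) \<Longrightarrow> x \<in> space X \<Longrightarrow> 0 \<le> N f x"
    and rev: "\<And>f g B C. f \<in> borel_measurable X \<Longrightarrow> (\<And>x. x \<in> space X \<Longrightarrow> 0 \<le> f x) \<Longrightarrow> (\<And>x. x \<in> space X \<Longrightarrow> f x \<le> B) \<Longrightarrow>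
       g \<in> borel_measurable X \<Longrightarrow> (\<And>x. x \<in> space X \<Longrightarrow> 0 \<le> g x) \<Longrightarrow> (\<And>x. x \<in> space X \<Longrightarrow> g x \<le> C) \<Longrightarrow>
       (\<integral>x. g x * N f x \<partial>\<mu>) = (\<integral>x. f x * N g x \<partial>\<mu>)"
  shows "reversible X P \<mu>"
  unfolding reversible_def
proof (intro conjI \<mu> allI impI ballI)
  have iter: "(\<integral>x. g x * (N ^^ n) f x \<partial>\<mu>) = (\<integral>x. f x * (N ^^ n) g x \<partial>\<mu>)"
    if "f \<in> borel_measurable X" "\<And>x. x \<in> space X \<Longrightarrow> 0 \<le> f x" "\<And>x. x \<in> space X \<Longrightarrow> f x \<le> B"
      "g \<in> borel_measurable X" "\<And>x. x \<in> space X \<Longrightarrow> 0 \<le> g x" "\<And>x. x \<in> space X \<Longrightarrow> g x \<le> C"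
    for f g B C n
    using that
  proof (induction n arbitrary: g C)
    case (Suc n)
    have f_abs: "\<bar>f x\<bar> \<le> B" if "x \<in> space X" for x using Suc.prems(2,3)[OF that] by simp
    have g_abs: "\<bar>g x\<bar> \<le> C" if "x \<in> space X" for x using Suc.prems(5,6)[OF that] by simp
    have Nn2: "(N ^^ n) f x \<le> \<Lambda> ^ n * B" if "x \<in> space X" for x
    proof -
      have "\<bar>(N ^^ n) f x\<bar> \<le> \<Lambda> ^ n * B" using jump_iterates[OF Suc.prems(1) f_abs] that by blast
      then show ?thesis by simp
    qed
    have Nn1: "(N ^^ n) f \<in> borel_measurable X" using jump_iterates[OF Suc.prems(1) f_abs] by blast
    have Nn0: "0 \<le> (N ^^ n) f x" if "x \<in> space X" for x
      using that by (induction n arbitrary: x) (auto intro: Suc.prems(2) pos)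
    have Ng1: "N g \<in> borel_measurable X" by (rule jump_measurable[OF Suc.prems(4) g_abs])
    have Ng2: "N g x \<le> \<Lambda> * C" if "x \<in> space X" for x
      using jump_bound[OF Suc.prems(4) g_abs that] by simp
    have Ng3: "0 \<le> N g x" if "x \<in> space X" for x
      by (rule pos[OF Suc.prems(5) that])
    have "(\<integral>x. g x * N ((N ^^ n) f) x \<partial>\<mu>) = (\<integral>x. (N ^^ n) f x * N g x \<partial>\<mu>)"
      by (rule rev[OF Nn1 Nn0 Nn2 Suc.prems(4-6)])
    also have "\<dots> = (\<integral>x. N g x * (N ^^ n) f x \<partial>\<mu>)" by (simp add: mult.commute)
    also have "\<dots> = (\<integral>x. f x * (N ^^ n) (N g) x \<partial>\<mu>)"
      by (rule Suc.IH[OF Suc.prems(1-3) Ng1 Ng3 Ng2])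
    finally show ?case by (simp add: funpow_swap1)
  qed (simp add: mult.commute)
  fix t :: real and A D assume t: "t \<ge> 0" and A: "A \<in> sets X" and D: "D \<in> sets X"
  have sets: "sets \<mu> = sets X" using \<mu> by (auto simp: space_prob_algebra)
  have sp: "space \<mu> = space X" using sets by (rule sets_eq_imp_space_eq)
  let ?i = "\<lambda>A. indicator A :: 'a \<Rightarrow> real"
  let ?p = "\<lambda>D x. \<integral>y. ?i D y \<partial>P t x"
  have i: "?i A \<in> borel_measurable X" "\<And>x. x \<in> space X \<Longrightarrow> \<bar>?i A x\<bar> \<le> 1"
     "\<And>x. x \<in> space X \<Longrightarrow> 0 \<le> ?i A x" "\<And>x. x \<in> space X \<Longrightarrow> ?i A x \<le> 1" if "A \<in> sets X" for A
    using that by (auto simp: indicator_def)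
  have eq: "(\<integral>\<^sup>+x\<in>A. emeasure (P t x) D \<partial>\<mu>) = ennreal (\<integral>x. ?i A x * ?p D x \<partial>\<mu>)"
    if A: "A \<in> sets X" and D: "D \<in> sets X" for A D
  proof -
    have Pm: "(\<lambda>x. \<integral>y. ?i D y \<partial>P t x) \<in> borel_measurable X"
      by (rule prob_algebra_integral_measurable[OF kernel[OF t] i(1)[OF D]])
    have P01: "0 \<le> ?p D x" "\<bar>?p D x\<bar> \<le> 1"
      "emeasure (P t x) D = ennreal (?p D x)" if x: "x \<in> space X" for x
    proof -
      note Px = kernel_space[OF t x]
      show "0 \<le> ?p D x" by (rule integral_nonneg_AE) auto
      show "\<bar>\<integral>y. ?i D y \<partial>P t x\<bar> \<le> 1" by (rule prob_algebra_bounded_integral(2)[OF Px i(1,2)[OF D]])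
      have "D \<in> sets (P t x)" "prob_space (P t x)" using D Px by (auto simp: space_prob_algebra)
      then show "emeasure (P t x) D = ennreal (?p D x)"
        using sets.sets_into_space[of D "P t x"]
        by (simp add: finite_measure.emeasure_eq_measure prob_space.finite_measure Int_absorb2)
    qed
    have "(\<integral>\<^sup>+x\<in>A. emeasure (P t x) D \<partial>\<mu>) = (\<integral>\<^sup>+x. ennreal (?i A x * ?p D x) \<partial>\<mu>)"
      using sp P01(3) by (intro nn_integral_cong) (auto simp: indicator_def)
    also have "\<dots> = ennreal (\<integral>x. ?i A x * ?p D x \<partial>\<mu>)"
    proof (rule nn_integral_eq_integral)
      show "integrable \<mu> (\<lambda>x. ?i A x * ?p D x)"
        by (rule prob_algebra_bounded_integral(1)[OF \<mu> borel_measurable_times[OF i(1)[OF A] Pm], of 1])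
           (use P01(2) in \<open>auto simp: indicator_def\<close>)
      show "AE x in \<mu>. 0 \<le> ?i A x * ?p D x"
        using P01(1) sp by (intro AE_I2) simp
    qed
    finally show ?thesis .
  qed
  have it: "(\<integral>x. ?i A x * (N ^^ j) (?i D) x \<partial>\<mu>) = (\<integral>x. ?i D x * (N ^^ j) (?i A) x \<partial>\<mu>)" for j
    by (rule iter[OF i(1,3,4)[OF D] i(1,3,4)[OF A]])
  have "(\<lambda>j. t ^ j / fact j * (\<integral>x. ?i D x * (N ^^ j) (?i A) x \<partial>\<mu>)) sums (exp (\<Lambda> * t) * (\<integral>x. ?i A x * ?p D x \<partial>\<mu>))"
    unfolding it[symmetric] by (rule taylor_series_integrated[OF \<mu> i(1,2)[OF D] i(1,2)[OF A] t])
  moreover have "(\<lambda>j. t ^ j / fact j * (\<integral>x. ?i D x * (N ^^ j) (?i A) x \<partial>\<mu>)) sums (exp (\<Lambda> * t) * (\<integral>x. ?i D x * ?p A x \<partial>\<mu>))"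
    by (rule taylor_series_integrated[OF \<mu> i(1,2)[OF A] i(1,2)[OF D] t])
  ultimately have "exp (\<Lambda> * t) * (\<integral>x. ?i A x * ?p D x \<partial>\<mu>) = exp (\<Lambda> * t) * (\<integral>x. ?i D x * ?p A x \<partial>\<mu>)"
    by (rule sums_unique2)
  then have "(\<integral>x. ?i A x * ?p D x \<partial>\<mu>) = (\<integral>x. ?i D x * ?p A x \<partial>\<mu>)"
    by simp
  then show "(\<integral>\<^sup>+x\<in>A. emeasure (P t x) D \<partial>\<mu>) = (\<integral>\<^sup>+x\<in>D. emeasure (P t x) A \<partial>\<mu>)"
    by (simp add: eq A D)
qed

lemma (in bounded_generator) reversible_imp_stationary:
  assumes rev: "reversible X P \<mu>"
  shows "stationary X P \<mu>"
  unfolding stationary_def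
proof (intro conjI allI impI)
  show \<mu>: "\<mu> \<in> space (prob_algebra X)" using rev by (simp add: reversible_def)
  fix t :: real assume t: "t \<ge> 0"
  have sets: "sets \<mu> = sets X" using \<mu> by (auto simp: space_prob_algebra)
  have sp: "space \<mu> = space X" using sets by (rule sets_eq_imp_space_eq)
  show "\<mu> \<bind> P t = \<mu>"
  proof (rule measure_eqI)
    show "sets (\<mu> \<bind> P t) = sets \<mu>"
      using sets_bind'[OF \<mu> kernel[OF t]] sets by simp
    fix A assume "A \<in> sets (\<mu> \<bind> P t)"
    then have A: "A \<in> sets X" using sets_bind'[OF \<mu> kernel[OF t]] by simp
    \<comment> \<open>Detailed balance with the whole space as one of the two sets.\<close>
    have "emeasure (\<mu> \<bind> P t) A = (\<integral>\<^sup>+x\<in>space X. emeasure (P t x) A \<partial>\<mu>)"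
      unfolding emeasure_bind_prob_algebra[OF \<mu> kernel[OF t] A] using sp by (intro nn_integral_cong) simp
    also have "\<dots> = (\<integral>\<^sup>+x\<in>A. emeasure (P t x) (space X) \<partial>\<mu>)"
      using rev t A unfolding reversible_def by blast
    also have "\<dots> = (\<integral>\<^sup>+x. indicator A x \<partial>\<mu>)"
      using sp in_space_prob_algebra[OF kernel_space[OF t]] by (intro nn_integral_cong) simp
    also have "\<dots> = emeasure \<mu> A" using A sets by simp
    finally show "emeasure (\<mu> \<bind> P t) A = emeasure \<mu> A" .
  qed
qed

theorem theorem2p3:
  fixes s :: real
    and p :: "'v::finite \<Rightarrow> 'v \<Rightarrow> real"
    and c :: "'v \<Rightarrow> real"
    and \<theta>' :: "'v \<Rightarrow> real"
    and P Q :: "real \<Rightarrow> ('v \<Rightarrow> real) \<Rightarrow> ('v \<Rightarrow> real) measure"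
  assumes s: "s > 0"
    and p_sym: "\<And>i j. p i j = p j i"
    and p_nonneg: "\<And>i j. p i j \<ge> 0"
    and p_irred: "irreducible_weights p"
    and c_nonneg: "\<And>i. c i \<ge> 0"
    and \<theta>'_pos: "\<And>i. \<theta>' i > 0"
    and kmp: "markov_process_with_generator config (kmp_generator s p c \<theta>') P"
    and hidden: "markov_process_with_generator config (hidden_generator s p c \<theta>') Q"
  shows
    "(\<forall>\<theta>. (\<forall>i. \<theta> i > 0) \<longrightarrow>
        (\<forall>t>0. \<nu>_prod s \<theta> \<bind> P t = Q t \<theta> \<bind> \<nu>_prod s)) \<and>
     ((\<exists>i. c i > 0) \<longrightarrow>
        (\<exists>\<Xi>. unique_stationary config Q \<Xi> \<and>
             unique_stationary config P (\<Xi> \<bind> \<nu>_prod s) \<and>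
             converges_to config P (\<Xi> \<bind> \<nu>_prod s))) \<and>
     ((\<exists>i. c i > 0) \<longrightarrow>
        (\<forall>\<theta>0. (\<forall>i. \<theta>' i = \<theta>0) \<longrightarrow>
             unique_stationary config P (\<nu>_prod s (\<lambda>_. \<theta>0)) \<and>
             reversible config P (\<nu>_prod s (\<lambda>_. \<theta>0))))"
proof -
  let ?r = "rate p c"
  let ?J = "kmp_kernel s \<theta>'" and ?H = "hidden_kernel s \<theta>'"
  let ?\<Lambda> = "sum ?r UNIV"
  have rate: "?r k \<ge> 0" for k by (rule rate_nonneg[OF p_nonneg c_nonneg])
  have J: "?J k \<in> config \<rightarrow>\<^sub>M prob_algebra config" for k by (rule measurable_kmp_kernel[OF s \<theta>'_pos])
  have H: "?H k \<in> config \<rightarrow>\<^sub>M prob_algebra config" for k by (rule measurable_hidden_kernel[OF s \<theta>'_pos])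
  have Pg: "bounded_generator config P (jump_op ?r ?J) ?\<Lambda>"
  proof (rule bounded_generator_jump_op[OF kmp _ J rate])
    fix f :: "('v \<Rightarrow> real) \<Rightarrow> real" and B and x :: "'v \<Rightarrow> real"
    assume "f \<in> borel_measurable config" "\<And>x. x \<in> space config \<Longrightarrow> \<bar>f x\<bar> \<le> B" "x \<in> space config"
    then show "kmp_generator s p c \<theta>' f x = jump_op ?r ?J f x - ?\<Lambda> * f x"
      by (rule kmp_generator_eq[OF s \<theta>'_pos])
  qed
  have Qg: "bounded_generator config Q (jump_op ?r ?H) ?\<Lambda>"
  proof (rule bounded_generator_jump_op[OF hidden _ H rate])
    fix f :: "('v \<Rightarrow> real) \<Rightarrow> real" and B and x :: "'v \<Rightarrow> real"
    assume "f \<in> borel_measurable config" "\<And>x. x \<in> space config \<Longrightarrow> \<bar>f x\<bar> \<le> B" "x \<in> space config"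
    then show "hidden_generator s p c \<theta>' f x = jump_op ?r ?H f x - ?\<Lambda> * f x"
      by (rule hidden_generator_eq[OF s \<theta>'_pos])
  qed
  interpret P: bounded_generator config P "jump_op ?r ?J" ?\<Lambda> by (rule Pg)
  interpret Q: bounded_generator config Q "jump_op ?r ?H" ?\<Lambda> by (rule Qg)
  have a: "\<nu>_prod s \<theta> \<bind> P t = Q t \<theta> \<bind> \<nu>_prod s" if "\<And>i. \<theta> i > 0" "t > 0" for \<theta> t
    by (rule duality_semigroup[OF s \<theta>'_pos that(1) Pg Qg]) (use that(2) in simp)
  \<comment> \<open>Stated for arbitrary kernels \<open>G\<close> with the one-move Lipschitz bound,
    so that a single argument covers the energies and the hidden parameters.\<close>
  have attracting: "unique_stationary config R \<pi> \<and> converges_to config R \<pi>"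
    if ex: "\<exists>i. c i > 0" and \<pi>: "stationary config R \<pi>"
      and R: "bounded_generator config R (jump_op ?r G) ?\<Lambda>"
      and G: "\<And>k f B v x y. f \<in> borel_measurable config \<Longrightarrow> (\<And>x. x \<in> space config \<Longrightarrow> \<bar>f x\<bar> \<le> B) \<Longrightarrow>
       (\<And>l. v l \<ge> 0) \<Longrightarrow> (\<And>x y. x \<in> space config \<Longrightarrow> y \<in> space config \<Longrightarrow> \<bar>f x - f y\<bar> \<le> weighted_dist v x y) \<Longrightarrow>
       x \<in> space config \<Longrightarrow> y \<in> space config \<Longrightarrow> (\<And>i. k \<noteq> Inl (i, i)) \<Longrightarrow>
       \<bar>(\<integral>z. f z \<partial>G k x) - (\<integral>z. f z \<partial>G k y)\<bar> \<le> weighted_dist (averaged_weight k v) x y"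
    for R and \<pi> :: "('v \<Rightarrow> real) measure" and G
  proof -
    obtain k where k: "c k > 0" using ex by blast
    have "\<exists>w \<delta>. (\<forall>l. w l > 0) \<and> \<delta> > 0 \<and> \<delta> \<le> ?\<Lambda> \<and>
      (\<forall>l. (\<Sum>k\<in>UNIV. ?r k * averaged_weight k w l) \<le> (?\<Lambda> - \<delta>) * w l)"
      by (rule contracting_weight[where p=p and c=c and k=k, OF p_sym p_nonneg p_irred c_nonneg k])
    then obtain w \<delta> where "(\<forall>l. w l > 0) \<and> \<delta> > 0 \<and> \<delta> \<le> ?\<Lambda> \<and>
      (\<forall>l. (\<Sum>k\<in>UNIV. ?r k * averaged_weight k w l) \<le> (?\<Lambda> - \<delta>) * w l)"
      by (elim exE) (rule that)
    then have w: "w l > 0" and \<delta>: "\<delta> > 0" "\<delta> \<le> ?\<Lambda>"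
      and drift: "(\<Sum>k\<in>UNIV. ?r k * averaged_weight k w l) \<le> (?\<Lambda> - \<delta>) * w l" for l
      by simp_all
    show ?thesis
    proof (rule stationary_unique_and_attracting[OF R \<delta>(1) _ \<pi>])
      fix f :: "('v \<Rightarrow> real) \<Rightarrow> real" and L B
      assume lip: "config_lipschitz L f" and B: "\<And>x. x \<in> space config \<Longrightarrow> \<bar>f x\<bar> \<le> B"
      have f: "f \<in> borel_measurable config"
        by (rule continuous_on_config_measurable[OF config_lipschitz_continuous[OF lip]])
      obtain C where C: "C \<ge> 0" and fC: "\<And>x y. x \<in> space config \<Longrightarrow> y \<in> space config \<Longrightarrow> \<bar>f x - f y\<bar> \<le> C * weighted_dist w x y"
        using config_lipschitz_weighted[where w=w and f=f and L=L, OF w lip] by (elim exE conjE) (rule that, auto)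
      have q: "0 \<le> ?\<Lambda> - \<delta>" using \<delta> by simp
      have "\<bar>(\<integral>z. f z \<partial>R t x) - (\<integral>z. f z \<partial>R t y)\<bar> \<le> C * weighted_dist w x y * exp (- \<delta> * t)"
        if x: "x \<in> space config" and y: "y \<in> space config" and t: "t \<ge> 0" for x y t
      proof -
        have it: "\<bar>(jump_op ?r G ^^ n) f x - (jump_op ?r G ^^ n) f y\<bar> \<le> (C * weighted_dist w x y) * (?\<Lambda> - \<delta>) ^ n" for n
        proof (rule jump_op_iterates_lipschitz[OF R rate _ w q drift f B C fC x y])
          fix k :: "'v move" and f :: "('v \<Rightarrow> real) \<Rightarrow> real" and B v and x y :: "'v \<Rightarrow> real"
          assume "f \<in> borel_measurable config" "\<And>x. x \<in> space config \<Longrightarrow> \<bar>f x\<bar> \<le> B"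
            "\<And>l. v l \<ge> 0" "\<And>x y. x \<in> space config \<Longrightarrow> y \<in> space config \<Longrightarrow> \<bar>f x - f y\<bar> \<le> weighted_dist v x y"
            "x \<in> space config" "y \<in> space config" "\<And>i. k \<noteq> Inl (i, i)"
          then show "\<bar>(\<integral>z. f z \<partial>G k x) - (\<integral>z. f z \<partial>G k y)\<bar> \<le> weighted_dist (averaged_weight k v) x y"
            by (rule G)
        qed
        have "- (?\<Lambda> - (?\<Lambda> - \<delta>)) * t = - \<delta> * t" by simp
        with bounded_generator.semigroup_contraction[OF R f B x y t it] show ?thesis by (simp only:)
      qed
      then show "\<exists>S. \<forall>x\<in>space config. \<forall>y\<in>space config. \<forall>t\<ge>0.
         \<bar>(\<integral>z. f z \<partial>R t x) - (\<integral>z. f z \<partial>R t y)\<bar> \<le> S x y * exp (- \<delta> * t)"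
        by (intro exI[of _ "\<lambda>x y. C * weighted_dist w x y"] ballI allI impI)
    qed
  qed
  have attractingP: "unique_stationary config P \<pi> \<and> converges_to config P \<pi>"
    if "\<exists>i. c i > 0" "stationary config P \<pi>" for \<pi>
    by (rule attracting[OF that Pg]) (rule kmp_kernel_lipschitz[OF s \<theta>'_pos])
  have attractingQ: "unique_stationary config Q \<pi> \<and> converges_to config Q \<pi>"
    if "\<exists>i. c i > 0" "stationary config Q \<pi>" for \<pi>
    by (rule attracting[OF that Qg]) (rule hidden_kernel_lipschitz[OF s \<theta>'_pos])
  have b: "\<exists>\<Xi>. unique_stationary config Q \<Xi> \<and> unique_stationary config P (\<Xi> \<bind> \<nu>_prod s) \<and>
       converges_to config P (\<Xi> \<bind> \<nu>_prod s)" if ex: "\<exists>i. c i > 0"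
  proof -
    obtain k where k: "c k > 0" using ex by blast
    \<comment> \<open>A reservoir with positive coupling makes the total rate positive, as needed to
      normalise the law of the next move.\<close>
    have "0 < ?r (Inr k)" using k by simp
    also have "\<dots> \<le> ?\<Lambda>" using rate by (intro member_le_sum) auto
    finally have total: "?\<Lambda> > 0" .
    obtain \<Xi> where \<Xi>: "\<Xi> \<in> space (prob_algebra config)" and pos: "AE \<theta> in \<Xi>. \<forall>i. \<theta> i > 0"
      and inv: "\<And>f B. f \<in> borel_measurable config \<Longrightarrow> (\<And>x. x \<in> space config \<Longrightarrow> \<bar>f x\<bar> \<le> B) \<Longrightarrow>
        (\<integral>\<theta>. jump_op ?r ?H f \<theta> \<partial>\<Xi>) = ?\<Lambda> * (\<integral>\<theta>. f \<theta> \<partial>\<Xi>)"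
      by (rule hidden_invariant_law[where s=s and \<theta>'=\<theta>' and p=p and c=c, OF s \<theta>'_pos rate total]) (rule that; blast)
    have Q_stat: "stationary config Q \<Xi>" by (rule Q.stationaryI[OF \<Xi> inv])
    note K = measurable_\<nu>_prod[OF s]
    have \<Xi>K: "\<Xi> \<bind> \<nu>_prod s \<in> space (prob_algebra config)"
      using prob_space_bind'[OF \<Xi> K] sets_bind'[OF \<Xi> K] by (simp add: space_prob_algebra)
    \<comment> \<open>Integrals against the mixture are \<Xi>-integrals of \<open>?K\<close>;
      intertwining carries the jump operator across \<open>?K\<close> for \<Xi>-almost every
      \<theta>, namely the positive ones, and then the invariance of \<Xi> applies.\<close>
    have P_stat: "stationary config P (\<Xi> \<bind> \<nu>_prod s)"
    proof (rule P.stationaryI[OF \<Xi>K])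
      fix f :: "('v \<Rightarrow> real) \<Rightarrow> real" and B
      assume f: "f \<in> borel_measurable config" and B: "\<And>x. x \<in> space config \<Longrightarrow> \<bar>f x\<bar> \<le> B"
      let ?K = "\<lambda>f \<eta>. \<integral>\<zeta>. f \<zeta> \<partial>\<nu>_prod s \<eta>"
      have Kf: "?K f \<in> borel_measurable config" "\<And>x. x \<in> space config \<Longrightarrow> \<bar>?K f x\<bar> \<le> B"
        by (rule prob_algebra_integral_measurable[OF K f])
           (rule prob_algebra_bounded_integral(2)[OF measurable_space[OF K] f B])
      note Nf = P.jump_measurable[OF f B] P.jump_bound[OF f B]
      have sets: "sets \<Xi> = sets config" using \<Xi> by (simp add: space_prob_algebra)
      have "(\<integral>x. jump_op ?r ?J f x \<partial>(\<Xi> \<bind> \<nu>_prod s)) = (\<integral>\<theta>. ?K (jump_op ?r ?J f) \<theta> \<partial>\<Xi>)"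
        by (rule prob_algebra_integral_bind[OF \<Xi> K Nf])
      also have "\<dots> = (\<integral>\<theta>. jump_op ?r ?H (?K f) \<theta> \<partial>\<Xi>)"
      proof (rule integral_cong_AE)
        show "?K (jump_op ?r ?J f) \<in> borel_measurable \<Xi>"
          using prob_algebra_integral_measurable[OF K Nf(1)] measurable_cong_sets[OF sets refl] by blast
        show "jump_op ?r ?H (?K f) \<in> borel_measurable \<Xi>"
          using Q.jump_measurable[OF Kf] measurable_cong_sets[OF sets refl] by blast
        show "AE \<theta> in \<Xi>. ?K (jump_op ?r ?J f) \<theta> = jump_op ?r ?H (?K f) \<theta>"
          using pos by eventually_elim (rule jump_op_intertwining[OF s \<theta>'_pos _ f B], blast)
      qed
      also have "\<dots> = ?\<Lambda> * (\<integral>\<theta>. ?K f \<theta> \<partial>\<Xi>)" by (rule inv[OF Kf])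
      also have "(\<integral>\<theta>. ?K f \<theta> \<partial>\<Xi>) = (\<integral>x. f x \<partial>(\<Xi> \<bind> \<nu>_prod s))"
        by (rule prob_algebra_integral_bind[OF \<Xi> K f B, symmetric])
      finally show "(\<integral>x. jump_op ?r ?J f x \<partial>(\<Xi> \<bind> \<nu>_prod s)) = ?\<Lambda> * (\<integral>x. f x \<partial>(\<Xi> \<bind> \<nu>_prod s))" .
    qed
    have uP: "unique_stationary config P (\<Xi> \<bind> \<nu>_prod s) \<and> converges_to config P (\<Xi> \<bind> \<nu>_prod s)"
      by (rule attractingP[OF ex P_stat])
    have uQ: "unique_stationary config Q \<Xi> \<and> converges_to config Q \<Xi>"
      by (rule attractingQ[OF ex Q_stat])
    show ?thesis
      by (rule exI[of _ \<Xi>], rule conjI[OF conjunct1[OF uQ] uP])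
  qed
  have c: "unique_stationary config P (\<nu>_prod s (\<lambda>_. \<theta>0)) \<and> reversible config P (\<nu>_prod s (\<lambda>_. \<theta>0))"
    if ex: "\<exists>i. c i > 0" and eq: "\<And>i. \<theta>' i = \<theta>0" for \<theta>0
  proof -
    have \<theta>0: "\<theta>0 > 0" using \<theta>'_pos eq by metis
    let ?\<mu> = "\<nu>_prod s (\<lambda>_. \<theta>0) :: ('v \<Rightarrow> real) measure"
    have \<mu>: "?\<mu> \<in> space (prob_algebra config)"
      by (rule \<nu>_prod_space[OF s]) (use \<theta>0 in simp)
    \<comment> \<open>A nonzero rate rules out the diagonal pairs, for which the two-site identity
      says nothing.\<close>
    have rev_nn: "(\<integral>\<^sup>+\<zeta>. g \<zeta> * (\<integral>\<^sup>+x. f x \<partial>?J k \<zeta>) \<partial>?\<mu>) = (\<integral>\<^sup>+\<zeta>. f \<zeta> * (\<integral>\<^sup>+x. g x \<partial>?J k \<zeta>) \<partial>?\<mu>)"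
      if k: "?r k \<noteq> 0" and f: "f \<in> borel_measurable config" and g: "g \<in> borel_measurable config" for k f g
    proof (cases k)
      case (Inl q)
      obtain i j where q: "q = (i, j)" by (cases q)
      then have "i \<noteq> j" using k Inl by (auto split: if_splits)
      then show ?thesis
        unfolding Inl q by (rule kmp_reversible_bulk[OF s \<theta>'_pos \<theta>0 f g])
    next
      case (Inr i)
      show ?thesis unfolding Inr by (rule kmp_reversible_site[OF s eq \<theta>0 f g])
    qed
    have rev: "(\<integral>x. g x * jump_op ?r ?J f x \<partial>?\<mu>) = (\<integral>x. f x * jump_op ?r ?J g x \<partial>?\<mu>)"
      if f: "f \<in> borel_measurable config" "\<And>x. x \<in> space config \<Longrightarrow> 0 \<le> f x" "\<And>x. x \<in> space config \<Longrightarrow> f x \<le> B"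
      and g: "g \<in> borel_measurable config" "\<And>x. x \<in> space config \<Longrightarrow> 0 \<le> g x" "\<And>x. x \<in> space config \<Longrightarrow> g x \<le> C" for f g B C
      by (rule jump_op_reversible[where r="?r" and J="?J" and X=config and \<mu>="?\<mu>" and f=f and g=g and B=B and C=C])
        (erule (2) rev_nn | rule J rate \<mu> f g | assumption)+
    have pos: "0 \<le> jump_op ?r ?J f x"
      if f0: "\<And>x. x \<in> space config \<Longrightarrow> 0 \<le> f x" and x: "x \<in> space config" for f and x :: "'v \<Rightarrow> real"
    proof -
      have "0 \<le> (\<integral>y. f y \<partial>?J k x)" for k
      proof (intro integral_nonneg_AE AE_I2)
        fix y assume y: "y \<in> space (?J k x)"
        have "sets (?J k x) = sets config"
          using measurable_space[OF J[of k] x] unfolding space_prob_algebra by blast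
        then have "space (?J k x) = space config" by (rule sets_eq_imp_space_eq)
        with y have "y \<in> space config" by (simp only:)
        then show "0 \<le> f y" by (rule f0)
      qed
      then show ?thesis
        unfolding jump_op_def by (intro sum_nonneg mult_nonneg_nonneg rate)
    qed
    have "reversible config P ?\<mu>"
    proof (rule P.reversibleI)
      show "?\<mu> \<in> space (prob_algebra config)" by (rule \<mu>)
    next
      fix f :: "('v \<Rightarrow> real) \<Rightarrow> real" and x :: "'v \<Rightarrow> real"
      assume "\<And>x. x \<in> space config \<Longrightarrow> 0 \<le> f x" "x \<in> space config"
      then show "0 \<le> jump_op ?r ?J f x" by (rule pos)
    next
      fix f g :: "('v \<Rightarrow> real) \<Rightarrow> real" and B C :: real
      assume "f \<in> borel_measurable config" "\<And>x. x \<in> space config \<Longrightarrow> 0 \<le> f x" "\<And>x. x \<in> space config \<Longrightarrow> f x \<le> B"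
        "g \<in> borel_measurable config" "\<And>x. x \<in> space config \<Longrightarrow> 0 \<le> g x" "\<And>x. x \<in> space config \<Longrightarrow> g x \<le> C"
      then show "(\<integral>x. g x * jump_op ?r ?J f x \<partial>?\<mu>) = (\<integral>x. f x * jump_op ?r ?J g x \<partial>?\<mu>)" by (rule rev)
    qed
    \<comment> \<open>Reversibility yields stationarity, and uniqueness comes from the contraction,
      so the mixture of part (b) need not be identified by hand.\<close>
    then show ?thesis using attractingP[OF ex P.reversible_imp_stationary] by blast
  qed
  show ?thesis using a b c by blast
qed

end
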